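(* Let $(\mathcal{C},\mathbb{E},\mathfrak{s})$ be a small $R$-linear extriangulated category with enough projective morphisms. Then $(\mathbb{E}_{\mathrm{I}}^{\bullet},\delta_\sharp)$ is a $\delta$-functor on $(\mathcal{C},\mathbb{E},\mathfrak{s})$, i.e. for every $\mathfrak{s}$-triangle $A\xrightarrow{x}B\xrightarrow{y}C\overset{\delta}{\dashrightarrow}$ the sequence $$\cdots\xrightarrow{\delta_\sharp}\mathbb{E}_{\mathrm{I}}^{n}(-,A)\xrightarrow{x_*}\mathbb{E}_{\mathrm{I}}^{n}(-,B)\xrightarrow{y_*}\mathbb{E}_{\mathrm{I}}^{n}(-,C)\xrightarrow{\delta_\sharp}\mathbb{E}_{\mathrm{I}}^{n+1}(-,A)\to\cdots\qquad(n\in\mathbb{Z})$$ is exact in $\mathrm{Mod}\,\mathcal{C}$.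
   Context: $R$ is a commutative ring with $1$; $\mathcal{C}$ is an additive $R$-linear category. Extriangulated categories: let $\mathbb{E}\colon\mathcal{C}^{\mathrm{op}}\times\mathcal{C}\to\mathrm{Mod}\,R$ be an $R$-bilinear functor. An element $\delta\in\mathbb{E}(C,A)$ is called an extension; for $a\colon A\to A'$ and $c\colon C'\to C$ put $a_*\delta=\mathbb{E}(C,a)(\delta)$ and $c^*\delta=\mathbb{E}(c,A)(\delta)$. A morphism of extensions from $\delta\in\mathbb{E}(C,A)$ to $\delta'\in\mathbb{E}(C',A')$ is a pair $(a\colon A\to A',\,c\colon C\to C')$ with $a_*\delta=c^*\delta'$. The extension $\delta\oplus\delta'\in\mathbb{E}(C\oplus C',A\oplus A')$ is the one with diagonal components $\delta,\delta'$ and zero off-diagonal components. Sequences $A\xrightarrow{x}B\xrightarrow{y}C$ and $A\xrightarrow{x'}B'\xrightarrow{y'}C$ are equivalent if there is an isomorphism $b\colon B\to B'$ with $bx=x'$, $y'b=y$; the class is written $[A\xrightarrow{x}B\xrightarrow{y}C]$. An additive realization $\mathfrak{s}$ assigns to each $\delta\in\mathbb{E}(C,A)$ such a class $\mathfrak{s}(\delta)=[A\xrightarrow{x}B\xrightarrow{y}C]$ so that: for each morphism $(a,c)\colon\delta\to\delta'$ with $\mathfrak{s}(\delta')=[A'\xrightarrow{x'}B'\xrightarrow{y'}C']$ there is $b\colon B\to B'$ with $bx=x'a$, $y'b=cy$; $\mathfrak{s}(0)=[A\to A\oplus C\to C]$ (canonical maps); and $\mathfrak{s}(\delta\oplus\delta')=\mathfrak{s}(\delta)\oplus\mathfrak{s}(\delta')$.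 The triple $(\mathcal{C},\mathbb{E},\mathfrak{s})$ is an ($R$-linear) extriangulated category if moreover: (ET3) if $\mathfrak{s}(\delta)=[A\xrightarrow{x}B\xrightarrow{y}C]$, $\mathfrak{s}(\delta')=[A'\xrightarrow{x'}B'\xrightarrow{y'}C']$ and $bx=x'a$, then there is $c$ with $cy=y'b$ and $a_*\delta=c^*\delta'$; (ET3)$^{\mathrm{op}}$ the dual; (ET4) if $\delta\in\mathbb{E}(D,A)$ and $\delta'\in\mathbb{E}(F,B)$ are realized by $A\xrightarrow{f}B\xrightarrow{f'}D$ and $B\xrightarrow{g}C\xrightarrow{g'}F$, then there are an object $E$, morphisms $d\colon D\to E$, $e\colon E\to F$, $h=gf$, $h'\colon C\to E$ with $h'g=df'$, $eh'=g'$, and $\delta''\in\mathbb{E}(E,A)$ realized by $A\xrightarrow{h}C\xrightarrow{h'}E$, such that $D\xrightarrow{d}E\xrightarrow{e}F$ realizes $f'_*\delta'$, $d^*\delta''=\delta$ and $f_*\delta''=e^*\delta'$; (ET4)$^{\mathrm{op}}$ the dual. If $\mathfrak{s}(\delta)=[A\xrightarrow{x}B\xrightarrow{y}C]$ one writes $A\xrightarrow{x}B\xrightarrow{y}C\overset{\delta}{\dashrightarrow}$ and calls it an $\mathfrak{s}$-triangle; $x$ is an inflation, $y$ a deflation, $A\to B\to C$ a conflation. A morphism $f$ is projective if $\mathbb{E}(f,-)=0$. There are enough projective morphisms if every object $C$ admits a deflation $G\to C$ which is a projective morphism. $\mathrm{Mod}\,\mathcal{C}$ (resp. $\mathcal{C}\,\mathrm{Mod}$)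 is the category of $R$-linear functors $\mathcal{C}^{\mathrm{op}}\to\mathrm{Mod}\,R$ (resp. $\mathcal{C}\to\mathrm{Mod}\,R$). For $\mathcal{C}$ small, positive extensions are defined by $\mathbb{E}^0=\mathcal{C}(-,-)$, $\mathbb{E}^1=\mathbb{E}$ and inductively by the coend $\mathbb{E}^n(X,Y)=\int^{M\in\mathcal{C}}\mathbb{E}^{n-1}(M,Y)\otimes_R\mathbb{E}(X,M)$; there are natural isomorphisms $\mathbb{E}^{s+t}(X,Y)\cong\int^{M}\mathbb{E}^s(M,Y)\otimes_R\mathbb{E}^t(X,M)$. Write $\rho\cup\lambda\in\mathbb{E}^{s+t}(X,Y)$ for the class of $\rho\otimes\lambda$, $\rho\in\mathbb{E}^s(M,Y)$, $\lambda\in\mathbb{E}^t(X,M)$. For $\delta\in\mathbb{E}(C,A)$ and $n\ge0$, $\delta_\sharp\colon\mathbb{E}^n(-,C)\to\mathbb{E}^{n+1}(-,A)$ is $\lambda\mapsto\delta\cup\lambda$ and $\delta^\sharp\colon\mathbb{E}^n(A,-)\to\mathbb{E}^{n+1}(C,-)$ is $\lambda\mapsto\lambda\cup\delta$; for $n=0$ these are $f\mapsto f^*\delta$ and $f\mapsto f_*\delta$. Negative extensions: for $n\ge0$ put $\mathbb{E}_{\mathrm{I}}^{-n}(C,A)=(\mathcal{C}\,\mathrm{Mod})(\mathbb{E}^n(A,-),\mathcal{C}(C,-))$, an $R$-bilinear functor of $(C,A)$ ($\mathbb{E}_{\mathrm{I}}^0=\mathcal{C}(-,-)$ by Yoneda),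 and $\mathbb{E}_{\mathrm{I}}^{n}=\mathbb{E}^n$ for $n>0$. For $\delta\in\mathbb{E}(C,A)$ and $n\ge0$, $\delta_\sharp\colon\mathbb{E}_{\mathrm{I}}^{-(n+1)}(-,C)\to\mathbb{E}_{\mathrm{I}}^{-n}(-,A)$ is precomposition with $\delta^\sharp\colon\mathbb{E}^n(A,-)\to\mathbb{E}^{n+1}(C,-)$; in non-negative degrees $\delta_\sharp$ is the map $\delta_\sharp$ of $\mathbb{E}^n$. *)

theory Defs
  imports "HOL-Algebra.Module" "HOL-Library.Multiset" "HOL-Library.FuncSet"
begin

text \<open>
  Modules are those of HOL-Algebra; their ring fields \<open>mult\<close> and \<open>one\<close> carry no information and
  are left \<open>undefined\<close> in the modules constructed below.
\<close>

definition linear_map ::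
  "'r ring \<Rightarrow> ('r, 'a) module \<Rightarrow> ('r, 'b) module \<Rightarrow> ('a \<Rightarrow> 'b) \<Rightarrow> bool" where
  "linear_map R M N f \<longleftrightarrow>
     f \<in> carrier M \<rightarrow> carrier N \<and>
     (\<forall>u\<in>carrier M. \<forall>v\<in>carrier M. f (u \<oplus>\<^bsub>M\<^esub> v) = f u \<oplus>\<^bsub>N\<^esub> f v) \<and>
     (\<forall>r\<in>carrier R. \<forall>u\<in>carrier M. f (r \<odot>\<^bsub>M\<^esub> u) = r \<odot>\<^bsub>N\<^esub> f u)"

definition bilinear_map ::
  "'r ring \<Rightarrow> ('r, 'a) module \<Rightarrow> ('r, 'b) module \<Rightarrow> ('r, 'c) module \<Rightarrow> ('a \<Rightarrow> 'b \<Rightarrow> 'c) \<Rightarrow> bool" where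
  "bilinear_map R M N P f \<longleftrightarrow>
     (\<forall>u\<in>carrier M. linear_map R N P (f u)) \<and>
     (\<forall>v\<in>carrier N. linear_map R M P (\<lambda>u. f u v))"

text \<open>Transport of a module structure along a map that is injective on the carrier.\<close>

definition image_module :: "('a \<Rightarrow> 'b) \<Rightarrow> ('r, 'a) module \<Rightarrow> ('r, 'b) module" where
  "image_module g M =
     \<lparr> carrier = g ` carrier M, monoid.mult = undefined, one = undefined, zero = g \<zero>\<^bsub>M\<^esub>,
       add = (\<lambda>u v. g (inv_into (carrier M) g u \<oplus>\<^bsub>M\<^esub> inv_into (carrier M) g v)),
       smult = (\<lambda>r u. g (r \<odot>\<^bsub>M\<^esub> inv_into (carrier M) g u)) \<rparr>"


section \<open>Linear categories with a bifunctor and a realization\<close>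

text \<open>
  The objects are all elements of the type \<open>'o\<close>, so the categories are small. Hom sets need not be
  disjoint: composition and the actions below are indexed by objects.
  \<^item> \<open>Comp K X Y Z g f\<close> is the composite of \<open>f : X \<rightarrow> Y\<close> and \<open>g : Y \<rightarrow> Z\<close>.
  \<^item> \<open>EE K C A\<close> is \<open>\<bbbE>(C, A)\<close>; for \<open>c : C' \<rightarrow> C\<close> and \<open>a : A \<rightarrow> A'\<close>,
    \<open>Act K C' C A A' c a\<close> is \<open>\<bbbE>(c, a) : \<bbbE>(C, A) \<rightarrow> \<bbbE>(C', A')\<close>.
  \<^item> \<open>Real K C A \<delta>\<close> is the class \<open>\<s>(\<delta>)\<close>, a set of triples \<open>(B, x, y)\<close>
    standing for sequences \<open>A \<rightarrow> B \<rightarrow> C\<close>.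
\<close>

record ('r, 'o, 'm, 'e) ecat =
  Hom   :: "'o \<Rightarrow> 'o \<Rightarrow> ('r, 'm) module"
  Comp  :: "'o \<Rightarrow> 'o \<Rightarrow> 'o \<Rightarrow> 'm \<Rightarrow> 'm \<Rightarrow> 'm"
  Ident :: "'o \<Rightarrow> 'm"
  EE    :: "'o \<Rightarrow> 'o \<Rightarrow> ('r, 'e) module"
  Act   :: "'o \<Rightarrow> 'o \<Rightarrow> 'o \<Rightarrow> 'o \<Rightarrow> 'm \<Rightarrow> 'm \<Rightarrow> 'e \<Rightarrow> 'e"
  Real  :: "'o \<Rightarrow> 'o \<Rightarrow> 'e \<Rightarrow> ('o \<times> 'm \<times> 'm) set"

abbreviation mor :: "('r, 'o, 'm, 'e) ecat \<Rightarrow> 'o \<Rightarrow> 'o \<Rightarrow> 'm set" where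
  "mor K X Y \<equiv> carrier (Hom K X Y)"

text \<open>\<open>a\<^sub>*\<delta>\<close> for \<open>\<delta> \<in> \<bbbE>(C, A)\<close>, \<open>a : A \<rightarrow> A'\<close>.\<close>

definition push :: "('r, 'o, 'm, 'e) ecat \<Rightarrow> 'o \<Rightarrow> 'o \<Rightarrow> 'o \<Rightarrow> 'm \<Rightarrow> 'e \<Rightarrow> 'e" where
  "push K C A A' a \<delta> = Act K C C A A' (Ident K C) a \<delta>"

text \<open>\<open>c\<^sup>*\<delta>\<close> for \<open>c : C' \<rightarrow> C\<close>, \<open>\<delta> \<in> \<bbbE>(C, A)\<close>.\<close>

definition pull :: "('r, 'o, 'm, 'e) ecat \<Rightarrow> 'o \<Rightarrow> 'o \<Rightarrow> 'o \<Rightarrow> 'm \<Rightarrow> 'e \<Rightarrow> 'e" where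
  "pull K C' C A c \<delta> = Act K C' C A A c (Ident K A) \<delta>"

locale linear_category = cring R for R :: "'r ring" (structure) +
  fixes K :: "('r, 'o, 'm, 'e) ecat"
  assumes hom_module: "module R (Hom K X Y)"
    and comp_bilinear: "bilinear_map R (Hom K Y Z) (Hom K X Y) (Hom K X Z) (Comp K X Y Z)"
    and ident_mor: "Ident K X \<in> mor K X X"
    and comp_ident_left: "f \<in> mor K X Y \<Longrightarrow> Comp K X Y Y (Ident K Y) f = f"
    and comp_ident_right: "f \<in> mor K X Y \<Longrightarrow> Comp K X X Y f (Ident K X) = f"
    and comp_assoc: "f \<in> mor K W X \<Longrightarrow> g \<in> mor K X Y \<Longrightarrow> h \<in> mor K Y Z \<Longrightarrow>
      Comp K W Y Z h (Comp K W X Y g f) = Comp K W X Z (Comp K X Y Z h g) f"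

definition zero_object :: "('r, 'o, 'm, 'e) ecat \<Rightarrow> 'o \<Rightarrow> bool" where
  "zero_object K Z \<longleftrightarrow> (\<forall>X. (\<exists>!f. f \<in> mor K X Z) \<and> (\<exists>!f. f \<in> mor K Z X))"

record ('o, 'm) biprod =
  Sm  :: 'o
  In1 :: 'm
  In2 :: 'm
  Pr1 :: 'm
  Pr2 :: 'm

definition biproduct :: "('r, 'o, 'm, 'e) ecat \<Rightarrow> 'o \<Rightarrow> 'o \<Rightarrow> ('o, 'm) biprod \<Rightarrow> bool" where
  "biproduct K X Y P \<longleftrightarrow>
     In1 P \<in> mor K X (Sm P) \<and> In2 P \<in> mor K Y (Sm P) \<and>
     Pr1 P \<in> mor K (Sm P) X \<and> Pr2 P \<in> mor K (Sm P) Y \<and>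
     Comp K X (Sm P) X (Pr1 P) (In1 P) = Ident K X \<and>
     Comp K Y (Sm P) Y (Pr2 P) (In2 P) = Ident K Y \<and>
     Comp K Y (Sm P) X (Pr1 P) (In2 P) = \<zero>\<^bsub>Hom K Y X\<^esub> \<and>
     Comp K X (Sm P) Y (Pr2 P) (In1 P) = \<zero>\<^bsub>Hom K X Y\<^esub> \<and>
     Comp K (Sm P) X (Sm P) (In1 P) (Pr1 P) \<oplus>\<^bsub>Hom K (Sm P) (Sm P)\<^esub>
       Comp K (Sm P) Y (Sm P) (In2 P) (Pr2 P) = Ident K (Sm P)"

locale additive_category = linear_category +
  assumes ex_zero_object: "\<exists>Z. zero_object K Z"
    and ex_biproduct: "\<exists>P. biproduct K X Y P"

text \<open>\<open>f \<oplus> g : X \<oplus> Y \<rightarrow> X' \<oplus> Y'\<close> with respect to biproducts \<open>P\<close> and \<open>P'\<close>.\<close>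

definition dsum_mor ::
  "('r, 'o, 'm, 'e) ecat \<Rightarrow> 'o \<Rightarrow> 'o \<Rightarrow> ('o, 'm) biprod \<Rightarrow> 'o \<Rightarrow> 'o \<Rightarrow> ('o, 'm) biprod \<Rightarrow>
   'm \<Rightarrow> 'm \<Rightarrow> 'm" where
  "dsum_mor K X Y P X' Y' P' f g =
     Comp K (Sm P) X (Sm P') (Comp K X X' (Sm P') (In1 P') f) (Pr1 P)
     \<oplus>\<^bsub>Hom K (Sm P) (Sm P')\<^esub>
     Comp K (Sm P) Y (Sm P') (Comp K Y Y' (Sm P') (In2 P') g) (Pr2 P)"

definition isomorphism :: "('r, 'o, 'm, 'e) ecat \<Rightarrow> 'o \<Rightarrow> 'o \<Rightarrow> 'm \<Rightarrow> bool" where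
  "isomorphism K X Y f \<longleftrightarrow> f \<in> mor K X Y \<and>
     (\<exists>g\<in>mor K Y X. Comp K X Y X g f = Ident K X \<and> Comp K Y X Y f g = Ident K Y)"


section \<open>Extriangulated categories\<close>

locale bilinear_ext = additive_category +
  assumes ext_module: "module R (EE K C A)"
    and act_linear: "c \<in> mor K C' C \<Longrightarrow> a \<in> mor K A A' \<Longrightarrow>
      linear_map R (EE K C A) (EE K C' A') (Act K C' C A A' c a)"
    and act_ident: "\<delta> \<in> carrier (EE K C A) \<Longrightarrow> Act K C C A A (Ident K C) (Ident K A) \<delta> = \<delta>"
    and act_comp: "c \<in> mor K C' C \<Longrightarrow> c' \<in> mor K C'' C' \<Longrightarrow>
      a \<in> mor K A A' \<Longrightarrow> a' \<in> mor K A' A'' \<Longrightarrow> \<delta> \<in> carrier (EE K C A) \<Longrightarrow>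
      Act K C'' C A A'' (Comp K C'' C' C c c') (Comp K A A' A'' a' a) \<delta> =
      Act K C'' C' A' A'' c' a' (Act K C' C A A' c a \<delta>)"
    and act_bilinear: "\<delta> \<in> carrier (EE K C A) \<Longrightarrow>
      bilinear_map R (Hom K C' C) (Hom K A A') (EE K C' A') (\<lambda>c a. Act K C' C A A' c a \<delta>)"

definition ext_morphism ::
  "('r, 'o, 'm, 'e) ecat \<Rightarrow> 'o \<Rightarrow> 'o \<Rightarrow> 'e \<Rightarrow> 'o \<Rightarrow> 'o \<Rightarrow> 'e \<Rightarrow> 'm \<Rightarrow> 'm \<Rightarrow> bool" where
  "ext_morphism K C A \<delta> C' A' \<delta>' a c \<longleftrightarrow>
     a \<in> mor K A A' \<and> c \<in> mor K C C' \<and> push K C A A' a \<delta> = pull K C C' A' c \<delta>'"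

text \<open>\<open>\<epsilon> = \<delta> \<oplus> \<delta>'\<close> in \<open>\<bbbE>(C \<oplus> C', A \<oplus> A')\<close>,
  for biproducts \<open>PC\<close> of \<open>C, C'\<close> and \<open>PA\<close> of \<open>A, A'\<close>.\<close>

definition ext_dsum ::
  "('r, 'o, 'm, 'e) ecat \<Rightarrow> 'o \<Rightarrow> 'o \<Rightarrow> ('o, 'm) biprod \<Rightarrow> 'o \<Rightarrow> 'o \<Rightarrow> ('o, 'm) biprod \<Rightarrow>
   'e \<Rightarrow> 'e \<Rightarrow> 'e \<Rightarrow> bool" where
  "ext_dsum K C C' PC A A' PA \<delta> \<delta>' \<epsilon> \<longleftrightarrow>
     \<epsilon> \<in> carrier (EE K (Sm PC) (Sm PA)) \<and>
     Act K C (Sm PC) (Sm PA) A (In1 PC) (Pr1 PA) \<epsilon> = \<delta> \<and>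
     Act K C' (Sm PC) (Sm PA) A' (In2 PC) (Pr2 PA) \<epsilon> = \<delta>' \<and>
     Act K C (Sm PC) (Sm PA) A' (In1 PC) (Pr2 PA) \<epsilon> = \<zero>\<^bsub>EE K C A'\<^esub> \<and>
     Act K C' (Sm PC) (Sm PA) A (In2 PC) (Pr1 PA) \<epsilon> = \<zero>\<^bsub>EE K C' A\<^esub>"

definition seqs :: "('r, 'o, 'm, 'e) ecat \<Rightarrow> 'o \<Rightarrow> 'o \<Rightarrow> ('o \<times> 'm \<times> 'm) set" where
  "seqs K A C = {(B, x, y). x \<in> mor K A B \<and> y \<in> mor K B C}"

definition seq_equiv :: "('r, 'o, 'm, 'e) ecat \<Rightarrow> 'o \<Rightarrow> 'o \<Rightarrow> (('o \<times> 'm \<times> 'm) \<times> ('o \<times> 'm \<times> 'm)) set" where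
  "seq_equiv K A C = {((B, x, y), (B', x', y')).
     (B, x, y) \<in> seqs K A C \<and> (B', x', y') \<in> seqs K A C \<and>
     (\<exists>b. isomorphism K B B' b \<and> Comp K A B B' b x = x' \<and> Comp K B B' C y' b = y)}"

text \<open>\<open>\<s>(\<delta>) = [A \<rightarrow> B \<rightarrow> C]\<close> with maps \<open>x\<close> and \<open>y\<close>.\<close>

definition s_triangle ::
  "('r, 'o, 'm, 'e) ecat \<Rightarrow> 'o \<Rightarrow> 'o \<Rightarrow> 'o \<Rightarrow> 'm \<Rightarrow> 'm \<Rightarrow> 'e \<Rightarrow> bool" where
  "s_triangle K A B C x y \<delta> \<longleftrightarrow>
     \<delta> \<in> carrier (EE K C A) \<and> (B, x, y) \<in> seqs K A C \<and>
     Real K C A \<delta> = seq_equiv K A C `` {(B, x, y)}"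

locale additive_realization = bilinear_ext +
  assumes real_class: "\<delta> \<in> carrier (EE K C A) \<Longrightarrow> Real K C A \<delta> \<in> seqs K A C // seq_equiv K A C"
    and real_morphism:
      "s_triangle K A B C x y \<delta> \<Longrightarrow> s_triangle K A' B' C' x' y' \<delta>' \<Longrightarrow>
       ext_morphism K C A \<delta> C' A' \<delta>' a c \<Longrightarrow>
       \<exists>b\<in>mor K B B'. Comp K A B B' b x = Comp K A A' B' x' a \<and>
                        Comp K B B' C' y' b = Comp K B C C' c y"
    and real_zero:
      "biproduct K A C P \<Longrightarrow> s_triangle K A (Sm P) C (In1 P) (Pr2 P) \<zero>\<^bsub>EE K C A\<^esub>"
    and real_dsum:
      "s_triangle K A B C x y \<delta> \<Longrightarrow> s_triangle K A' B' C' x' y' \<delta>' \<Longrightarrow>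
       biproduct K A A' PA \<Longrightarrow> biproduct K B B' PB \<Longrightarrow> biproduct K C C' PC \<Longrightarrow>
       ext_dsum K C C' PC A A' PA \<delta> \<delta>' \<epsilon> \<Longrightarrow>
       s_triangle K (Sm PA) (Sm PB) (Sm PC)
         (dsum_mor K A A' PA B B' PB x x') (dsum_mor K B B' PB C C' PC y y') \<epsilon>"

locale extriangulated_category = additive_realization +
  assumes ET3:
      "s_triangle K A B C x y \<delta> \<Longrightarrow> s_triangle K A' B' C' x' y' \<delta>' \<Longrightarrow>
       a \<in> mor K A A' \<Longrightarrow> b \<in> mor K B B' \<Longrightarrow> Comp K A B B' b x = Comp K A A' B' x' a \<Longrightarrow>
       \<exists>c. ext_morphism K C A \<delta> C' A' \<delta>' a c \<and> Comp K B C C' c y = Comp K B B' C' y' b"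
    and ET3_op:
      "s_triangle K A B C x y \<delta> \<Longrightarrow> s_triangle K A' B' C' x' y' \<delta>' \<Longrightarrow>
       b \<in> mor K B B' \<Longrightarrow> c \<in> mor K C C' \<Longrightarrow> Comp K B C C' c y = Comp K B B' C' y' b \<Longrightarrow>
       \<exists>a. ext_morphism K C A \<delta> C' A' \<delta>' a c \<and> Comp K A B B' b x = Comp K A A' B' x' a"
    and ET4:
      "s_triangle K A B D f f' \<delta> \<Longrightarrow> s_triangle K B C F g g' \<delta>' \<Longrightarrow>
       \<exists>E d e h' \<delta>''.
         d \<in> mor K D E \<and> e \<in> mor K E F \<and> h' \<in> mor K C E \<and>
         Comp K B C E h' g = Comp K B D E d f' \<and> Comp K C E F e h' = g' \<and>
         s_triangle K A C E (Comp K A B C g f) h' \<delta>'' \<and>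
         s_triangle K D E F d e (push K F B D f' \<delta>') \<and>
         pull K D E A d \<delta>'' = \<delta> \<and>
         push K E A B f \<delta>'' = pull K E F B e \<delta>'"
    and ET4_op:
      "s_triangle K D B A f' f \<delta> \<Longrightarrow> s_triangle K F C B g' g \<delta>' \<Longrightarrow>
       \<exists>E d e h' \<delta>''.
         d \<in> mor K E D \<and> e \<in> mor K F E \<and> h' \<in> mor K E C \<and>
         Comp K E C B g h' = Comp K E D B f' d \<and> Comp K F E C h' e = g' \<and>
         s_triangle K E C A h' (Comp K C B A f g) \<delta>'' \<and>
         s_triangle K F E D e d (pull K D B F f' \<delta>') \<and>
         push K A E D d \<delta>'' = \<delta> \<and>
         pull K B A E f \<delta>'' = push K B F E e \<delta>'"

definition deflation :: "('r, 'o, 'm, 'e) ecat \<Rightarrow> 'o \<Rightarrow> 'o \<Rightarrow> 'm \<Rightarrow> bool" where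
  "deflation K B C y \<longleftrightarrow> (\<exists>A x \<delta>. s_triangle K A B C x y \<delta>)"

definition projective_morphism :: "('r, 'o, 'm, 'e) ecat \<Rightarrow> 'o \<Rightarrow> 'o \<Rightarrow> 'm \<Rightarrow> bool" where
  "projective_morphism K X Y f \<longleftrightarrow> f \<in> mor K X Y \<and>
     (\<forall>A. \<forall>\<delta>\<in>carrier (EE K Y A). pull K X Y A f \<delta> = \<zero>\<^bsub>EE K X A\<^esub>)"

definition enough_projective_morphisms :: "('r, 'o, 'm, 'e) ecat \<Rightarrow> bool" where
  "enough_projective_morphisms K \<longleftrightarrow>
     (\<forall>C. \<exists>G g. deflation K G C g \<and> projective_morphism K G C g)"


section \<open>Module-valued functors\<close>

text \<open>
  The data of a functor to modules. For a covariant functor \<open>Map F X Y f\<close> is the map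
  \<open>F X \<rightarrow> F Y\<close> induced by \<open>f : X \<rightarrow> Y\<close>, for a contravariant one the map \<open>F Y \<rightarrow> F X\<close>.
\<close>

record ('r, 'o, 'm, 'p) mfun =
  Obj :: "'o \<Rightarrow> ('r, 'p) module"
  Map :: "'o \<Rightarrow> 'o \<Rightarrow> 'm \<Rightarrow> 'p \<Rightarrow> 'p"

abbreviation elts :: "('r, 'o, 'm, 'p) mfun \<Rightarrow> 'o \<Rightarrow> 'p set" where
  "elts F X \<equiv> carrier (Obj F X)"

text \<open>Objects and morphisms of \<open>Mod C\<close>, the category of contravariant linear functors.\<close>

definition Mod_functor ::
  "'r ring \<Rightarrow> ('r, 'o, 'm, 'e) ecat \<Rightarrow> ('r, 'o, 'm, 'p) mfun \<Rightarrow> bool" where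
  "Mod_functor R K F \<longleftrightarrow>
     (\<forall>X. module R (Obj F X)) \<and>
     (\<forall>X Y. \<forall>f\<in>mor K X Y. linear_map R (Obj F Y) (Obj F X) (Map F X Y f)) \<and>
     (\<forall>X. \<forall>u\<in>elts F X. Map F X X (Ident K X) u = u) \<and>
     (\<forall>X Y Z. \<forall>f\<in>mor K X Y. \<forall>g\<in>mor K Y Z. \<forall>u\<in>elts F Z.
        Map F X Z (Comp K X Y Z g f) u = Map F X Y f (Map F Y Z g u)) \<and>
     (\<forall>X Y. \<forall>u\<in>elts F Y. linear_map R (Hom K X Y) (Obj F X) (\<lambda>f. Map F X Y f u))"

definition Mod_morphism ::
  "'r ring \<Rightarrow> ('r, 'o, 'm, 'e) ecat \<Rightarrow> ('r, 'o, 'm, 'p) mfun \<Rightarrow> ('r, 'o, 'm, 'q) mfun \<Rightarrow>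
   ('o \<Rightarrow> 'p \<Rightarrow> 'q) \<Rightarrow> bool" where
  "Mod_morphism R K F G \<phi> \<longleftrightarrow>
     (\<forall>X. linear_map R (Obj F X) (Obj G X) (\<phi> X)) \<and>
     (\<forall>X Y. \<forall>f\<in>mor K X Y. \<forall>u\<in>elts F Y. \<phi> X (Map F X Y f u) = Map G X Y f (\<phi> Y u))"

text \<open>Kernels and images in \<open>Mod C\<close> are formed objectwise.\<close>

definition Mod_exact ::
  "'r ring \<Rightarrow> ('r, 'o, 'm, 'e) ecat \<Rightarrow>
   ('r, 'o, 'm, 'p) mfun \<Rightarrow> ('o \<Rightarrow> 'p \<Rightarrow> 'q) \<Rightarrow> ('r, 'o, 'm, 'q) mfun \<Rightarrow>
   ('o \<Rightarrow> 'q \<Rightarrow> 's) \<Rightarrow> ('r, 'o, 'm, 's) mfun \<Rightarrow> bool" where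
  "Mod_exact R K F \<phi> G \<psi> H \<longleftrightarrow>
     Mod_functor R K F \<and> Mod_functor R K G \<and> Mod_functor R K H \<and>
     Mod_morphism R K F G \<phi> \<and> Mod_morphism R K G H \<psi> \<and>
     (\<forall>X. \<phi> X ` elts F X = {u \<in> elts G X. \<psi> X u = \<zero>\<^bsub>Obj H X\<^esub>})"

text \<open>
  The module of natural transformations between covariant functors. Components are taken
  extensional, so that equal transformations are equal as functions.
\<close>

definition nat_trans ::
  "'r ring \<Rightarrow> ('r, 'o, 'm, 'e) ecat \<Rightarrow> ('r, 'o, 'm, 'p) mfun \<Rightarrow> ('r, 'o, 'm, 'q) mfun \<Rightarrow>
   ('o \<Rightarrow> 'p \<Rightarrow> 'q) set" where
  "nat_trans R K F G = {\<phi>.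
     (\<forall>Y. \<phi> Y \<in> extensional (elts F Y) \<and> linear_map R (Obj F Y) (Obj G Y) (\<phi> Y)) \<and>
     (\<forall>Y Z. \<forall>f\<in>mor K Y Z. \<forall>u\<in>elts F Y. \<phi> Z (Map F Y Z f u) = Map G Y Z f (\<phi> Y u))}"

definition nat_module ::
  "'r ring \<Rightarrow> ('r, 'o, 'm, 'e) ecat \<Rightarrow> ('r, 'o, 'm, 'p) mfun \<Rightarrow> ('r, 'o, 'm, 'q) mfun \<Rightarrow>
   ('r, 'o \<Rightarrow> 'p \<Rightarrow> 'q) module" where
  "nat_module R K F G =
     \<lparr> carrier = nat_trans R K F G, monoid.mult = undefined, one = undefined,
       zero = (\<lambda>Y. \<lambda>u\<in>elts F Y. \<zero>\<^bsub>Obj G Y\<^esub>),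
       add = (\<lambda>\<phi> \<psi> Y. \<lambda>u\<in>elts F Y. \<phi> Y u \<oplus>\<^bsub>Obj G Y\<^esub> \<psi> Y u),
       smult = (\<lambda>r \<phi> Y. \<lambda>u\<in>elts F Y. r \<odot>\<^bsub>Obj G Y\<^esub> \<phi> Y u) \<rparr>"

definition hom_cov :: "('r, 'o, 'm, 'e) ecat \<Rightarrow> 'o \<Rightarrow> ('r, 'o, 'm, 'm) mfun" where
  "hom_cov K X = \<lparr> Obj = (\<lambda>Y. Hom K X Y), Map = (\<lambda>Y Z a f. Comp K X Y Z a f) \<rparr>"

definition ext_cov :: "('r, 'o, 'm, 'e) ecat \<Rightarrow> 'o \<Rightarrow> ('r, 'o, 'm, 'e) mfun" where
  "ext_cov K X = \<lparr> Obj = (\<lambda>Y. EE K X Y), Map = (\<lambda>Y Z a \<delta>. push K X Y Z a \<delta>) \<rparr>"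


section \<open>Positive extensions\<close>

text \<open>
  Let \<open>P\<close> be a contravariant and \<open>Q\<close> a covariant functor. The coend
  \<open>\<integral>\<^sup>M P M \<otimes>\<^sub>R Q M\<close> is the quotient of \<open>\<Oplus>\<^sub>M P M \<otimes>\<^sub>R Q M\<close> by the relations
  \<open>P(c) \<rho> \<otimes> \<tau> = \<rho> \<otimes> Q(c) \<tau>\<close>. Its elements are represented by finite formal sums of pure
  tensors, a multiset of triples \<open>(M, \<rho>, \<tau>)\<close> standing for the sum of the \<open>\<rho> \<otimes> \<tau>\<close>, and
  \<open>coend_eq\<close> is the congruence generated by the relations of the tensor product and of the
  coend. There are no formal negatives, whence the separate rule for \<open>0 \<otimes> \<tau>\<close>; the negative of
  \<open>\<rho> \<otimes> \<tau>\<close> is \<open>(-\<rho>) \<otimes> \<tau>\<close>.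
\<close>

definition formal_sums ::
  "('r, 'o, 'm, 'p) mfun \<Rightarrow> ('r, 'o, 'm, 'q) mfun \<Rightarrow> ('o \<times> 'p \<times> 'q) multiset set" where
  "formal_sums P Q = {u. \<forall>(M, \<rho>, \<tau>) \<in> set_mset u. \<rho> \<in> elts P M \<and> \<tau> \<in> elts Q M}"

inductive coend_eq ::
  "'r ring \<Rightarrow> ('r, 'o, 'm, 'e) ecat \<Rightarrow> ('r, 'o, 'm, 'p) mfun \<Rightarrow> ('r, 'o, 'm, 'q) mfun \<Rightarrow>
   ('o \<times> 'p \<times> 'q) multiset \<Rightarrow> ('o \<times> 'p \<times> 'q) multiset \<Rightarrow> bool"
  for R K P Q where
  reflexive: "u \<in> formal_sums P Q \<Longrightarrow> coend_eq R K P Q u u"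
| symmetric: "coend_eq R K P Q u v \<Longrightarrow> coend_eq R K P Q v u"
| transitive: "coend_eq R K P Q u v \<Longrightarrow> coend_eq R K P Q v w \<Longrightarrow> coend_eq R K P Q u w"
| plus: "coend_eq R K P Q u u' \<Longrightarrow> coend_eq R K P Q v v' \<Longrightarrow> coend_eq R K P Q (u + v) (u' + v')"
| zero: "\<tau> \<in> elts Q M \<Longrightarrow> coend_eq R K P Q {#(M, \<zero>\<^bsub>Obj P M\<^esub>, \<tau>)#} {#}"
| add_left: "\<rho> \<in> elts P M \<Longrightarrow> \<rho>' \<in> elts P M \<Longrightarrow> \<tau> \<in> elts Q M \<Longrightarrow>
    coend_eq R K P Q {#(M, \<rho> \<oplus>\<^bsub>Obj P M\<^esub> \<rho>', \<tau>)#} {#(M, \<rho>, \<tau>), (M, \<rho>', \<tau>)#}"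
| add_right: "\<rho> \<in> elts P M \<Longrightarrow> \<tau> \<in> elts Q M \<Longrightarrow> \<tau>' \<in> elts Q M \<Longrightarrow>
    coend_eq R K P Q {#(M, \<rho>, \<tau> \<oplus>\<^bsub>Obj Q M\<^esub> \<tau>')#} {#(M, \<rho>, \<tau>), (M, \<rho>, \<tau>')#}"
| balanced: "r \<in> carrier R \<Longrightarrow> \<rho> \<in> elts P M \<Longrightarrow> \<tau> \<in> elts Q M \<Longrightarrow>
    coend_eq R K P Q {#(M, r \<odot>\<^bsub>Obj P M\<^esub> \<rho>, \<tau>)#} {#(M, \<rho>, r \<odot>\<^bsub>Obj Q M\<^esub> \<tau>)#}"
| dinatural: "c \<in> mor K M N \<Longrightarrow> \<rho> \<in> elts P N \<Longrightarrow> \<tau> \<in> elts Q M \<Longrightarrow>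
    coend_eq R K P Q {#(M, Map P M N c \<rho>, \<tau>)#} {#(N, \<rho>, Map Q M N c \<tau>)#}"

text \<open>
  One type for the elements of all \<open>\<bbbE>\<^sup>n(X, Y)\<close>, \<open>n \<ge> 0\<close>. An element of the coend
  \<open>\<integral>\<^sup>M \<bbbE>\<^sup>n\<^sup>-\<^sup>1(M, Y) \<otimes>\<^sub>R \<bbbE>(X, M)\<close> is stored as a chosen representative of its class: two
  formal sums have the same \<open>coend_class\<close> iff they are related by \<open>coend_eq\<close>. This keeps the
  type independent of \<open>n\<close>, which genuine quotient sets would not.
\<close>

datatype ('o, 'm, 'e) pext =
    Mor (un_Mor: 'm)
  | Ex (un_Ex: 'e)
  | Cls (un_Cls: "('o \<times> ('o, 'm, 'e) pext \<times> 'e) multiset")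

definition coend_class ::
  "'r ring \<Rightarrow> ('r, 'o, 'm, 'e) ecat \<Rightarrow> ('r, 'o, 'm, ('o, 'm, 'e) pext) mfun \<Rightarrow> 'o \<Rightarrow>
   ('o \<times> ('o, 'm, 'e) pext \<times> 'e) multiset \<Rightarrow> ('o, 'm, 'e) pext" where
  "coend_class R K P X u = Cls (SOME v. coend_eq R K P (ext_cov K X) u v)"

text \<open>The functor sending \<open>X\<close> to \<open>\<integral>\<^sup>M P M \<otimes>\<^sub>R \<bbbE>(X, M)\<close>.\<close>

definition coend_fun ::
  "'r ring \<Rightarrow> ('r, 'o, 'm, 'e) ecat \<Rightarrow> ('r, 'o, 'm, ('o, 'm, 'e) pext) mfun \<Rightarrow>
   ('r, 'o, 'm, ('o, 'm, 'e) pext) mfun" where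
  "coend_fun R K P =
     \<lparr> Obj = (\<lambda>X.
         \<lparr> carrier = coend_class R K P X ` formal_sums P (ext_cov K X),
           monoid.mult = undefined, one = undefined,
           zero = coend_class R K P X {#},
           add = (\<lambda>\<xi> \<eta>. coend_class R K P X (un_Cls \<xi> + un_Cls \<eta>)),
           smult = (\<lambda>r \<xi>. coend_class R K P X
             (image_mset (\<lambda>(M, \<rho>, \<tau>). (M, r \<odot>\<^bsub>Obj P M\<^esub> \<rho>, \<tau>)) (un_Cls \<xi>))) \<rparr>),
       Map = (\<lambda>X' X c \<xi>. coend_class R K P X'
         (image_mset (\<lambda>(M, \<rho>, \<tau>). (M, \<rho>, pull K X' X M c \<tau>)) (un_Cls \<xi>))) \<rparr>"

text \<open>\<open>pos_ext R K n Y\<close> is the contravariant functor \<open>\<bbbE>\<^sup>n(-, Y)\<close>.\<close>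

fun pos_ext ::
  "'r ring \<Rightarrow> ('r, 'o, 'm, 'e) ecat \<Rightarrow> nat \<Rightarrow> 'o \<Rightarrow> ('r, 'o, 'm, ('o, 'm, 'e) pext) mfun" where
  "pos_ext R K 0 Y =
     \<lparr> Obj = (\<lambda>X. image_module Mor (Hom K X Y)),
       Map = (\<lambda>X' X c \<xi>. Mor (Comp K X' X Y (un_Mor \<xi>) c)) \<rparr>"
| "pos_ext R K (Suc 0) Y =
     \<lparr> Obj = (\<lambda>X. image_module Ex (EE K X Y)),
       Map = (\<lambda>X' X c \<xi>. Ex (pull K X' X Y c (un_Ex \<xi>))) \<rparr>"
| "pos_ext R K (Suc (Suc n)) Y = coend_fun R K (pos_ext R K (Suc n) Y)"

text \<open>\<open>pos_push R K n X Y Y' a\<close> is \<open>\<bbbE>\<^sup>n(X, a)\<close> for \<open>a : Y \<rightarrow> Y'\<close>.\<close>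

fun pos_push ::
  "'r ring \<Rightarrow> ('r, 'o, 'm, 'e) ecat \<Rightarrow> nat \<Rightarrow> 'o \<Rightarrow> 'o \<Rightarrow> 'o \<Rightarrow> 'm \<Rightarrow>
   ('o, 'm, 'e) pext \<Rightarrow> ('o, 'm, 'e) pext" where
  "pos_push R K 0 X Y Y' a \<xi> = Mor (Comp K X Y Y' a (un_Mor \<xi>))"
| "pos_push R K (Suc 0) X Y Y' a \<xi> = Ex (push K X Y Y' a (un_Ex \<xi>))"
| "pos_push R K (Suc (Suc n)) X Y Y' a \<xi> =
     coend_class R K (pos_ext R K (Suc n) Y') X
       (image_mset (\<lambda>(M, \<rho>, \<tau>). (M, pos_push R K (Suc n) M Y Y' a \<rho>, \<tau>)) (un_Cls \<xi>))"

text \<open>The covariant functor \<open>\<bbbE>\<^sup>n(X, -)\<close>.\<close>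

definition pos_ext_cov ::
  "'r ring \<Rightarrow> ('r, 'o, 'm, 'e) ecat \<Rightarrow> nat \<Rightarrow> 'o \<Rightarrow> ('r, 'o, 'm, ('o, 'm, 'e) pext) mfun" where
  "pos_ext_cov R K n X =
     \<lparr> Obj = (\<lambda>Y. Obj (pos_ext R K n Y) X), Map = (\<lambda>Y Y' a. pos_push R K n X Y Y' a) \<rparr>"

text \<open>
  \<open>cup R K s t X M Y \<rho> \<mu> = \<rho> \<union> \<mu> \<in> \<bbbE>\<^sup>s\<^sup>+\<^sup>t(X, Y)\<close> for \<open>\<rho> \<in> \<bbbE>\<^sup>s(M, Y)\<close> and
  \<open>\<mu> \<in> \<bbbE>\<^sup>t(X, M)\<close>, along the canonical isomorphisms: \<open>\<rho> \<union> f = f\<^sup>*\<rho>\<close> and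
  \<open>g \<union> \<tau> = g\<^sub>*\<tau>\<close> in degree zero, \<open>\<rho> \<union> \<tau> = [\<rho> \<otimes> \<tau>]\<close> by construction for
  \<open>\<tau> \<in> \<bbbE>(X, M)\<close> and \<open>s > 0\<close>, and \<open>\<rho> \<union> [\<sigma> \<otimes> \<tau>] = [(\<rho> \<union> \<sigma>) \<otimes> \<tau>]\<close>.
\<close>

fun cup ::
  "'r ring \<Rightarrow> ('r, 'o, 'm, 'e) ecat \<Rightarrow> nat \<Rightarrow> nat \<Rightarrow> 'o \<Rightarrow> 'o \<Rightarrow> 'o \<Rightarrow>
   ('o, 'm, 'e) pext \<Rightarrow> ('o, 'm, 'e) pext \<Rightarrow> ('o, 'm, 'e) pext" where
  "cup R K s 0 X M Y \<rho> \<mu> = Map (pos_ext R K s Y) X M (un_Mor \<mu>) \<rho>"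
| "cup R K 0 (Suc 0) X M Y \<rho> \<mu> = pos_push R K (Suc 0) X M Y (un_Mor \<rho>) \<mu>"
| "cup R K (Suc s) (Suc 0) X M Y \<rho> \<mu> =
     coend_class R K (pos_ext R K (Suc s) Y) X {#(M, \<rho>, un_Ex \<mu>)#}"
| "cup R K s (Suc (Suc t)) X M Y \<rho> \<mu> =
     coend_class R K (pos_ext R K (s + Suc t) Y) X
       (image_mset (\<lambda>(N, \<sigma>, \<tau>). (N, cup R K s (Suc t) N M Y \<rho> \<sigma>, \<tau>)) (un_Cls \<mu>))"

text \<open>For \<open>\<delta> \<in> \<bbbE>(C, A)\<close>: the maps \<open>\<delta>\<^sub>\<sharp> : \<bbbE>\<^sup>n(X, C) \<rightarrow> \<bbbE>\<^sup>n\<^sup>+\<^sup>1(X, A)\<close> and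
  \<open>\<delta>\<^sup>\<sharp> : \<bbbE>\<^sup>n(A, Y) \<rightarrow> \<bbbE>\<^sup>n\<^sup>+\<^sup>1(C, Y)\<close>.\<close>

definition lower_sharp ::
  "'r ring \<Rightarrow> ('r, 'o, 'm, 'e) ecat \<Rightarrow> nat \<Rightarrow> 'o \<Rightarrow> 'o \<Rightarrow> 'e \<Rightarrow> 'o \<Rightarrow>
   ('o, 'm, 'e) pext \<Rightarrow> ('o, 'm, 'e) pext" where
  "lower_sharp R K n C A \<delta> X \<mu> = cup R K 1 n X C A (Ex \<delta>) \<mu>"

definition upper_sharp ::
  "'r ring \<Rightarrow> ('r, 'o, 'm, 'e) ecat \<Rightarrow> nat \<Rightarrow> 'o \<Rightarrow> 'o \<Rightarrow> 'e \<Rightarrow> 'o \<Rightarrow>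
   ('o, 'm, 'e) pext \<Rightarrow> ('o, 'm, 'e) pext" where
  "upper_sharp R K n C A \<delta> Y \<mu> = cup R K n 1 C A Y \<mu> (Ex \<delta>)"


section \<open>The extensions \<open>\<bbbE>\<^sub>I\<close> in all integer degrees\<close>

text \<open>Precomposition of \<open>\<phi>\<close> with a transformation \<open>\<theta>\<close> whose source is \<open>F\<close>.\<close>

definition precompose ::
  "('r, 'o, 'm, 'p) mfun \<Rightarrow> ('o \<Rightarrow> 'p \<Rightarrow> 'q) \<Rightarrow> ('o \<Rightarrow> 'q \<Rightarrow> 's) \<Rightarrow> ('o \<Rightarrow> 'p \<Rightarrow> 's)" where
  "precompose F \<theta> \<phi> = (\<lambda>Y. \<lambda>u\<in>elts F Y. \<phi> Y (\<theta> Y u))"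

datatype ('o, 'm, 'e) iext =
    Nonneg (un_Nonneg: "('o, 'm, 'e) pext")
  | Neg (un_Neg: "'o \<Rightarrow> ('o, 'm, 'e) pext \<Rightarrow> 'm")

text \<open>
  \<open>ext_I R K n A\<close> is the contravariant functor \<open>\<bbbE>\<^sub>I\<^sup>n(-, A)\<close>. In degree zero it is
  \<open>C(-, A)\<close>, which is identified with the natural transformations \<open>C(A, -) \<rightarrow> C(X, -)\<close> by
  Yoneda.
\<close>

definition ext_I ::
  "'r ring \<Rightarrow> ('r, 'o, 'm, 'e) ecat \<Rightarrow> int \<Rightarrow> 'o \<Rightarrow> ('r, 'o, 'm, ('o, 'm, 'e) iext) mfun" where
  "ext_I R K n A =
     (if n \<ge> 0 then
        \<lparr> Obj = (\<lambda>X. image_module Nonneg (Obj (pos_ext R K (nat n) A) X)),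
          Map = (\<lambda>X' X c \<xi>. Nonneg (Map (pos_ext R K (nat n) A) X' X c (un_Nonneg \<xi>))) \<rparr>
      else
        \<lparr> Obj = (\<lambda>X. image_module Neg
            (nat_module R K (pos_ext_cov R K (nat (- n)) A) (hom_cov K X))),
          Map = (\<lambda>X' X c \<xi>. Neg (\<lambda>Y. \<lambda>u\<in>elts (pos_ext_cov R K (nat (- n)) A) Y.
            Comp K X' X Y (un_Neg \<xi> Y u) c)) \<rparr>)"

text \<open>\<open>x\<^sub>* : \<bbbE>\<^sub>I\<^sup>n(X, A) \<rightarrow> \<bbbE>\<^sub>I\<^sup>n(X, B)\<close> for \<open>x : A \<rightarrow> B\<close>; in negative degrees,
  precomposition with \<open>x\<^sup>* : \<bbbE>\<^sup>-\<^sup>n(B, -) \<rightarrow> \<bbbE>\<^sup>-\<^sup>n(A, -)\<close>.\<close>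

definition ext_I_push ::
  "'r ring \<Rightarrow> ('r, 'o, 'm, 'e) ecat \<Rightarrow> int \<Rightarrow> 'o \<Rightarrow> 'o \<Rightarrow> 'm \<Rightarrow> 'o \<Rightarrow>
   ('o, 'm, 'e) iext \<Rightarrow> ('o, 'm, 'e) iext" where
  "ext_I_push R K n A B x X \<xi> =
     (if n \<ge> 0 then Nonneg (pos_push R K (nat n) X A B x (un_Nonneg \<xi>))
      else Neg (precompose (pos_ext_cov R K (nat (- n)) B)
             (\<lambda>Y. Map (pos_ext R K (nat (- n)) Y) A B x) (un_Neg \<xi>)))"

text \<open>
  \<open>\<delta>\<^sub>\<sharp> : \<bbbE>\<^sub>I\<^sup>n(X, C) \<rightarrow> \<bbbE>\<^sub>I\<^sup>n\<^sup>+\<^sup>1(X, A)\<close> for \<open>\<delta> \<in> \<bbbE>(C, A)\<close>. In degree \<open>-1\<close> the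
  precomposite is a transformation \<open>C(A, -) \<rightarrow> C(X, -)\<close>, and its value at the identity of \<open>A\<close>
  is the morphism corresponding to it by Yoneda.
\<close>

definition ext_I_conn ::
  "'r ring \<Rightarrow> ('r, 'o, 'm, 'e) ecat \<Rightarrow> int \<Rightarrow> 'o \<Rightarrow> 'o \<Rightarrow> 'e \<Rightarrow> 'o \<Rightarrow>
   ('o, 'm, 'e) iext \<Rightarrow> ('o, 'm, 'e) iext" where
  "ext_I_conn R K n C A \<delta> X \<xi> =
     (if n \<ge> 0 then Nonneg (lower_sharp R K (nat n) C A \<delta> X (un_Nonneg \<xi>))
      else
        let k = nat (- n - 1);
            \<psi> = precompose (pos_ext_cov R K k A) (upper_sharp R K k C A \<delta>) (un_Neg \<xi>)
        in if k = 0 then Nonneg (Mor (\<psi> A (Mor (Ident K A)))) else Neg \<psi>)"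

text \<open>The long exact sequence attached to every s-triangle, exact at each of its terms.\<close>

definition ext_I_delta_functor :: "'r ring \<Rightarrow> ('r, 'o, 'm, 'e) ecat \<Rightarrow> bool" where
  "ext_I_delta_functor R K \<longleftrightarrow>
     (\<forall>A B C x y \<delta> n. s_triangle K A B C x y \<delta> \<longrightarrow>
        Mod_exact R K (ext_I R K n A) (ext_I_push R K n A B x) (ext_I R K n B)
          (ext_I_push R K n B C y) (ext_I R K n C) \<and>
        Mod_exact R K (ext_I R K n B) (ext_I_push R K n B C y) (ext_I R K n C)
          (ext_I_conn R K n C A \<delta>) (ext_I R K (n + 1) A) \<and>
        Mod_exact R K (ext_I R K n C) (ext_I_conn R K n C A \<delta>) (ext_I R K (n + 1) A)
          (ext_I_push R K (n + 1) A B x) (ext_I R K (n + 1) B))"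

end

theory Submission
  imports Defs
begin

text \<open>
  The proof rests on one presentation. Choose for every object \<open>X\<close> an s-triangle
  \<open>\<Omega> \<rightarrow> G \<rightarrow> X\<close> with extension \<open>\<omega> \<in> \<bbbE>(X, \<Omega>)\<close>, maps \<open>j : \<Omega> \<rightarrow> G\<close> and \<open>g : G \<rightarrow> X\<close>, and \<open>g\<close>
  projective. As \<open>g\<^sup>*\<close> kills all extensions, every \<open>\<tau> \<in> \<bbbE>(X, M)\<close> is \<open>a\<^sub>*\<omega>\<close> for some \<open>a : \<Omega> \<rightarrow> M\<close>, and
  \<open>a\<close> is unique up to morphisms that factor through \<open>j\<close>. So \<open>\<bbbE>(X, -)\<close> is the cokernel of
  \<open>C(G, -) \<rightarrow> C(\<Omega>, -)\<close>, and applying a coend (which is right exact, and absorbs representable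
  functors) gives, for all \<open>n \<ge> 0\<close>,
    \<open>\<bbbE>\<^sup>n\<^sup>+\<^sup>1(X, Y) = \<bbbE>\<^sup>n(\<Omega>, Y) / j\<^sup>*\<bbbE>\<^sup>n(G, Y)\<close>, the class of \<open>\<rho>\<close> corresponding to \<open>\<rho> \<union> \<omega>\<close>.
  The lemmas \<open>upper_sharp_onto\<close> and \<open>upper_sharp_kernel\<close> say this; for \<open>n \<ge> 1\<close> the hard half is
  \<open>pure_eq_zero_imp\<close>. The presentation also reduces all identities between coend elements to single pure tensors.

  Positive degrees. Exactness for \<open>A \<rightarrow> B \<rightarrow> C\<close> is lifted from degree \<open>n\<close> to degree \<open>n + 1\<close> by writing
  elements as \<open>\<rho> \<union> \<omega>\<close>. A relation that holds for \<open>\<rho> \<union> \<omega>\<close> holds for \<open>\<rho>\<close> up to some \<open>j\<^sup>*\<sigma>\<close> with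
  \<open>\<sigma>\<close> on \<open>G\<close>. Since \<open>G\<close> itself need not be projective, \<open>\<sigma>\<close> need not vanish or lift; but covering \<open>G\<close>
  once more by a projective deflation \<open>p\<close> replaces it by \<open>p\<^sup>*\<sigma>\<close>, and this is harmless
  (\<open>lift_vanishing\<close>). The induction starts from the exact sequences of an s-triangle in degrees zero
  and one.

  Negative degrees. Natural transformations out of a cokernel form a kernel, so
  \<open>\<bbbE>\<^sub>I\<^sup>-\<^sup>n\<^sup>-\<^sup>1(X, A)\<close> is the kernel of \<open>j\<^sub>* : \<bbbE>\<^sub>I\<^sup>-\<^sup>n(X, \<Omega>) \<rightarrow> \<bbbE>\<^sub>I\<^sup>-\<^sup>n(X, G)\<close> (\<open>neg_conn_injective\<close>,
  \<open>neg_conn_kernel\<close>). Given \<open>A \<rightarrow> B \<rightarrow> C\<close>, a projective deflation \<open>H \<rightarrow> B\<close> is also one onto \<open>C\<close> after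
  composition, and the syzygies \<open>F\<close> of \<open>B\<close> and \<open>E\<close> of \<open>C\<close> so obtained fit into an s-triangle
  \<open>F \<rightarrow> E \<rightarrow> A\<close> (\<open>syzygy_triangle\<close>). A diagram chase between the two s-triangles moves exactness from
  degree \<open>-n\<close> to degree \<open>-n - 1\<close>, starting from degree zero, where
  Yoneda turns natural transformations \<open>C(A, -) \<rightarrow> C(X, -)\<close> into morphisms \<open>X \<rightarrow> A\<close>.
\<close>

section \<open>Modules and linear maps\<close>

lemma linear_mapI:
  assumes "\<And>u. u \<in> carrier M \<Longrightarrow> f u \<in> carrier N"
    and "\<And>u v. u \<in> carrier M \<Longrightarrow> v \<in> carrier M \<Longrightarrow> f (u \<oplus>\<^bsub>M\<^esub> v) = f u \<oplus>\<^bsub>N\<^esub> f v"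
    and "\<And>r u. r \<in> carrier R \<Longrightarrow> u \<in> carrier M \<Longrightarrow> f (r \<odot>\<^bsub>M\<^esub> u) = r \<odot>\<^bsub>N\<^esub> f u"
  shows "linear_map R M N f"
  using assms by (auto simp: linear_map_def)

lemma linear_map_closed: "linear_map R M N f \<Longrightarrow> u \<in> carrier M \<Longrightarrow> f u \<in> carrier N"
  by (auto simp: linear_map_def)

lemma linear_map_add:
  "linear_map R M N f \<Longrightarrow> u \<in> carrier M \<Longrightarrow> v \<in> carrier M \<Longrightarrow> f (u \<oplus>\<^bsub>M\<^esub> v) = f u \<oplus>\<^bsub>N\<^esub> f v"
  by (auto simp: linear_map_def)

lemma linear_map_smult:
  "linear_map R M N f \<Longrightarrow> r \<in> carrier R \<Longrightarrow> u \<in> carrier M \<Longrightarrow> f (r \<odot>\<^bsub>M\<^esub> u) = r \<odot>\<^bsub>N\<^esub> f u"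
  by (auto simp: linear_map_def)

lemma linear_map_zero:
  assumes "module R M" "module R N" and f: "linear_map R M N f"
  shows "f \<zero>\<^bsub>M\<^esub> = \<zero>\<^bsub>N\<^esub>"
proof -
  interpret M: module R M by fact
  interpret N: module R N by fact
  have "f \<zero>\<^bsub>M\<^esub> \<oplus>\<^bsub>N\<^esub> f \<zero>\<^bsub>M\<^esub> = f \<zero>\<^bsub>M\<^esub>"
    using linear_map_add[OF f, of "\<zero>\<^bsub>M\<^esub>" "\<zero>\<^bsub>M\<^esub>"] by simp
  then show ?thesis
    using linear_map_closed[OF f M.zero_closed] by (simp add: N.add.l_cancel_one)
qed

lemma linear_map_minus:
  assumes "module R M" "module R N" and f: "linear_map R M N f"
    and u: "u \<in> carrier M" and v: "v \<in> carrier M"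
  shows "f (u \<ominus>\<^bsub>M\<^esub> v) = f u \<ominus>\<^bsub>N\<^esub> f v"
proof -
  interpret M: module R M by fact
  interpret N: module R N by fact
  have w: "u \<ominus>\<^bsub>M\<^esub> v \<in> carrier M" using u v by simp
  have "u = (u \<ominus>\<^bsub>M\<^esub> v) \<oplus>\<^bsub>M\<^esub> v" 
    using u v by (simp add: M.minus_eq M.add.m_assoc M.l_neg)
  then have "f u = f (u \<ominus>\<^bsub>M\<^esub> v) \<oplus>\<^bsub>N\<^esub> f v"
    using linear_map_add[OF f w v] by simp
  then show ?thesis
    using linear_map_closed[OF f w] linear_map_closed[OF f v] 
    by (simp add: N.minus_eq N.add.m_assoc N.r_neg)
qed

lemma linear_map_compose:
  "linear_map R M N f \<Longrightarrow> linear_map R N P g \<Longrightarrow> linear_map R M P (\<lambda>u. g (f u))"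
  by (intro linear_mapI) (auto simp: linear_map_closed linear_map_add linear_map_smult)

lemma module_minus_eq_zero:
  assumes "module R M" "u \<in> carrier M" "v \<in> carrier M"
  shows "u \<ominus>\<^bsub>M\<^esub> v = \<zero>\<^bsub>M\<^esub> \<longleftrightarrow> u = v"
proof -
  interpret M: module R M by fact
  show ?thesis using assms M.minus_equality M.minus_eq by (metis M.minus_minus M.r_neg M.a_inv_closed)
qed

lemma module_minus_add_cancel:
  assumes "module R M" "u \<in> carrier M" "v \<in> carrier M"
  shows "(u \<ominus>\<^bsub>M\<^esub> v) \<oplus>\<^bsub>M\<^esub> v = u" 
proof -
  interpret M: module R M by fact
  show ?thesis using assms by (simp add: M.minus_eq M.add.m_assoc M.l_neg)
qed

text \<open>The module axioms are equations, so they pass to any image of a module.\<close>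

lemma module_surj_image:
  assumes "module R M"
    and onto: "h ` carrier M = carrier N"
    and zero: "h \<zero>\<^bsub>M\<^esub> = \<zero>\<^bsub>N\<^esub>"
    and add: "\<And>u v. u \<in> carrier M \<Longrightarrow> v \<in> carrier M \<Longrightarrow> h (u \<oplus>\<^bsub>M\<^esub> v) = h u \<oplus>\<^bsub>N\<^esub> h v"
    and smult: "\<And>r u. r \<in> carrier R \<Longrightarrow> u \<in> carrier M \<Longrightarrow> h (r \<odot>\<^bsub>M\<^esub> u) = r \<odot>\<^bsub>N\<^esub> h u"
  shows "module R N"
proof -
  interpret M: module R M by fact
  have h: "h u \<in> carrier N" if "u \<in> carrier M" for u using onto that by blast
  have pre: "\<exists>u\<in>carrier M. v = h u" if "v \<in> carrier N" for v using onto that by blast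
  show ?thesis
  proof (rule moduleI)
    show "cring R" by (rule M.R.cring_axioms)
    show "abelian_group N"
    proof (rule abelian_groupI)
      fix x y assume "x \<in> carrier N" "y \<in> carrier N"
      then obtain u v where u: "u \<in> carrier M" "x = h u" and v: "v \<in> carrier M" "y = h v"
        using pre by blast
      show "x \<oplus>\<^bsub>N\<^esub> y \<in> carrier N" using u v h add by (metis M.a_closed)
      show "x \<oplus>\<^bsub>N\<^esub> y = y \<oplus>\<^bsub>N\<^esub> x" using u v add by (metis M.a_comm)
      fix z assume "z \<in> carrier N"
      then obtain w where w: "w \<in> carrier M" "z = h w" using pre by blast
      show "x \<oplus>\<^bsub>N\<^esub> y \<oplus>\<^bsub>N\<^esub> z = x \<oplus>\<^bsub>N\<^esub> (y \<oplus>\<^bsub>N\<^esub> z)"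
        using u v w by (simp add: add[symmetric] M.a_assoc)
    next
      show "\<zero>\<^bsub>N\<^esub> \<in> carrier N" using h zero by (metis M.zero_closed)
      fix x assume "x \<in> carrier N"
      then obtain u where u: "u \<in> carrier M" "x = h u" using pre by blast
      show "\<zero>\<^bsub>N\<^esub> \<oplus>\<^bsub>N\<^esub> x = x" using u zero add by (metis M.l_zero M.zero_closed)
      show "\<exists>y\<in>carrier N. y \<oplus>\<^bsub>N\<^esub> x = \<zero>\<^bsub>N\<^esub>" using u zero add h
        by (metis M.l_neg M.a_inv_closed)
    qed
  next
    fix a x assume a: "a \<in> carrier R" and "x \<in> carrier N"
    then obtain u where u: "u \<in> carrier M" "x = h u" using pre by blast
    show "a \<odot>\<^bsub>N\<^esub> x \<in> carrier N" using u a smult h by (metis M.smult_closed)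
    fix b assume b: "b \<in> carrier R"
    show "(a \<oplus>\<^bsub>R\<^esub> b) \<odot>\<^bsub>N\<^esub> x = a \<odot>\<^bsub>N\<^esub> x \<oplus>\<^bsub>N\<^esub> b \<odot>\<^bsub>N\<^esub> x"
      using u a b by (simp add: smult[symmetric] add[symmetric] M.smult_l_distr)
    show "(a \<otimes>\<^bsub>R\<^esub> b) \<odot>\<^bsub>N\<^esub> x = a \<odot>\<^bsub>N\<^esub> (b \<odot>\<^bsub>N\<^esub> x)"
      using u a b by (simp add: smult[symmetric] M.smult_assoc1)
  next
    fix a x y assume a: "a \<in> carrier R" and "x \<in> carrier N" "y \<in> carrier N"
    then obtain u v where u: "u \<in> carrier M" "x = h u" and v: "v \<in> carrier M" "y = h v"
      using pre by blast
    show "a \<odot>\<^bsub>N\<^esub> (x \<oplus>\<^bsub>N\<^esub> y) = a \<odot>\<^bsub>N\<^esub> x \<oplus>\<^bsub>N\<^esub> a \<odot>\<^bsub>N\<^esub> y"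
      using u v a by (simp add: smult[symmetric] add[symmetric] M.smult_r_distr)
  next
    fix x assume "x \<in> carrier N"
    then obtain u where u: "u \<in> carrier M" "x = h u" using pre by blast
    show "\<one>\<^bsub>R\<^esub> \<odot>\<^bsub>N\<^esub> x = x" using u smult by (metis M.smult_one M.R.one_closed)
  qed
qed

lemma image_module_sel:
  assumes inj: "\<And>u. h (g u) = u"
  shows "carrier (image_module g M) = g ` carrier M"
    and "\<zero>\<^bsub>image_module g M\<^esub> = g \<zero>\<^bsub>M\<^esub>"
    and "u \<in> carrier M \<Longrightarrow> v \<in> carrier M \<Longrightarrow> g u \<oplus>\<^bsub>image_module g M\<^esub> g v = g (u \<oplus>\<^bsub>M\<^esub> v)"
    and "u \<in> carrier M \<Longrightarrow> r \<odot>\<^bsub>image_module g M\<^esub> g u = g (r \<odot>\<^bsub>M\<^esub> u)"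
proof -
  have "inj_on g (carrier M)" by (metis inj inj_onI)
  then show "u \<in> carrier M \<Longrightarrow> v \<in> carrier M \<Longrightarrow> g u \<oplus>\<^bsub>image_module g M\<^esub> g v = g (u \<oplus>\<^bsub>M\<^esub> v)"
    "u \<in> carrier M \<Longrightarrow> r \<odot>\<^bsub>image_module g M\<^esub> g u = g (r \<odot>\<^bsub>M\<^esub> u)"
    by (auto simp: image_module_def)
qed (auto simp: image_module_def)

lemma module_image_module:
  assumes "module R M" and "\<And>u. h (g u) = u"
  shows "module R (image_module g M)"
  using assms(1) by (rule module_surj_image[where h = g]) (simp_all add: image_module_sel[where h=h, OF assms(2)])

lemma linear_map_wrap:
  assumes "\<And>u. h (g u) = u"
  shows "linear_map R M (image_module g M) g"
  by (intro linear_mapI) (auto simp: image_module_sel[where h=h, OF assms])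

lemma linear_map_image_module:
  assumes "\<And>u. h (g u) = u" "\<And>u. h' (g' u) = u" "linear_map R M N f"
  shows "linear_map R (image_module g M) (image_module g' N) (\<lambda>u. g' (f (h u)))"
  using assms(3)
  by (intro linear_mapI)
    (auto simp: image_module_sel[where h=h and g=g, OF assms(1)] image_module_sel[where h=h' and g=g', OF assms(2)]
      assms(1,2) linear_map_closed linear_map_add linear_map_smult)


section \<open>Exact sequences of functors\<close>

lemma Mod_functorD:
  assumes "Mod_functor R K F"
  shows "module R (Obj F X)"
    and "f \<in> mor K X Y \<Longrightarrow> linear_map R (Obj F Y) (Obj F X) (Map F X Y f)"
    and "u \<in> elts F X \<Longrightarrow> Map F X X (Ident K X) u = u"
    and "f \<in> mor K X Y \<Longrightarrow> g \<in> mor K Y Z \<Longrightarrow> u \<in> elts F Z \<Longrightarrow>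
       Map F X Z (Comp K X Y Z g f) u = Map F X Y f (Map F Y Z g u)"
    and "u \<in> elts F Y \<Longrightarrow> linear_map R (Hom K X Y) (Obj F X) (\<lambda>f. Map F X Y f u)"
  using assms unfolding Mod_functor_def by blast+

lemma Mod_morphismD:
  assumes "Mod_morphism R K F G \<phi>"
  shows "linear_map R (Obj F X) (Obj G X) (\<phi> X)"
    and "f \<in> mor K X Y \<Longrightarrow> u \<in> elts F Y \<Longrightarrow> \<phi> X (Map F X Y f u) = Map G X Y f (\<phi> Y u)"
  using assms unfolding Mod_morphism_def by blast+

lemma Mod_morphism_compose:
  assumes \<phi>: "Mod_morphism R K F G \<phi>" and \<psi>: "Mod_morphism R K G H \<psi>"
  shows "Mod_morphism R K F H (\<lambda>X u. \<psi> X (\<phi> X u))"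
  using linear_map_compose[OF Mod_morphismD(1)[OF \<phi>] Mod_morphismD(1)[OF \<psi>]]
    Mod_morphismD(2)[OF \<phi>] Mod_morphismD(2)[OF \<psi>] linear_map_closed[OF Mod_morphismD(1)[OF \<phi>]]
  by (auto simp: Mod_morphism_def)

lemma Mod_exactI:
  assumes "Mod_functor R K F" "Mod_functor R K G" "Mod_functor R K H"
    and \<phi>: "Mod_morphism R K F G \<phi>" and "Mod_morphism R K G H \<psi>"
    and "\<And>X u. u \<in> elts F X \<Longrightarrow> \<psi> X (\<phi> X u) = \<zero>\<^bsub>Obj H X\<^esub>"
    and "\<And>X v. v \<in> elts G X \<Longrightarrow> \<psi> X v = \<zero>\<^bsub>Obj H X\<^esub> \<Longrightarrow> \<exists>u\<in>elts F X. v = \<phi> X u"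
  shows "Mod_exact R K F \<phi> G \<psi> H"
  unfolding Mod_exact_def using assms linear_map_closed[OF Mod_morphismD(1)[OF \<phi>]]
  by (auto simp: image_iff)

text \<open>
  The functors \<open>\<bbbE>\<^sup>n\<close> and \<open>\<bbbE>\<^sub>I\<^sup>n\<close> tag their elements with a datatype constructor \<open>g\<close>, inverted by a
  selector \<open>h\<close>. Transport along the pair lets the proofs work with untagged elements.
\<close>

definition transport ::
  "('p \<Rightarrow> 'q) \<Rightarrow> ('q \<Rightarrow> 'p) \<Rightarrow> ('r, 'o, 'm, 'p) mfun \<Rightarrow> ('r, 'o, 'm, 'q) mfun" where
  "transport g h F =
     \<lparr> Obj = (\<lambda>X. image_module g (Obj F X)), Map = (\<lambda>X' X c \<xi>. g (Map F X' X c (h \<xi>))) \<rparr>"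

lemma transport_sel:
  "Obj (transport g h F) X = image_module g (Obj F X)"
  "Map (transport g h F) X' X c = (\<lambda>\<xi>. g (Map F X' X c (h \<xi>)))"
  by (simp_all add: transport_def)

lemma transport_functor:
  assumes inj: "\<And>u. h (g u) = u" and F: "Mod_functor R K F"
  shows "Mod_functor R K (transport g h F)"
proof -
  note [simp] = transport_sel image_module_sel[where h=h and g=g, OF inj] inj
  note F = Mod_functorD[OF F]
  show ?thesis unfolding Mod_functor_def
  proof (intro conjI allI ballI)
    show "module R (Obj (transport g h F) X)" for X
      using module_image_module[of R "Obj F X" h g] F(1) inj by simp
    show "linear_map R (Obj (transport g h F) Y) (Obj (transport g h F) X) (Map (transport g h F) X Y f)"
      if "f \<in> mor K X Y" for X Y f
      using linear_map_image_module[where h=h and g=g and h'=h and g'=g, OF inj inj F(2)[OF that]] by simp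
    show "linear_map R (Hom K X Y) (Obj (transport g h F) X) (\<lambda>f. Map (transport g h F) X Y f u)"
      if "u \<in> elts (transport g h F) Y" for X Y u
      using that linear_map_compose[OF F(5)[of "h u" Y X] linear_map_wrap[where h=h and g=g, OF inj]] by auto
  qed (auto simp: F(3,4) linear_map_closed[OF F(2)])
qed

lemma transport_morphism:
  assumes inj: "\<And>u. h (g u) = u" "\<And>u. h' (g' u) = u"
    and \<phi>: "Mod_morphism R K F G \<phi>"
  shows "Mod_morphism R K (transport g h F) (transport g' h' G) (\<lambda>X \<xi>. g' (\<phi> X (h \<xi>)))"
  unfolding Mod_morphism_def
  using linear_map_image_module[where h=h and g=g and h'=h' and g'=g', OF inj Mod_morphismD(1)[OF \<phi>]]
    Mod_morphismD(2)[OF \<phi>]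
  by (auto simp: transport_sel image_module_sel[where h=h and g=g, OF inj(1)] inj)

lemma transport_exact:
  assumes inj: "\<And>u. h (g u) = u" "\<And>u. h' (g' u) = u" "\<And>u. h'' (g'' u) = u"
    and ex: "Mod_exact R K F \<phi> G \<psi> H"
  shows "Mod_exact R K (transport g h F) (\<lambda>X \<xi>. g' (\<phi> X (h \<xi>))) (transport g' h' G)
    (\<lambda>X \<xi>. g'' (\<psi> X (h' \<xi>))) (transport g'' h'' H)"
proof -
  have inj'': "g'' a = g'' b \<longleftrightarrow> a = b" for a b by (metis inj(3))
  have F: "Mod_functor R K F" and G: "Mod_functor R K G" and H: "Mod_functor R K H"
    and \<phi>: "Mod_morphism R K F G \<phi>" and \<psi>: "Mod_morphism R K G H \<psi>"
    and im: "\<And>X. \<phi> X ` elts F X = {u \<in> elts G X. \<psi> X u = \<zero>\<^bsub>Obj H X\<^esub>}"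
    using ex by (auto simp: Mod_exact_def)
  have "(\<lambda>\<xi>. g' (\<phi> X (h \<xi>))) ` (g ` elts F X) = g' ` (\<phi> X ` elts F X)" for X
    by (auto simp: inj image_image)
  then show ?thesis unfolding Mod_exact_def
    using transport_functor[where h=h and g=g, OF inj(1) F] transport_functor[where h=h' and g=g', OF inj(2) G]
      transport_functor[where h=h'' and g=g'', OF inj(3) H]
      transport_morphism[where h=h and g=g and h'=h' and g'=g', OF inj(1,2) \<phi>]
      transport_morphism[where h=h' and g=g' and h'=h'' and g'=g'', OF inj(2,3) \<psi>]
    by (auto simp: transport_sel image_module_sel[where h=h and g=g, OF inj(1)]
      image_module_sel[where h=h' and g=g', OF inj(2)] image_module_sel[where h=h'' and g=g'', OF inj(3)]
      inj inj'' im)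
qed

lemma Mod_morphism_from_transport:
  assumes inj: "\<And>u. h (g u) = u" and \<phi>: "Mod_morphism R K F G \<phi>"
  shows "Mod_morphism R K (transport g h F) G (\<lambda>X \<xi>. \<phi> X (h \<xi>))"
  using Mod_morphismD[OF \<phi>]
  by (fastforce simp: Mod_morphism_def linear_map_def transport_sel image_module_sel[where h=h and g=g, OF inj] inj)


section \<open>Linear categories and bilinear extension functors\<close>

context linear_category
begin

lemma comp_linear_right:
  "g \<in> mor K Y Z \<Longrightarrow> linear_map R (Hom K X Y) (Hom K X Z) (Comp K X Y Z g)"
  using comp_bilinear by (auto simp: bilinear_map_def)

lemma comp_linear_left:
  "f \<in> mor K X Y \<Longrightarrow> linear_map R (Hom K Y Z) (Hom K X Z) (\<lambda>g. Comp K X Y Z g f)"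
  using comp_bilinear by (auto simp: bilinear_map_def)

lemma comp_closed [simp, intro]:
  "f \<in> mor K X Y \<Longrightarrow> g \<in> mor K Y Z \<Longrightarrow> Comp K X Y Z g f \<in> mor K X Z"
  using linear_map_closed[OF comp_linear_right] by blast

lemma zero_mor [simp, intro]: "\<zero>\<^bsub>Hom K X Y\<^esub> \<in> mor K X Y"
  using hom_module module.axioms(2) abelian_group.a_group abelian_groupE(2) by blast

lemma comp_zero_right [simp]: "g \<in> mor K Y Z \<Longrightarrow> Comp K X Y Z g \<zero>\<^bsub>Hom K X Y\<^esub> = \<zero>\<^bsub>Hom K X Z\<^esub>"
  using linear_map_zero[OF hom_module hom_module comp_linear_right] by blast

lemma comp_zero_left [simp]: "f \<in> mor K X Y \<Longrightarrow> Comp K X Y Z \<zero>\<^bsub>Hom K Y Z\<^esub> f = \<zero>\<^bsub>Hom K X Z\<^esub>"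
  using linear_map_zero[OF hom_module hom_module comp_linear_left] by blast

lemma hom_minus_closed [simp, intro]:
  "f \<in> mor K X Y \<Longrightarrow> g \<in> mor K X Y \<Longrightarrow> f \<ominus>\<^bsub>Hom K X Y\<^esub> g \<in> mor K X Y"
  using abelian_group.minus_closed[OF module.axioms(2)[OF hom_module]] by blast

declare ident_mor [simp, intro] comp_ident_left [simp] comp_ident_right [simp]

lemma biproduct_zero_right:
  assumes "zero_object K Z"
  shows "biproduct K X Z \<lparr>Sm = X, In1 = Ident K X, In2 = \<zero>\<^bsub>Hom K Z X\<^esub>,
    Pr1 = Ident K X, Pr2 = \<zero>\<^bsub>Hom K X Z\<^esub>\<rparr>"
proof -
  interpret H: module R "Hom K X X" by (rule hom_module)
  have "Ident K Z = \<zero>\<^bsub>Hom K Z Z\<^esub>"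
    using assms ident_mor zero_mor unfolding zero_object_def by blast
  then show ?thesis by (simp add: biproduct_def)
qed

lemma biproduct_zero_left:
  assumes "zero_object K Z"
  shows "biproduct K Z X \<lparr>Sm = X, In1 = \<zero>\<^bsub>Hom K Z X\<^esub>, In2 = Ident K X,
    Pr1 = \<zero>\<^bsub>Hom K X Z\<^esub>, Pr2 = Ident K X\<rparr>"
proof -
  interpret H: module R "Hom K X X" by (rule hom_module)
  have "Ident K Z = \<zero>\<^bsub>Hom K Z Z\<^esub>"
    using assms ident_mor zero_mor unfolding zero_object_def by blast
  then show ?thesis by (simp add: biproduct_def)
qed

end

context bilinear_ext
begin

lemma push_linear: "a \<in> mor K A A' \<Longrightarrow> linear_map R (EE K C A) (EE K C A') (push K C A A' a)"
  using act_linear[OF ident_mor] by (simp add: push_def[abs_def])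

lemma pull_linear: "c \<in> mor K C' C \<Longrightarrow> linear_map R (EE K C A) (EE K C' A) (pull K C' C A c)"
  using act_linear[OF _ ident_mor] by (simp add: pull_def[abs_def])

lemma push_linear_mor:
  "\<delta> \<in> carrier (EE K C A) \<Longrightarrow> linear_map R (Hom K A A') (EE K C A') (\<lambda>a. push K C A A' a \<delta>)"
  using act_bilinear[of \<delta> C A C A'] ident_mor by (auto simp: push_def bilinear_map_def)

lemma pull_linear_mor:
  "\<delta> \<in> carrier (EE K C A) \<Longrightarrow> linear_map R (Hom K C' C) (EE K C' A) (\<lambda>c. pull K C' C A c \<delta>)"
  using act_bilinear[of \<delta> C A C' A] ident_mor by (auto simp: pull_def bilinear_map_def)

lemma push_closed [simp, intro]:
  "a \<in> mor K A A' \<Longrightarrow> \<delta> \<in> carrier (EE K C A) \<Longrightarrow> push K C A A' a \<delta> \<in> carrier (EE K C A')"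
  using linear_map_closed[OF push_linear] .

lemma pull_closed [simp, intro]:
  "c \<in> mor K C' C \<Longrightarrow> \<delta> \<in> carrier (EE K C A) \<Longrightarrow> pull K C' C A c \<delta> \<in> carrier (EE K C' A)"
  using linear_map_closed[OF pull_linear] .

lemma zero_ext [simp, intro]: "\<zero>\<^bsub>EE K C A\<^esub> \<in> carrier (EE K C A)"
  using ext_module module.axioms(2) abelian_groupE(2) by blast

lemma push_zero [simp]: "a \<in> mor K A A' \<Longrightarrow> push K C A A' a \<zero>\<^bsub>EE K C A\<^esub> = \<zero>\<^bsub>EE K C A'\<^esub>"
  using linear_map_zero[OF ext_module ext_module push_linear] .

lemma pull_zero [simp]: "c \<in> mor K C' C \<Longrightarrow> pull K C' C A c \<zero>\<^bsub>EE K C A\<^esub> = \<zero>\<^bsub>EE K C' A\<^esub>"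
  using linear_map_zero[OF ext_module ext_module pull_linear] .

lemma push_zero_mor [simp]:
  "\<delta> \<in> carrier (EE K C A) \<Longrightarrow> push K C A A' \<zero>\<^bsub>Hom K A A'\<^esub> \<delta> = \<zero>\<^bsub>EE K C A'\<^esub>"
  using linear_map_zero[OF hom_module ext_module push_linear_mor] .

lemma pull_zero_mor [simp]:
  "\<delta> \<in> carrier (EE K C A) \<Longrightarrow> pull K C' C A \<zero>\<^bsub>Hom K C' C\<^esub> \<delta> = \<zero>\<^bsub>EE K C' A\<^esub>"
  using linear_map_zero[OF hom_module ext_module pull_linear_mor] .

lemma push_id [simp]: "\<delta> \<in> carrier (EE K C A) \<Longrightarrow> push K C A A (Ident K A) \<delta> = \<delta>"
  by (simp add: push_def act_ident)

lemma pull_id [simp]: "\<delta> \<in> carrier (EE K C A) \<Longrightarrow> pull K C C A (Ident K C) \<delta> = \<delta>"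
  by (simp add: pull_def act_ident)

lemma push_comp:
  "a \<in> mor K A A' \<Longrightarrow> a' \<in> mor K A' A'' \<Longrightarrow> \<delta> \<in> carrier (EE K C A) \<Longrightarrow>
   push K C A A'' (Comp K A A' A'' a' a) \<delta> = push K C A' A'' a' (push K C A A' a \<delta>)"
  using act_comp[OF ident_mor[of C] ident_mor[of C], of a A A' a' A'' \<delta>] by (simp add: push_def)

lemma pull_comp:
  "c \<in> mor K C' C \<Longrightarrow> c' \<in> mor K C'' C' \<Longrightarrow> \<delta> \<in> carrier (EE K C A) \<Longrightarrow>
   pull K C'' C A (Comp K C'' C' C c c') \<delta> = pull K C'' C' A c' (pull K C' C A c \<delta>)"
  using act_comp[OF _ _ ident_mor[of A] ident_mor[of A], of c C' C c' C'' \<delta>] by (simp add: pull_def)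

lemma push_pull:
  assumes c: "c \<in> mor K C' C" and a: "a \<in> mor K A A'" and \<delta>: "\<delta> \<in> carrier (EE K C A)"
  shows "push K C' A A' a (pull K C' C A c \<delta>) = pull K C' C A' c (push K C A A' a \<delta>)"
  using act_comp[OF c ident_mor[of C'] ident_mor[of A] a \<delta>]
    act_comp[OF ident_mor[of C] c a ident_mor[of A'] \<delta>] a c
  by (simp add: push_def pull_def)

end


section \<open>Exact sequences of an s-triangle in degrees zero and one\<close>

lemma s_triangleD:
  assumes "s_triangle K A B C x y \<delta>"
  shows "x \<in> mor K A B" "y \<in> mor K B C" "\<delta> \<in> carrier (EE K C A)"
  using assms by (auto simp: s_triangle_def seqs_def)

lemma biproductD:
  assumes "biproduct K X Y P"
  shows "In1 P \<in> mor K X (Sm P)" "In2 P \<in> mor K Y (Sm P)"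
    "Pr1 P \<in> mor K (Sm P) X" "Pr2 P \<in> mor K (Sm P) Y"
    "Comp K X (Sm P) X (Pr1 P) (In1 P) = Ident K X"
    "Comp K Y (Sm P) Y (Pr2 P) (In2 P) = Ident K Y"
  using assms by (auto simp: biproduct_def)

lemma (in additive_realization) ex_realization:
  assumes "\<delta> \<in> carrier (EE K C A)"
  obtains B x y where "s_triangle K A B C x y \<delta>"
proof -
  obtain t where "t \<in> seqs K A C" "Real K C A \<delta> = seq_equiv K A C `` {t}"
    using real_class[OF assms] by (auto elim: quotientE)
  then show thesis using assms that by (cases t) (auto simp: s_triangle_def)
qed

context extriangulated_category
begin

lemma identity_triangle_left:
  assumes "zero_object K Z"
  shows "s_triangle K X X Z (Ident K X) \<zero>\<^bsub>Hom K X Z\<^esub> \<zero>\<^bsub>EE K Z X\<^esub>"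
  using real_zero[OF biproduct_zero_right[OF assms]] by simp

lemma identity_triangle_right:
  assumes "zero_object K Z"
  shows "s_triangle K Z X X \<zero>\<^bsub>Hom K Z X\<^esub> (Ident K X) \<zero>\<^bsub>EE K X Z\<^esub>"
  using real_zero[OF biproduct_zero_left[OF assms]] by simp

context
  fixes A B C x y \<delta>
  assumes tri: "s_triangle K A B C x y \<delta>"
begin

text \<open>
  The composites in the long exact sequence vanish because an s-triangle maps to and from the
  s-triangles of identities, in which a zero object occurs.
\<close>

lemma triangle_comp_zero: "Comp K A B C y x = \<zero>\<^bsub>Hom K A C\<^esub>"
proof -
  note [simp] = s_triangleD[OF tri]
  obtain Z where Z: "zero_object K Z" using ex_zero_object by blast
  show ?thesis
    using ET3[OF identity_triangle_left[OF Z] tri ident_mor s_triangleD(1)[OF tri]] by (auto simp: ext_morphism_def)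
qed

lemma triangle_push_zero: "push K C A B x \<delta> = \<zero>\<^bsub>EE K C B\<^esub>"
proof -
  note [simp] = s_triangleD[OF tri]
  obtain Z where Z: "zero_object K Z" using ex_zero_object by blast
  show ?thesis
    using ET3[OF tri identity_triangle_left[OF Z], of x B "Ident K B"] by (auto simp: ext_morphism_def)
qed

lemma triangle_pull_zero: "pull K B C A y \<delta> = \<zero>\<^bsub>EE K B A\<^esub>"
proof -
  note [simp] = s_triangleD[OF tri]
  obtain Z where Z: "zero_object K Z" using ex_zero_object by blast
  show ?thesis
    using ET3_op[OF identity_triangle_right[OF Z] tri ident_mor s_triangleD(2)[OF tri]] by (auto simp: ext_morphism_def)
qed

lemma factor_through_inflation:
  assumes f: "f \<in> mor K X B" and "Comp K X B C y f = \<zero>\<^bsub>Hom K X C\<^esub>"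
  shows "\<exists>g\<in>mor K X A. f = Comp K X A B x g"
proof -
  note [simp] = s_triangleD[OF tri]
  obtain Z where Z: "zero_object K Z" using ex_zero_object by blast
  show ?thesis
    using ET3_op[OF identity_triangle_left[OF Z] tri f, of "\<zero>\<^bsub>Hom K Z C\<^esub>"] assms
    by (auto simp: ext_morphism_def)
qed

text \<open>
  If \<open>f\<^sup>*\<delta> = 0\<close>, then \<open>(1, f)\<close> is a morphism of extensions from zero to \<open>\<delta>\<close>. It is realized by a map
  from a direct sum \<open>A \<oplus> X\<close>, whose restriction to \<open>X\<close> is the lift.
\<close>

lemma lift_along_deflation:
  assumes f: "f \<in> mor K X C" and "pull K X C A f \<delta> = \<zero>\<^bsub>EE K X A\<^esub>"
  shows "\<exists>g\<in>mor K X B. f = Comp K X B C y g"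
proof -
  note [simp] = s_triangleD[OF tri]
  obtain P where P: "biproduct K A X P" using ex_biproduct by blast
  note [simp] = biproductD[OF P]
  have "ext_morphism K X A \<zero>\<^bsub>EE K X A\<^esub> C A \<delta> (Ident K A) f"
    using assms by (simp add: ext_morphism_def)
  then obtain b where b: "b \<in> mor K (Sm P) B"
    and "Comp K (Sm P) B C y b = Comp K (Sm P) X C f (Pr2 P)"
    using real_morphism[OF real_zero[OF P] tri] by blast
  then have "Comp K X (Sm P) C (Comp K (Sm P) B C y b) (In2 P) = f"
    using f by (simp add: comp_assoc[symmetric, of "In2 P" X "Sm P" "Pr2 P" X f C])
  then show ?thesis using b comp_assoc[of "In2 P" X "Sm P" b B y C]
    by (intro bexI[of _ "Comp K X (Sm P) B b (In2 P)"]) auto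
qed

lemma extend_along_inflation:
  assumes a: "a \<in> mor K A Y" and "push K C A Y a \<delta> = \<zero>\<^bsub>EE K C Y\<^esub>"
  shows "\<exists>b\<in>mor K B Y. a = Comp K A B Y b x"
proof -
  note [simp] = s_triangleD[OF tri]
  obtain P where P: "biproduct K Y C P" using ex_biproduct by blast
  note [simp] = biproductD[OF P]
  have "ext_morphism K C A \<delta> C Y \<zero>\<^bsub>EE K C Y\<^esub> a (Ident K C)"
    using assms by (simp add: ext_morphism_def)
  then obtain b where b: "b \<in> mor K B (Sm P)"
    and "Comp K A B (Sm P) b x = Comp K A Y (Sm P) (In1 P) a"
    using real_morphism[OF tri real_zero[OF P]] by blast
  then have "Comp K A (Sm P) Y (Pr1 P) (Comp K A B (Sm P) b x) = a"
    using a by (simp add: comp_assoc[of a A Y "In1 P" "Sm P" "Pr1 P" Y])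
  then show ?thesis using b comp_assoc[of x A B b "Sm P" "Pr1 P" Y]
    by (intro bexI[of _ "Comp K B (Sm P) Y (Pr1 P) b"]) auto
qed

text \<open>
  Let \<open>Y \<rightarrow> Z \<rightarrow> C\<close> realize \<open>\<theta>\<close>. If \<open>y\<^sup>*\<theta> = 0\<close>, then \<open>y\<close> lifts to some \<open>s : B \<rightarrow> Z\<close>, and completing \<open>(s, 1)\<close> to
  a morphism of s-triangles gives \<open>a\<close> with \<open>a\<^sub>*\<delta> = 1\<^sup>*\<theta>\<close>.
\<close>

lemma pull_zero_imp_push:
  assumes \<theta>: "\<theta> \<in> carrier (EE K C Y)" and zero: "pull K B C Y y \<theta> = \<zero>\<^bsub>EE K B Y\<^esub>"
  shows "\<exists>a\<in>mor K A Y. \<theta> = push K C A Y a \<delta>"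
proof -
  note [simp] = s_triangleD[OF tri]
  obtain Z z' z where t: "s_triangle K Y Z C z' z \<theta>" using ex_realization[OF \<theta>] .
  obtain P where P: "biproduct K Y B P" using ex_biproduct by blast
  note [simp] = biproductD[OF P] s_triangleD[OF t]
  have "ext_morphism K B Y \<zero>\<^bsub>EE K B Y\<^esub> C Y \<theta> (Ident K Y) y"
    using zero by (simp add: ext_morphism_def)
  then obtain b where b: "b \<in> mor K (Sm P) Z"
    and *: "Comp K (Sm P) Z C z b = Comp K (Sm P) B C y (Pr2 P)"
    using real_morphism[OF real_zero[OF P] t] by blast
  define s where "s = Comp K B (Sm P) Z b (In2 P)"
  have s: "s \<in> mor K B Z" using b by (simp add: s_def comp_closed[of _ B "Sm P"])
  have "Comp K B Z C z s = Comp K B (Sm P) C (Comp K (Sm P) Z C z b) (In2 P)"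
    using b comp_assoc[of "In2 P" B "Sm P" b Z z C] by (simp add: s_def)
  also have "\<dots> = y"
    by (simp add: * comp_assoc[symmetric, of "In2 P" B "Sm P" "Pr2 P" B y C])
  finally have "Comp K B C C (Ident K C) y = Comp K B Z C z s" by simp
  from ET3_op[OF tri t s ident_mor this] \<theta> show ?thesis by (auto simp: ext_morphism_def)
qed

lemma push_zero_imp_pull:
  assumes \<theta>: "\<theta> \<in> carrier (EE K X A)" and zero: "push K X A B x \<theta> = \<zero>\<^bsub>EE K X B\<^esub>"
  shows "\<exists>c\<in>mor K X C. \<theta> = pull K X C A c \<delta>"
proof -
  note [simp] = s_triangleD[OF tri]
  obtain Z z' z where t: "s_triangle K A Z X z' z \<theta>" using ex_realization[OF \<theta>] .
  obtain P where P: "biproduct K B X P" using ex_biproduct by blast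
  note [simp] = biproductD[OF P] s_triangleD[OF t]
  have "ext_morphism K X A \<theta> X B \<zero>\<^bsub>EE K X B\<^esub> x (Ident K X)"
    using zero by (simp add: ext_morphism_def)
  then obtain b where b: "b \<in> mor K Z (Sm P)"
    and *: "Comp K A Z (Sm P) b z' = Comp K A B (Sm P) (In1 P) x"
    using real_morphism[OF t real_zero[OF P]] by blast
  define s where "s = Comp K Z (Sm P) B (Pr1 P) b"
  have s: "s \<in> mor K Z B" using b by (simp add: s_def comp_closed[of _ Z "Sm P"])
  have "Comp K A Z B s z' = Comp K A (Sm P) B (Pr1 P) (Comp K A Z (Sm P) b z')"
    using b comp_assoc[of z' A Z b "Sm P" "Pr1 P" B] by (simp add: s_def)
  also have "\<dots> = Comp K A A B x (Ident K A)"
    by (simp add: * comp_assoc[of x A B "In1 P" "Sm P" "Pr1 P" B])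
  finally have "Comp K A Z B s z' = Comp K A A B x (Ident K A)" .
  from ET3[OF t tri ident_mor s this] \<theta> show ?thesis by (auto simp: ext_morphism_def)
qed

end

end


section \<open>Projective triangles\<close>

definition projective_triangle ::
  "('r, 'o, 'm, 'e) ecat \<Rightarrow> 'o \<Rightarrow> 'o \<Rightarrow> 'o \<Rightarrow> 'm \<Rightarrow> 'm \<Rightarrow> 'e \<Rightarrow> bool" where
  "projective_triangle K \<Omega> G X j g \<omega> \<longleftrightarrow>
     s_triangle K \<Omega> G X j g \<omega> \<and> projective_morphism K G X g"

lemma projective_triangleD:
  assumes "projective_triangle K \<Omega> G X j g \<omega>"
  shows "s_triangle K \<Omega> G X j g \<omega>" "projective_morphism K G X g"
    "j \<in> mor K \<Omega> G" "g \<in> mor K G X" "\<omega> \<in> carrier (EE K X \<Omega>)"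
  using assms by (auto simp: projective_triangle_def dest: s_triangleD)

lemma projective_morphismD:
  assumes "projective_morphism K G X g"
  shows "g \<in> mor K G X" "\<tau> \<in> carrier (EE K X M) \<Longrightarrow> pull K G X M g \<tau> = \<zero>\<^bsub>EE K G M\<^esub>"
  using assms by (auto simp: projective_morphism_def)

locale enough_projectives = extriangulated_category +
  assumes enough_projectives: "enough_projective_morphisms K"
begin

lemma ex_projective_triangle:
  obtains \<Omega> G j g \<omega> where "projective_triangle K \<Omega> G X j g \<omega>"
  using enough_projectives
  by (auto simp: enough_projective_morphisms_def deflation_def projective_triangle_def) metis

lemma projective_comp:
  assumes "projective_morphism K H B h" "y \<in> mor K B C"
  shows "projective_morphism K H C (Comp K H B C y h)"
  using assms projective_morphismD[OF assms(1)] 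
  by (auto simp: projective_morphism_def pull_comp)

lemma projective_triangle_push:
  assumes "projective_triangle K \<Omega> G X j g \<omega>" "\<tau> \<in> carrier (EE K X M)"
  obtains a where "a \<in> mor K \<Omega> M" "\<tau> = push K X \<Omega> M a \<omega>"
  using pull_zero_imp_push[OF projective_triangleD(1)[OF assms(1)] assms(2)] assms
    projective_morphismD(2)[OF projective_triangleD(2)[OF assms(1)]] by blast

text \<open>
  (ET4)\<open>\<^sup>o\<^sup>p\<close> for the deflations \<open>h : H \<rightarrow> B\<close> and \<open>y : B \<rightarrow> C\<close>. Their composite is projective because \<open>h\<close> is,
  so \<open>F\<close> and \<open>E\<close> are syzygies of \<open>B\<close> and \<open>C\<close>; the s-triangle \<open>F \<rightarrow> E \<rightarrow> A\<close> is the given one, rotated.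
\<close>

lemma syzygy_triangle:
  assumes "s_triangle K A B C x y \<delta>" "projective_triangle K F H B g h \<theta>"
  obtains E d e j \<epsilon> where "d \<in> mor K E A" "e \<in> mor K F E"
    "projective_triangle K E H C j (Comp K H B C y h) \<epsilon>"
    "Comp K E H B h j = Comp K E A B x d" "Comp K F E H j e = g"
    "s_triangle K F E A e d (pull K A B F x \<theta>)"
    "push K C E A d \<epsilon> = \<delta>" "pull K B C E y \<epsilon> = push K B F E e \<theta>"
proof -
  have "projective_morphism K H C (Comp K H B C y h)"
    using projective_comp[OF projective_triangleD(2)[OF assms(2)] s_triangleD(2)[OF assms(1)]] .
  then show thesis
    using ET4_op[OF assms(1) projective_triangleD(1)[OF assms(2)]] that
    unfolding projective_triangle_def by blast
qed

text \<open>
  The middle term of a projective triangle need not be projective, so \<open>\<bbbE>\<close> need not vanish on it;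
  but every extension of it becomes zero along a second projective deflation \<open>p\<close> onto that term.
\<close>

lemma refine_projective_triangle:
  assumes t: "projective_triangle K \<Omega> G X j g \<omega>"
  obtains \<Omega>' G' j' g' \<omega>' k p where "projective_triangle K \<Omega>' G' X j' g' \<omega>'"
    "projective_morphism K G' G p" "k \<in> mor K \<Omega>' \<Omega>" "push K X \<Omega>' \<Omega> k \<omega>' = \<omega>"
    "Comp K \<Omega>' \<Omega> G j k = Comp K \<Omega>' G' G p j'"
proof -
  obtain F G' f p \<theta> where t': "projective_triangle K F G' G f p \<theta>"
    using ex_projective_triangle .
  show thesis
    by (rule syzygy_triangle[OF projective_triangleD(1)[OF t] t'])
      (use that projective_triangleD(2)[OF t'] in metis)
qed

end


section \<open>Sums over multisets in an abelian group\<close>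

text \<open>
  Summands and partial sums outside the carrier are skipped. This makes the folded function commute
  with itself on the whole type, as a fold over a multiset requires.
\<close>

definition msum :: "('a, 'b) ring_scheme \<Rightarrow> ('t \<Rightarrow> 'a) \<Rightarrow> 't multiset \<Rightarrow> 'a" where
  "msum N f u = fold_mset
     (\<lambda>p s. if f p \<in> carrier N \<and> s \<in> carrier N then f p \<oplus>\<^bsub>N\<^esub> s else s) \<zero>\<^bsub>N\<^esub> u"

context abelian_group
begin

lemma msum_empty [simp]: "msum G f {#} = \<zero>"
  by (simp add: msum_def)

lemma msum_add_mset':
  "msum G f (add_mset p u) =
     (if f p \<in> carrier G \<and> msum G f u \<in> carrier G then f p \<oplus> msum G f u else msum G f u)"
proof -
  have "comp_fun_commute (\<lambda>p s. if f p \<in> carrier G \<and> s \<in> carrier G then f p \<oplus> s else s)"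
    by standard (auto simp: fun_eq_iff a_lcomm)
  then show ?thesis
    unfolding msum_def by (subst comp_fun_commute.fold_mset_add_mset) auto
qed

lemma msum_closed [simp, intro]: "msum G f u \<in> carrier G"
  by (induction u) (auto simp: msum_add_mset')

lemma msum_add_mset [simp]:
  "f p \<in> carrier G \<Longrightarrow> msum G f (add_mset p u) = f p \<oplus> msum G f u"
  by (simp add: msum_add_mset')

lemma msum_union:
  "(\<And>p. p \<in># u \<Longrightarrow> f p \<in> carrier G) \<Longrightarrow> msum G f (u + v) = msum G f u \<oplus> msum G f v"
  by (induction u) (auto simp: a_assoc)

end


section \<open>Coends against the extension functor\<close>

lemma ext_cov_sel [simp]:
  "Obj (ext_cov K X) Y = EE K X Y" "Map (ext_cov K X) Y Z a = push K X Y Z a"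
  by (simp_all add: ext_cov_def)

lemma formal_sums_simps [simp]:
  "{#} \<in> formal_sums P Q"
  "add_mset (M, \<rho>, \<tau>) u \<in> formal_sums P Q \<longleftrightarrow>
     \<rho> \<in> elts P M \<and> \<tau> \<in> elts Q M \<and> u \<in> formal_sums P Q"
  "u + v \<in> formal_sums P Q \<longleftrightarrow> u \<in> formal_sums P Q \<and> v \<in> formal_sums P Q"
  by (simp_all add: formal_sums_def ball_Un)

lemma coend_fun_sel:
  "elts (coend_fun R K P) X = coend_class R K P X ` formal_sums P (ext_cov K X)"
  "\<zero>\<^bsub>Obj (coend_fun R K P) X\<^esub> = coend_class R K P X {#}"
  "\<xi> \<oplus>\<^bsub>Obj (coend_fun R K P) X\<^esub> \<eta> = coend_class R K P X (un_Cls \<xi> + un_Cls \<eta>)"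
  "r \<odot>\<^bsub>Obj (coend_fun R K P) X\<^esub> \<xi> = coend_class R K P X
     (image_mset (\<lambda>(M, \<rho>, \<tau>). (M, r \<odot>\<^bsub>Obj P M\<^esub> \<rho>, \<tau>)) (un_Cls \<xi>))"
  "Map (coend_fun R K P) X' X c \<xi> = coend_class R K P X'
     (image_mset (\<lambda>(M, \<rho>, \<tau>). (M, \<rho>, pull K X' X M c \<tau>)) (un_Cls \<xi>))"
  by (simp_all add: coend_fun_def)

abbreviation pure ::
  "'r ring \<Rightarrow> ('r, 'o, 'm, 'e) ecat \<Rightarrow> ('r, 'o, 'm, ('o, 'm, 'e) pext) mfun \<Rightarrow> 'o \<Rightarrow>
   'o \<Rightarrow> ('o, 'm, 'e) pext \<Rightarrow> 'e \<Rightarrow> ('o, 'm, 'e) pext" where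
  "pure R K P X M \<rho> \<tau> \<equiv> coend_class R K P X {#(M, \<rho>, \<tau>)#}"

text \<open>The map of coends induced by a natural transformation of the first tensor factor.\<close>

definition coend_map ::
  "'r ring \<Rightarrow> ('r, 'o, 'm, 'e) ecat \<Rightarrow> ('r, 'o, 'm, ('o, 'm, 'e) pext) mfun \<Rightarrow>
   ('o \<Rightarrow> ('o, 'm, 'e) pext \<Rightarrow> ('o, 'm, 'e) pext) \<Rightarrow> 'o \<Rightarrow> ('o, 'm, 'e) pext \<Rightarrow> ('o, 'm, 'e) pext" where
  "coend_map R K P \<phi> X \<xi> =
     coend_class R K P X (image_mset (\<lambda>(M, \<rho>, \<tau>). (M, \<phi> M \<rho>, \<tau>)) (un_Cls \<xi>))"

lemma (in bilinear_ext) Mod_functor_closed: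
  assumes "Mod_functor R K P"
  shows "f \<in> mor K X Y \<Longrightarrow> u \<in> elts P Y \<Longrightarrow> Map P X Y f u \<in> elts P X"
    and "\<zero>\<^bsub>Obj P X\<^esub> \<in> elts P X"
    and "u \<in> elts P X \<Longrightarrow> v \<in> elts P X \<Longrightarrow> u \<oplus>\<^bsub>Obj P X\<^esub> v \<in> elts P X"
    and "r \<in> carrier R \<Longrightarrow> u \<in> elts P X \<Longrightarrow> r \<odot>\<^bsub>Obj P X\<^esub> u \<in> elts P X"
    and "f \<in> mor K X Y \<Longrightarrow> Map P X Y f \<zero>\<^bsub>Obj P Y\<^esub> = \<zero>\<^bsub>Obj P X\<^esub>"
proof -
  note P = Mod_functorD[OF assms]
  interpret M: module R "Obj P X" by (rule P)
  show "f \<in> mor K X Y \<Longrightarrow> u \<in> elts P Y \<Longrightarrow> Map P X Y f u \<in> elts P X"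
    using P(2) by (rule linear_map_closed)
  show "f \<in> mor K X Y \<Longrightarrow> Map P X Y f \<zero>\<^bsub>Obj P Y\<^esub> = \<zero>\<^bsub>Obj P X\<^esub>"
    using linear_map_zero[OF P(1,1,2)] .
  show "\<zero>\<^bsub>Obj P X\<^esub> \<in> elts P X" by simp
  show "u \<in> elts P X \<Longrightarrow> v \<in> elts P X \<Longrightarrow> u \<oplus>\<^bsub>Obj P X\<^esub> v \<in> elts P X" by simp
  show "r \<in> carrier R \<Longrightarrow> u \<in> elts P X \<Longrightarrow> r \<odot>\<^bsub>Obj P X\<^esub> u \<in> elts P X" by simp
qed

text \<open>
  All operations on coend elements act on a representative. With scalar multiplications, pushforwards
  and connecting maps for \<open>\<phi>\<close>, or pullbacks for \<open>\<psi>\<close>, this lemma makes them independent of its choice.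
\<close>

lemma (in bilinear_ext) coend_eq_image:
  assumes P: "Mod_functor R K P" and P': "Mod_functor R K P'"
    and \<phi>: "Mod_morphism R K P P' \<phi>"
    and \<psi>: "\<And>M. linear_map R (EE K X M) (EE K X' M) (\<psi> M)"
    and nat: "\<And>M N c \<tau>. c \<in> mor K M N \<Longrightarrow> \<tau> \<in> carrier (EE K X M) \<Longrightarrow>
      \<psi> N (push K X M N c \<tau>) = push K X' M N c (\<psi> M \<tau>)"
    and eq: "coend_eq R K P (ext_cov K X) u v"
  shows "coend_eq R K P' (ext_cov K X')
    (image_mset (\<lambda>(M, \<rho>, \<tau>). (M, \<phi> M \<rho>, \<psi> M \<tau>)) u)
    (image_mset (\<lambda>(M, \<rho>, \<tau>). (M, \<phi> M \<rho>, \<psi> M \<tau>)) v)"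
  using eq
proof induction
  case (reflexive u)
  then show ?case
    using linear_map_closed[OF \<psi>] linear_map_closed[OF Mod_morphismD(1)[OF \<phi>]]
    by (intro coend_eq.reflexive) (fastforce simp: formal_sums_def)
next
  case (transitive u v w)
  then show ?case by (rule_tac coend_eq.transitive)
next
  case (plus u u' v v')
  then show ?case by (simp add: coend_eq.plus)
next
  case (zero \<tau> M)
  then show ?case
    using linear_map_zero[OF Mod_functorD(1)[OF P] Mod_functorD(1)[OF P'] Mod_morphismD(1)[OF \<phi>]]
      linear_map_closed[OF \<psi>] by (simp add: coend_eq.zero)
next
  case (add_left \<rho> M \<rho>' \<tau>)
  then show ?case
    using linear_map_closed[OF \<psi>] linear_map_closed[OF Mod_morphismD(1)[OF \<phi>]]
      linear_map_add[OF Mod_morphismD(1)[OF \<phi>]] by (simp add: coend_eq.add_left)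
next
  case (add_right \<rho> M \<tau> \<tau>')
  then show ?case
    using linear_map_closed[OF \<psi>] linear_map_closed[OF Mod_morphismD(1)[OF \<phi>]]
      linear_map_add[OF \<psi>] coend_eq.add_right[of "\<phi> M \<rho>" P' M "\<psi> M \<tau>" "ext_cov K X'" "\<psi> M \<tau>'"]
    by simp
next
  case (balanced r \<rho> M \<tau>)
  then show ?case
    using linear_map_closed[OF \<psi>] linear_map_closed[OF Mod_morphismD(1)[OF \<phi>]]
      linear_map_smult[OF \<psi>] linear_map_smult[OF Mod_morphismD(1)[OF \<phi>]]
      coend_eq.balanced[of r R "\<phi> M \<rho>" P' M "\<psi> M \<tau>" "ext_cov K X'"]
    by simp
next
  case (dinatural c M N \<rho> \<tau>)
  then show ?case
    using linear_map_closed[OF \<psi>] linear_map_closed[OF Mod_morphismD(1)[OF \<phi>]]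
      Mod_morphismD(2)[OF \<phi>] nat
      coend_eq.dinatural[of c K M N "\<phi> N \<rho>" P' "\<psi> M \<tau>" "ext_cov K X'"]
    by simp
qed (rule coend_eq.symmetric)

locale coend_functor = bilinear_ext R K for R :: "'r ring" (structure)
    and K :: "('r, 'o, 'm, 'e) ecat" +
  fixes P :: "('r, 'o, 'm, ('o, 'm, 'e) pext) mfun"
  assumes P_functor: "Mod_functor R K P"
begin

lemma coend_class_cong:
  assumes "coend_eq R K P (ext_cov K X) u v"
  shows "coend_class R K P X u = coend_class R K P X v"
proof -
  have "coend_eq R K P (ext_cov K X) u = coend_eq R K P (ext_cov K X) v"
    using coend_eq.transitive[OF assms] coend_eq.transitive[OF coend_eq.symmetric[OF assms]]
    by (intro ext iffI)
  then show ?thesis by (simp add: coend_class_def)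
qed

lemma coend_class_rep:
  assumes "u \<in> formal_sums P (ext_cov K X)"
  shows "coend_eq R K P (ext_cov K X) u (un_Cls (coend_class R K P X u))"
  unfolding coend_class_def using someI[of "coend_eq R K P (ext_cov K X) u", OF coend_eq.reflexive[OF assms]]
  by simp

lemma coend_classD:
  assumes "u \<in> formal_sums P (ext_cov K X)" "v \<in> formal_sums P (ext_cov K X)"
    "coend_class R K P X u = coend_class R K P X v"
  shows "coend_eq R K P (ext_cov K X) u v"
  using coend_eq.transitive[OF coend_class_rep[OF assms(1)]
    coend_eq.symmetric[OF coend_class_rep[OF assms(2)], folded assms(3)]] .

lemma coend_add_class:
  assumes "u \<in> formal_sums P (ext_cov K X)" "v \<in> formal_sums P (ext_cov K X)"
  shows "coend_class R K P X u \<oplus>\<^bsub>Obj (coend_fun R K P) X\<^esub> coend_class R K P X v =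
    coend_class R K P X (u + v)"
  unfolding coend_fun_sel
  by (intro coend_class_cong coend_eq.symmetric[OF coend_eq.plus] coend_class_rep assms)

lemma scaling_morphism:
  assumes r: "r \<in> carrier R"
  shows "Mod_morphism R K P P (\<lambda>M \<rho>. r \<odot>\<^bsub>Obj P M\<^esub> \<rho>)"
  unfolding Mod_morphism_def
proof (intro conjI allI ballI)
  fix X
  interpret M: module R "Obj P X" using P_functor by (rule Mod_functorD)
  show "linear_map R (Obj P X) (Obj P X) (\<lambda>\<rho>. r \<odot>\<^bsub>Obj P X\<^esub> \<rho>)"
    using r by (intro linear_mapI) (auto simp: M.smult_r_distr M.smult_assoc1[symmetric] m_comm)
next
  show "r \<odot>\<^bsub>Obj P X\<^esub> Map P X Y f u = Map P X Y f (r \<odot>\<^bsub>Obj P Y\<^esub> u)"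
    if "f \<in> mor K X Y" "u \<in> elts P Y" for X Y f u
    using linear_map_smult[OF Mod_functorD(2)[OF P_functor that(1)] r that(2)] by simp
qed

lemma identity_morphism: "Mod_morphism R K P P (\<lambda>M \<rho>. \<rho>)"
  by (auto simp: Mod_morphism_def linear_map_def)

lemma coend_map_class:
  assumes P': "Mod_functor R K P'" and \<phi>: "Mod_morphism R K P P' \<phi>"
    and u: "u \<in> formal_sums P (ext_cov K X)"
  shows "coend_map R K P' \<phi> X (coend_class R K P X u) =
    coend_class R K P' X (image_mset (\<lambda>(M, \<rho>, \<tau>). (M, \<phi> M \<rho>, \<tau>)) u)"
proof -
  interpret P': coend_functor R K P' using P' by unfold_locales
  have *: "linear_map R (EE K X M) (EE K X M) (\<lambda>\<tau>. \<tau>)" for M by (auto simp: linear_map_def)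
  show ?thesis unfolding coend_map_def
    by (intro P'.coend_class_cong coend_eq.symmetric[OF coend_eq_image[OF P_functor P' \<phi> *]] 
      coend_class_rep u) auto
qed

lemma coend_smult_class:
  assumes "r \<in> carrier R" "u \<in> formal_sums P (ext_cov K X)"
  shows "r \<odot>\<^bsub>Obj (coend_fun R K P) X\<^esub> coend_class R K P X u =
    coend_class R K P X (image_mset (\<lambda>(M, \<rho>, \<tau>). (M, r \<odot>\<^bsub>Obj P M\<^esub> \<rho>, \<tau>)) u)"
  using coend_map_class[OF P_functor scaling_morphism[OF assms(1)] assms(2)]
  unfolding coend_map_def coend_fun_sel .

lemma coend_Map_class:
  assumes c: "c \<in> mor K X' X" and u: "u \<in> formal_sums P (ext_cov K X)"
  shows "Map (coend_fun R K P) X' X c (coend_class R K P X u) =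
    coend_class R K P X' (image_mset (\<lambda>(M, \<rho>, \<tau>). (M, \<rho>, pull K X' X M c \<tau>)) u)"
  unfolding coend_fun_sel
  by (intro coend_class_cong coend_eq.symmetric[OF coend_eq_image[OF P_functor P_functor identity_morphism pull_linear]]
      coend_class_rep u c) (auto simp: push_pull c)

lemma pure_in [simp, intro]:
  "\<rho> \<in> elts P M \<Longrightarrow> \<tau> \<in> carrier (EE K X M) \<Longrightarrow> pure R K P X M \<rho> \<tau> \<in> elts (coend_fun R K P) X"
  by (auto simp: coend_fun_sel)

lemma pure_add_left:
  assumes "\<rho> \<in> elts P M" "\<rho>' \<in> elts P M" "\<tau> \<in> carrier (EE K X M)"
  shows "pure R K P X M (\<rho> \<oplus>\<^bsub>Obj P M\<^esub> \<rho>') \<tau> =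
    pure R K P X M \<rho> \<tau> \<oplus>\<^bsub>Obj (coend_fun R K P) X\<^esub> pure R K P X M \<rho>' \<tau>"
  using assms coend_class_cong[OF coend_eq.add_left[of \<rho> P M \<rho>' \<tau> "ext_cov K X"]]
  by (simp add: coend_add_class add_mset_commute)

lemma pure_add_right:
  assumes "\<rho> \<in> elts P M" "\<tau> \<in> carrier (EE K X M)" "\<tau>' \<in> carrier (EE K X M)"
  shows "pure R K P X M \<rho> (\<tau> \<oplus>\<^bsub>EE K X M\<^esub> \<tau>') =
    pure R K P X M \<rho> \<tau> \<oplus>\<^bsub>Obj (coend_fun R K P) X\<^esub> pure R K P X M \<rho> \<tau>'"
  using assms coend_class_cong[OF coend_eq.add_right[of \<rho> P M \<tau> "ext_cov K X" \<tau>']]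
  by (simp add: coend_add_class add_mset_commute)

lemma pure_smult_left:
  assumes "r \<in> carrier R" "\<rho> \<in> elts P M" "\<tau> \<in> carrier (EE K X M)"
  shows "pure R K P X M (r \<odot>\<^bsub>Obj P M\<^esub> \<rho>) \<tau> = r \<odot>\<^bsub>Obj (coend_fun R K P) X\<^esub> pure R K P X M \<rho> \<tau>"
  using assms by (simp add: coend_smult_class)

lemma pure_smult_right:
  assumes "r \<in> carrier R" "\<rho> \<in> elts P M" "\<tau> \<in> carrier (EE K X M)"
  shows "pure R K P X M \<rho> (r \<odot>\<^bsub>EE K X M\<^esub> \<tau>) = r \<odot>\<^bsub>Obj (coend_fun R K P) X\<^esub> pure R K P X M \<rho> \<tau>"
  using assms coend_class_cong[OF coend_eq.balanced[of r R \<rho> P M \<tau> "ext_cov K X"]]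
  by (simp add: pure_smult_left)

lemma pure_dinatural:
  assumes "c \<in> mor K M N" "\<rho> \<in> elts P N" "\<tau> \<in> carrier (EE K X M)"
  shows "pure R K P X M (Map P M N c \<rho>) \<tau> = pure R K P X N \<rho> (push K X M N c \<tau>)"
  using assms coend_class_cong[OF coend_eq.dinatural[of c K M N \<rho> P \<tau> "ext_cov K X"]] by simp

lemma pure_zero_left:
  "\<tau> \<in> carrier (EE K X M) \<Longrightarrow> pure R K P X M \<zero>\<^bsub>Obj P M\<^esub> \<tau> = \<zero>\<^bsub>Obj (coend_fun R K P) X\<^esub>"
  using coend_class_cong[OF coend_eq.zero[of \<tau> "ext_cov K X" M R K P]] by (simp add: coend_fun_sel)

lemma pure_zero_right:
  assumes \<rho>: "\<rho> \<in> elts P M"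
  shows "pure R K P X M \<rho> \<zero>\<^bsub>EE K X M\<^esub> = \<zero>\<^bsub>Obj (coend_fun R K P) X\<^esub>"
proof -
  interpret M: module R "Obj P M" using P_functor by (rule Mod_functorD)
  interpret E: module R "EE K X M" by (rule ext_module)
  have "pure R K P X M \<rho> \<zero>\<^bsub>EE K X M\<^esub> = pure R K P X M \<rho> (\<zero> \<odot>\<^bsub>EE K X M\<^esub> \<zero>\<^bsub>EE K X M\<^esub>)" by simp
  also have "\<dots> = pure R K P X M (\<zero> \<odot>\<^bsub>Obj P M\<^esub> \<rho>) \<zero>\<^bsub>EE K X M\<^esub>"
    unfolding pure_smult_right[OF zero_closed \<rho> zero_ext] pure_smult_left[OF zero_closed \<rho> zero_ext] ..
  finally show ?thesis using \<rho> by (simp add: pure_zero_left)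
qed

lemma Map_pure:
  assumes "c \<in> mor K X' X" "\<rho> \<in> elts P M" "\<tau> \<in> carrier (EE K X M)"
  shows "Map (coend_fun R K P) X' X c (pure R K P X M \<rho> \<tau>) = pure R K P X' M \<rho> (pull K X' X M c \<tau>)"
  using assms by (simp add: coend_Map_class)

lemma coend_map_pure:
  assumes "Mod_functor R K P'" "Mod_morphism R K P P' \<phi>" "\<rho> \<in> elts P M" "\<tau> \<in> carrier (EE K X M)"
  shows "coend_map R K P' \<phi> X (pure R K P X M \<rho> \<tau>) = pure R K P' X M (\<phi> M \<rho>) \<tau>"
  using assms by (simp add: coend_map_class)

end


section \<open>Presentation of coends by projective triangles\<close>

locale projective_coend_functor = coend_functor + enough_projectives
begin

lemma coend_elements_pure:
  assumes t: "projective_triangle K \<Omega> G X j g \<omega>" and \<xi>: "\<xi> \<in> elts (coend_fun R K P) X"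
  obtains \<rho> where "\<rho> \<in> elts P \<Omega>" "\<xi> = pure R K P X \<Omega> \<rho> \<omega>"
proof -
  note [simp] = projective_triangleD[OF t]
  have *: "\<exists>\<rho>\<in>elts P \<Omega>. coend_eq R K P (ext_cov K X) u {#(\<Omega>, \<rho>, \<omega>)#}"
    if "u \<in> formal_sums P (ext_cov K X)" for u
    using that
  proof (induction u)
    case empty
    have "coend_eq R K P (ext_cov K X) {#} {#(\<Omega>, \<zero>\<^bsub>Obj P \<Omega>\<^esub>, \<omega>)#}"
      by (rule coend_eq.symmetric, rule coend_eq.zero) simp
    then show ?case using Mod_functor_closed(2)[OF P_functor] by blast
  next
    case (add p u)
    obtain M \<rho>' \<tau> where p: "p = (M, \<rho>', \<tau>)" by (cases p)
    with add.prems have in': "\<rho>' \<in> elts P M" "\<tau> \<in> carrier (EE K X M)" "u \<in> formal_sums P (ext_cov K X)"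
      by auto
    then obtain \<rho> where \<rho>: "\<rho> \<in> elts P \<Omega>" "coend_eq R K P (ext_cov K X) u {#(\<Omega>, \<rho>, \<omega>)#}"
      using add.IH by blast
    obtain a where a: "a \<in> mor K \<Omega> M" "\<tau> = push K X \<Omega> M a \<omega>"
      using projective_triangle_push[OF t in'(2)] .
    have \<sigma>: "Map P \<Omega> M a \<rho>' \<in> elts P \<Omega>" using a in' by (simp add: Mod_functor_closed[OF P_functor])
    have "coend_eq R K P (ext_cov K X) {#p#} {#(\<Omega>, Map P \<Omega> M a \<rho>', \<omega>)#}"
      using coend_eq.symmetric[OF coend_eq.dinatural[of a K \<Omega> M \<rho>' P \<omega> "ext_cov K X" R]] a in' p
      by simp
    then have "coend_eq R K P (ext_cov K X) ({#p#} + u) ({#(\<Omega>, Map P \<Omega> M a \<rho>', \<omega>)#} + {#(\<Omega>, \<rho>, \<omega>)#})"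
      using \<rho>(2) by (rule coend_eq.plus)
    moreover have "coend_eq R K P (ext_cov K X) ({#(\<Omega>, Map P \<Omega> M a \<rho>', \<omega>)#} + {#(\<Omega>, \<rho>, \<omega>)#})
        {#(\<Omega>, Map P \<Omega> M a \<rho>' \<oplus>\<^bsub>Obj P \<Omega>\<^esub> \<rho>, \<omega>)#}"
      using coend_eq.symmetric[OF coend_eq.add_left[of "Map P \<Omega> M a \<rho>'" P \<Omega> \<rho> \<omega> "ext_cov K X" R K]] \<rho>(1) \<sigma>
      by (simp add: add_mset_commute)
    ultimately have "coend_eq R K P (ext_cov K X) ({#p#} + u)
        {#(\<Omega>, Map P \<Omega> M a \<rho>' \<oplus>\<^bsub>Obj P \<Omega>\<^esub> \<rho>, \<omega>)#}"
      by (rule coend_eq.transitive)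
    then show ?case
      using \<sigma> \<rho>(1) Mod_functor_closed(3)[OF P_functor] by auto
  qed
  obtain u where "u \<in> formal_sums P (ext_cov K X)" "\<xi> = coend_class R K P X u"
    using \<xi> unfolding coend_fun_sel by blast
  then show thesis using * coend_class_cong that by blast
qed

text \<open>
  Choosing for every \<open>\<tau> \<in> \<bbbE>(X, M)\<close> some \<open>a\<close> with \<open>a\<^sub>*\<omega> = \<tau>\<close>, the rule \<open>\<rho> \<otimes> \<tau> \<mapsto> a\<^sup>*\<rho>\<close>
  defines a map from formal sums to \<open>P \<Omega>\<close>. Two choices of \<open>a\<close> differ by a morphism that factors
  through \<open>j\<close>, so modulo \<open>j\<^sup>*(P G)\<close> this map is compatible with all relations of the coend.
  Up to elements of \<open>j\<^sup>*(P G)\<close>, it recovers \<open>\<rho>\<close> from \<open>\<rho> \<otimes> \<omega>\<close>.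
\<close>

lemma pure_eq_zero_imp:
  assumes t: "projective_triangle K \<Omega> G X j g \<omega>" and \<rho>: "\<rho> \<in> elts P \<Omega>"
    and zero: "pure R K P X \<Omega> \<rho> \<omega> = \<zero>\<^bsub>Obj (coend_fun R K P) X\<^esub>"
  shows "\<exists>\<sigma>\<in>elts P G. \<rho> = Map P \<Omega> G j \<sigma>"
proof -
  note [simp] = projective_triangleD[OF t]
  note F = Mod_functorD[OF P_functor] and [simp, intro] = Mod_functor_closed[OF P_functor]
  interpret N: module R "Obj P \<Omega>" by (rule F)
  interpret G: module R "Obj P G" by (rule F)
  define rel where "rel a b \<longleftrightarrow> a \<in> elts P \<Omega> \<and> b \<in> elts P \<Omega> \<and>
    (\<exists>\<sigma>\<in>elts P G. a = b \<oplus>\<^bsub>Obj P \<Omega>\<^esub> Map P \<Omega> G j \<sigma>)" for a b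
  have Mj: "linear_map R (Obj P G) (Obj P \<Omega>) (Map P \<Omega> G j)" by (rule F) simp
  have Mj_in [simp]: "Map P \<Omega> G j \<sigma> \<in> elts P \<Omega>" if "\<sigma> \<in> elts P G" for \<sigma> using that by simp
  have rel_refl: "rel a a" if "a \<in> elts P \<Omega>" for a
    unfolding rel_def using that by (auto intro!: bexI[of _ "\<zero>\<^bsub>Obj P G\<^esub>"])
  have rel_sym: "rel b a" if "rel a b" for a b
  proof -
    from that obtain \<sigma> where *: "a \<in> elts P \<Omega>" "b \<in> elts P \<Omega>" "\<sigma> \<in> elts P G"
      "a = b \<oplus>\<^bsub>Obj P \<Omega>\<^esub> Map P \<Omega> G j \<sigma>" unfolding rel_def by blast
    have "Map P \<Omega> G j \<sigma> \<oplus>\<^bsub>Obj P \<Omega>\<^esub> Map P \<Omega> G j (\<ominus>\<^bsub>Obj P G\<^esub> \<sigma>) = \<zero>\<^bsub>Obj P \<Omega>\<^esub>"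
      using linear_map_add[OF Mj, of \<sigma> "\<ominus>\<^bsub>Obj P G\<^esub> \<sigma>"] *(3) by (simp add: G.r_neg)
    then have "b = a \<oplus>\<^bsub>Obj P \<Omega>\<^esub> Map P \<Omega> G j (\<ominus>\<^bsub>Obj P G\<^esub> \<sigma>)"
      using * by (simp add: N.a_assoc)
    then show ?thesis unfolding rel_def using * G.a_inv_closed by blast
  qed
  have rel_trans: "rel a c" if "rel a b" "rel b c" for a b c
  proof -
    from that obtain \<sigma> \<sigma>' where *: "a \<in> elts P \<Omega>" "b \<in> elts P \<Omega>" "c \<in> elts P \<Omega>" "\<sigma> \<in> elts P G"
      "\<sigma>' \<in> elts P G" "a = b \<oplus>\<^bsub>Obj P \<Omega>\<^esub> Map P \<Omega> G j \<sigma>" "b = c \<oplus>\<^bsub>Obj P \<Omega>\<^esub> Map P \<Omega> G j \<sigma>'"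
      unfolding rel_def by blast
    have "a = c \<oplus>\<^bsub>Obj P \<Omega>\<^esub> Map P \<Omega> G j (\<sigma>' \<oplus>\<^bsub>Obj P G\<^esub> \<sigma>)"
      using *(3,4,5) linear_map_add[OF Mj] by (simp add: *(6,7) N.a_assoc)
    then show ?thesis unfolding rel_def using * G.a_closed by blast
  qed
  have rel_add: "rel (a \<oplus>\<^bsub>Obj P \<Omega>\<^esub> a') (b \<oplus>\<^bsub>Obj P \<Omega>\<^esub> b')" if "rel a b" "rel a' b'" for a b a' b'
  proof -
    from that obtain \<sigma> \<sigma>' where *: "a \<in> elts P \<Omega>" "b \<in> elts P \<Omega>" "a' \<in> elts P \<Omega>" "b' \<in> elts P \<Omega>"
      "\<sigma> \<in> elts P G" "\<sigma>' \<in> elts P G"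
      "a = b \<oplus>\<^bsub>Obj P \<Omega>\<^esub> Map P \<Omega> G j \<sigma>" "a' = b' \<oplus>\<^bsub>Obj P \<Omega>\<^esub> Map P \<Omega> G j \<sigma>'"
      unfolding rel_def by blast
    have "a \<oplus>\<^bsub>Obj P \<Omega>\<^esub> a' = (b \<oplus>\<^bsub>Obj P \<Omega>\<^esub> b') \<oplus>\<^bsub>Obj P \<Omega>\<^esub> Map P \<Omega> G j (\<sigma> \<oplus>\<^bsub>Obj P G\<^esub> \<sigma>')"
      using *(2,4,5,6) linear_map_add[OF Mj] by (simp add: *(7,8) N.a_ac)
    then show ?thesis unfolding rel_def using * G.a_closed N.a_closed by blast
  qed
  \<comment> \<open>Changing the lift of an extension along \<open>\<omega>\<close> changes values by elements of \<open>j\<^sup>*(P G)\<close>.\<close>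
  have change: "rel (Map P \<Omega> M a \<mu>) (Map P \<Omega> M a' \<mu>)"
    if a: "a \<in> mor K \<Omega> M" "a' \<in> mor K \<Omega> M" and eq: "push K X \<Omega> M a \<omega> = push K X \<Omega> M a' \<omega>"
      and \<mu>: "\<mu> \<in> elts P M" for M a a' \<mu>
  proof -
    interpret E: module R "EE K X M" by (rule ext_module)
    have "push K X \<Omega> M (a \<ominus>\<^bsub>Hom K \<Omega> M\<^esub> a') \<omega> = \<zero>\<^bsub>EE K X M\<^esub>"
      using linear_map_minus[OF hom_module ext_module push_linear_mor a, of \<omega> X] eq a
      by (simp add: module_minus_eq_zero[OF ext_module])
    then obtain b where b: "b \<in> mor K G M" "a \<ominus>\<^bsub>Hom K \<Omega> M\<^esub> a' = Comp K \<Omega> G M b j"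
      using extend_along_inflation[OF projective_triangleD(1)[OF t]] a by blast
    have "Map P \<Omega> M a \<mu> \<ominus>\<^bsub>Obj P \<Omega>\<^esub> Map P \<Omega> M a' \<mu> = Map P \<Omega> G j (Map P G M b \<mu>)"
      using linear_map_minus[OF hom_module F(1) F(5)[OF \<mu>] a] F(4)[of j \<Omega> G b M \<mu>] b \<mu> by simp
    then have "Map P \<Omega> M a \<mu> = Map P \<Omega> M a' \<mu> \<oplus>\<^bsub>Obj P \<Omega>\<^esub> Map P \<Omega> G j (Map P G M b \<mu>)"
      using module_minus_add_cancel[OF F(1), of "Map P \<Omega> M a \<mu>" \<Omega> "Map P \<Omega> M a' \<mu>"] a \<mu> b
      by (metis N.a_comm Mod_functor_closed(1)[OF P_functor] Mj_in)
    then show ?thesis unfolding rel_def using a b \<mu> by auto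
  qed
  define lift where "lift M \<tau> = (SOME a. a \<in> mor K \<Omega> M \<and> \<tau> = push K X \<Omega> M a \<omega>)" for M \<tau>
  have lift [simp]: "lift M \<tau> \<in> mor K \<Omega> M" and push_lift: "push K X \<Omega> M (lift M \<tau>) \<omega> = \<tau>"
    if "\<tau> \<in> carrier (EE K X M)" for M \<tau>
  proof -
    obtain a where "a \<in> mor K \<Omega> M \<and> \<tau> = push K X \<Omega> M a \<omega>"
      using projective_triangle_push[OF t \<open>\<tau> \<in> _\<close>] by blast
    then have "lift M \<tau> \<in> mor K \<Omega> M \<and> \<tau> = push K X \<Omega> M (lift M \<tau>) \<omega>"
      unfolding lift_def by (rule someI)
    then show "lift M \<tau> \<in> mor K \<Omega> M" "push K X \<Omega> M (lift M \<tau>) \<omega> = \<tau>" by simp_all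
  qed
  define val where "val = (\<lambda>(M, \<mu>, \<tau>). Map P \<Omega> M (lift M \<tau>) \<mu>)"
  have val [simp]: "val (M, \<mu>, \<tau>) = Map P \<Omega> M (lift M \<tau>) \<mu>" for M \<mu> \<tau> by (simp add: val_def)
  have val_in: "val p \<in> elts P \<Omega>" if "u \<in> formal_sums P (ext_cov K X)" "p \<in># u" for p u
    using that by (fastforce simp: formal_sums_def)
  have inv: "u \<in> formal_sums P (ext_cov K X) \<and> v \<in> formal_sums P (ext_cov K X) \<and>
      rel (msum (Obj P \<Omega>) val u) (msum (Obj P \<Omega>) val v)"
    if "coend_eq R K P (ext_cov K X) u v" for u v
    using that
  proof induction
    case (reflexive u)
    then show ?case by (simp add: rel_refl)
  next
    case (symmetric u v)
    then show ?case by (simp add: rel_sym)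
  next
    case (transitive u v w)
    then show ?case using rel_trans by blast
  next
    case (plus u u' v v')
    have "msum (Obj P \<Omega>) val (u + v) = msum (Obj P \<Omega>) val u \<oplus>\<^bsub>Obj P \<Omega>\<^esub> msum (Obj P \<Omega>) val v"
      using plus.IH val_in by (intro N.msum_union) blast
    moreover have "msum (Obj P \<Omega>) val (u' + v') = msum (Obj P \<Omega>) val u' \<oplus>\<^bsub>Obj P \<Omega>\<^esub> msum (Obj P \<Omega>) val v'"
      using plus.IH val_in by (intro N.msum_union) blast
    ultimately show ?case using plus.IH rel_add by simp
  next
    case (zero \<tau> M)
    then show ?case by (simp add: rel_refl)
  next
    case (add_left \<mu> M \<mu>' \<tau>)
    then show ?case using linear_map_add[OF F(2)[OF lift]] by (simp add: rel_refl)
  next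
    case (add_right \<mu> M \<tau> \<tau>')
    then have in': "\<mu> \<in> elts P M" "\<tau> \<in> carrier (EE K X M)" "\<tau>' \<in> carrier (EE K X M)" by simp_all
    interpret E: module R "EE K X M" by (rule ext_module)
    interpret H: module R "Hom K \<Omega> M" by (rule hom_module)
    have "rel (Map P \<Omega> M (lift M (\<tau> \<oplus>\<^bsub>EE K X M\<^esub> \<tau>')) \<mu>)
        (Map P \<Omega> M (lift M \<tau> \<oplus>\<^bsub>Hom K \<Omega> M\<^esub> lift M \<tau>') \<mu>)"
      using in' linear_map_add[OF push_linear_mor[of \<omega> X \<Omega> M]]
      by (intro change) (simp_all add: push_lift)
    then show ?case using in' linear_map_add[OF F(5)[of \<mu> M \<Omega>]] by simp
  next
    case (balanced r \<mu> M \<tau>)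
    then have in': "r \<in> carrier R" "\<mu> \<in> elts P M" "\<tau> \<in> carrier (EE K X M)" by simp_all
    interpret E: module R "EE K X M" by (rule ext_module)
    interpret H: module R "Hom K \<Omega> M" by (rule hom_module)
    have "rel (Map P \<Omega> M (r \<odot>\<^bsub>Hom K \<Omega> M\<^esub> lift M \<tau>) \<mu>) (Map P \<Omega> M (lift M (r \<odot>\<^bsub>EE K X M\<^esub> \<tau>)) \<mu>)"
      using in' linear_map_smult[OF push_linear_mor[of \<omega> X \<Omega> M]]
      by (intro change) (simp_all add: push_lift)
    then show ?case using in' linear_map_smult[OF F(5)[of \<mu> M \<Omega>]] linear_map_smult[OF F(2)[of "lift M \<tau>"]]
      by simp
  next
    case (dinatural c M M' \<mu> \<tau>)
    then have in': "c \<in> mor K M M'" "\<mu> \<in> elts P M'" "\<tau> \<in> carrier (EE K X M)" by simp_all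
    have "rel (Map P \<Omega> M' (Comp K \<Omega> M M' c (lift M \<tau>)) \<mu>) (Map P \<Omega> M' (lift M' (push K X M M' c \<tau>)) \<mu>)"
      using in' by (intro change) (simp_all add: push_lift push_comp)
    then show ?case using in' F(4)[of "lift M \<tau>" \<Omega> M c M' \<mu>] by simp
  qed
  have "coend_eq R K P (ext_cov K X) {#(\<Omega>, \<rho>, \<omega>)#} {#}"
    using zero \<rho> unfolding coend_fun_sel by (intro coend_classD) auto
  then have "rel (Map P \<Omega> \<Omega> (lift \<Omega> \<omega>) \<rho>) \<zero>\<^bsub>Obj P \<Omega>\<^esub>" using inv \<rho> by fastforce
  moreover have "rel (Map P \<Omega> \<Omega> (Ident K \<Omega>) \<rho>) (Map P \<Omega> \<Omega> (lift \<Omega> \<omega>) \<rho>)"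
    using \<rho> by (intro change) (simp_all add: push_lift)
  ultimately have "rel \<rho> \<zero>\<^bsub>Obj P \<Omega>\<^esub>" using rel_trans F(3)[OF \<rho>] by metis
  then show ?thesis by (auto simp: rel_def)
qed

text \<open>The map \<open>\<rho> \<mapsto> \<rho> \<otimes> \<omega>\<close> from \<open>P \<Omega>\<close> is linear and onto, so the coend inherits the module axioms.\<close>

lemma coend_module: "module R (Obj (coend_fun R K P) X)"
proof -
  obtain \<Omega> G j g \<omega> where t: "projective_triangle K \<Omega> G X j g \<omega>" using ex_projective_triangle .
  note [simp] = projective_triangleD[OF t]
  show ?thesis
  proof (rule module_surj_image[where h = "\<lambda>\<rho>. pure R K P X \<Omega> \<rho> \<omega>"])
    show "module R (Obj P \<Omega>)" using P_functor by (rule Mod_functorD)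
    show "(\<lambda>\<rho>. pure R K P X \<Omega> \<rho> \<omega>) ` elts P \<Omega> = elts (coend_fun R K P) X"
      using coend_elements_pure[OF t] by (auto 4 3)
  qed (simp_all add: pure_zero_left pure_add_left pure_smult_left)
qed

text \<open>All coend identities reduce to pure tensors \<open>\<rho> \<otimes> \<omega>\<close> with one fixed \<open>\<omega>\<close>.\<close>

lemma coend_linear_mapI:
  assumes t: "projective_triangle K \<Omega> G X j g \<omega>"
    and *: "linear_map R (Obj P \<Omega>) N (\<lambda>\<rho>. f (pure R K P X \<Omega> \<rho> \<omega>))"
  shows "linear_map R (Obj (coend_fun R K P) X) N f"
proof (rule linear_mapI)
  note [simp] = projective_triangleD[OF t]
  interpret M: module R "Obj P \<Omega>" using P_functor by (rule Mod_functorD)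
  fix u assume "u \<in> elts (coend_fun R K P) X"
  then obtain \<rho> where u: "\<rho> \<in> elts P \<Omega>" "u = pure R K P X \<Omega> \<rho> \<omega>" using coend_elements_pure[OF t] by blast
  show "f u \<in> carrier N" using linear_map_closed[OF * u(1)] u(2) by simp
  show "f (r \<odot>\<^bsub>Obj (coend_fun R K P) X\<^esub> u) = r \<odot>\<^bsub>N\<^esub> f u" if "r \<in> carrier R" for r
    using linear_map_smult[OF * that u(1)] u that by (simp add: pure_smult_left)
  fix v assume "v \<in> elts (coend_fun R K P) X"
  then obtain \<rho>' where v: "\<rho>' \<in> elts P \<Omega>" "v = pure R K P X \<Omega> \<rho>' \<omega>" using coend_elements_pure[OF t] by blast
  show "f (u \<oplus>\<^bsub>Obj (coend_fun R K P) X\<^esub> v) = f u \<oplus>\<^bsub>N\<^esub> f v"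
    using linear_map_add[OF * u(1) v(1)] u v by (simp add: pure_add_left)
qed

lemma pure_linear_left:
  assumes "\<tau> \<in> carrier (EE K X M)"
  shows "linear_map R (Obj P M) (Obj (coend_fun R K P) X) (\<lambda>\<rho>. pure R K P X M \<rho> \<tau>)"
  using assms by (intro linear_mapI) (auto simp: pure_add_left pure_smult_left)

lemma pure_linear_right:
  assumes "\<rho> \<in> elts P M"
  shows "linear_map R (EE K X M) (Obj (coend_fun R K P) X) (\<lambda>\<tau>. pure R K P X M \<rho> \<tau>)"
  using assms by (intro linear_mapI) (auto simp: pure_add_right pure_smult_right)

lemma coend_fun_functor: "Mod_functor R K (coend_fun R K P)"
  unfolding Mod_functor_def
proof (intro conjI allI ballI)
  show "module R (Obj (coend_fun R K P) X)" for X by (rule coend_module)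
next
  fix X Y f assume f: "f \<in> mor K X Y"
  obtain \<Omega> G j g \<omega> where t: "projective_triangle K \<Omega> G Y j g \<omega>" using ex_projective_triangle .
  note [simp] = projective_triangleD[OF t]
  have "linear_map R (Obj P \<Omega>) (Obj (coend_fun R K P) X)
      (\<lambda>\<rho>. Map (coend_fun R K P) X Y f (pure R K P Y \<Omega> \<rho> \<omega>))"
    using pure_linear_left[of "pull K X Y \<Omega> f \<omega>"] f
    by (auto simp: linear_map_def Map_pure pure_add_left[symmetric] pure_smult_left[symmetric]
        Mod_functor_closed[OF P_functor] intro: linear_map_closed)
  then show "linear_map R (Obj (coend_fun R K P) Y) (Obj (coend_fun R K P) X) (Map (coend_fun R K P) X Y f)"
    by (rule coend_linear_mapI[OF t])
next
  fix X u assume u: "u \<in> elts (coend_fun R K P) X"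
  obtain \<Omega> G j g \<omega> where t: "projective_triangle K \<Omega> G X j g \<omega>" using ex_projective_triangle .
  obtain \<rho> where "\<rho> \<in> elts P \<Omega>" "u = pure R K P X \<Omega> \<rho> \<omega>" using coend_elements_pure[OF t u] .
  then show "Map (coend_fun R K P) X X (Ident K X) u = u"
    using projective_triangleD[OF t] by (simp add: Map_pure)
next
  fix X Y Z f h u assume f: "f \<in> mor K X Y" "h \<in> mor K Y Z" and u: "u \<in> elts (coend_fun R K P) Z"
  obtain \<Omega> G j g \<omega> where t: "projective_triangle K \<Omega> G Z j g \<omega>" using ex_projective_triangle .
  obtain \<rho> where "\<rho> \<in> elts P \<Omega>" "u = pure R K P Z \<Omega> \<rho> \<omega>" using coend_elements_pure[OF t u] .
  then show "Map (coend_fun R K P) X Z (Comp K X Y Z h f) u =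
      Map (coend_fun R K P) X Y f (Map (coend_fun R K P) Y Z h u)"
    using projective_triangleD[OF t] f by (simp add: Map_pure pull_comp comp_closed[of f X Y h Z])
next
  fix X Y u assume u: "u \<in> elts (coend_fun R K P) Y"
  obtain \<Omega> G j g \<omega> where t: "projective_triangle K \<Omega> G Y j g \<omega>" using ex_projective_triangle .
  note [simp] = projective_triangleD[OF t]
  obtain \<rho> where \<rho>: "\<rho> \<in> elts P \<Omega>" "u = pure R K P Y \<Omega> \<rho> \<omega>" using coend_elements_pure[OF t u] .
  interpret H: module R "Hom K X Y" by (rule hom_module)
  show "linear_map R (Hom K X Y) (Obj (coend_fun R K P) X) (\<lambda>f. Map (coend_fun R K P) X Y f u)"
    using linear_map_compose[OF pull_linear_mor[of \<omega> Y \<Omega> X] pure_linear_right[OF \<rho>(1)]] \<rho>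
    by (auto simp: linear_map_def Map_pure)
qed

lemma coend_map_morphism:
  assumes P': "Mod_functor R K P'" and \<phi>: "Mod_morphism R K P P' \<phi>"
  shows "Mod_morphism R K (coend_fun R K P) (coend_fun R K P') (coend_map R K P' \<phi>)"
  unfolding Mod_morphism_def
proof (intro conjI allI ballI)
  interpret P': projective_coend_functor R K P' using P' by unfold_locales
  note [simp] = coend_map_pure[OF P' \<phi>] linear_map_closed[OF Mod_morphismD(1)[OF \<phi>]]
  show "linear_map R (Obj (coend_fun R K P) X) (Obj (coend_fun R K P') X) (coend_map R K P' \<phi> X)" for X
  proof -
    obtain \<Omega> G j g \<omega> where t: "projective_triangle K \<Omega> G X j g \<omega>" using ex_projective_triangle .
    note [simp] = projective_triangleD[OF t]
    interpret M: module R "Obj P \<Omega>" using P_functor by (rule Mod_functorD)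
    have "linear_map R (Obj P \<Omega>) (Obj (coend_fun R K P') X) (\<lambda>\<rho>. coend_map R K P' \<phi> X (pure R K P X \<Omega> \<rho> \<omega>))"
      using linear_map_compose[OF Mod_morphismD(1)[OF \<phi>, of \<Omega>] P'.pure_linear_left[of \<omega> X \<Omega>]]
      by (auto simp: linear_map_def)
    then show ?thesis by (rule coend_linear_mapI[OF t])
  qed
  fix X Y f u assume f: "f \<in> mor K X Y" and u: "u \<in> elts (coend_fun R K P) Y"
  obtain \<Omega> G j g \<omega> where t: "projective_triangle K \<Omega> G Y j g \<omega>" using ex_projective_triangle .
  note [simp] = projective_triangleD[OF t]
  obtain \<rho> where \<rho>: "\<rho> \<in> elts P \<Omega>" "u = pure R K P Y \<Omega> \<rho> \<omega>" using coend_elements_pure[OF t u] .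
  then show "coend_map R K P' \<phi> X (Map (coend_fun R K P) X Y f u) =
      Map (coend_fun R K P') X Y f (coend_map R K P' \<phi> Y u)"
    using f by (simp add: Map_pure P'.Map_pure)
qed

end


section \<open>The functors of positive extensions\<close>

definition hom_fun :: "('r, 'o, 'm, 'e) ecat \<Rightarrow> 'o \<Rightarrow> ('r, 'o, 'm, 'm) mfun" where
  "hom_fun K Y = \<lparr> Obj = (\<lambda>X. Hom K X Y), Map = (\<lambda>X' X c f. Comp K X' X Y f c) \<rparr>"

definition ext_fun :: "('r, 'o, 'm, 'e) ecat \<Rightarrow> 'o \<Rightarrow> ('r, 'o, 'm, 'e) mfun" where
  "ext_fun K Y = \<lparr> Obj = (\<lambda>X. EE K X Y), Map = (\<lambda>X' X c \<delta>. pull K X' X Y c \<delta>) \<rparr>"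

lemma fun_sel [simp]:
  "Obj (hom_fun K Y) X = Hom K X Y" "Map (hom_fun K Y) X' X c = (\<lambda>f. Comp K X' X Y f c)"
  "Obj (ext_fun K Y) X = EE K X Y" "Map (ext_fun K Y) X' X c = pull K X' X Y c"
  by (simp_all add: hom_fun_def ext_fun_def)

lemma pos_ext_transport:
  "pos_ext R K 0 Y = transport Mor un_Mor (hom_fun K Y)"
  "pos_ext R K (Suc 0) Y = transport Ex un_Ex (ext_fun K Y)"
  by (simp_all add: transport_def hom_fun_def ext_fun_def)

lemma pos_ext_0_sel:
  "elts (pos_ext R K 0 Y) X = Mor ` mor K X Y"
  "\<zero>\<^bsub>Obj (pos_ext R K 0 Y) X\<^esub> = Mor \<zero>\<^bsub>Hom K X Y\<^esub>"
  "f \<in> mor K X Y \<Longrightarrow> g \<in> mor K X Y \<Longrightarrow>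
     Mor f \<oplus>\<^bsub>Obj (pos_ext R K 0 Y) X\<^esub> Mor g = Mor (f \<oplus>\<^bsub>Hom K X Y\<^esub> g)"
  "f \<in> mor K X Y \<Longrightarrow> r \<odot>\<^bsub>Obj (pos_ext R K 0 Y) X\<^esub> Mor f = Mor (r \<odot>\<^bsub>Hom K X Y\<^esub> f)"
  "Map (pos_ext R K 0 Y) X' X c (Mor f) = Mor (Comp K X' X Y f c)"
  by (simp_all add: image_module_sel[where h = un_Mor])

lemma pos_ext_1_sel:
  "elts (pos_ext R K (Suc 0) Y) X = Ex ` carrier (EE K X Y)"
  "\<zero>\<^bsub>Obj (pos_ext R K (Suc 0) Y) X\<^esub> = Ex \<zero>\<^bsub>EE K X Y\<^esub>"
  "\<delta> \<in> carrier (EE K X Y) \<Longrightarrow> \<epsilon> \<in> carrier (EE K X Y) \<Longrightarrow>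
     Ex \<delta> \<oplus>\<^bsub>Obj (pos_ext R K (Suc 0) Y) X\<^esub> Ex \<epsilon> = Ex (\<delta> \<oplus>\<^bsub>EE K X Y\<^esub> \<epsilon>)"
  "\<delta> \<in> carrier (EE K X Y) \<Longrightarrow> r \<odot>\<^bsub>Obj (pos_ext R K (Suc 0) Y) X\<^esub> Ex \<delta> = Ex (r \<odot>\<^bsub>EE K X Y\<^esub> \<delta>)"
  "Map (pos_ext R K (Suc 0) Y) X' X c (Ex \<delta>) = Ex (pull K X' X Y c \<delta>)"
  by (simp_all add: image_module_sel[where h = un_Ex])

lemma pos_ext_Suc_Suc: "pos_ext R K (Suc (Suc n)) Y = coend_fun R K (pos_ext R K (Suc n) Y)"
  by simp

lemma pos_push_Suc_Suc:
  "(\<lambda>X. pos_push R K (Suc (Suc n)) X Y Y' a) =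
     coend_map R K (pos_ext R K (Suc n) Y') (\<lambda>M. pos_push R K (Suc n) M Y Y' a)"
  by (auto simp: coend_map_def fun_eq_iff)

lemma lower_sharp_simps:
  "lower_sharp R K 0 C A \<delta> X = (\<lambda>\<mu>. Ex (pull K X C A (un_Mor \<mu>) \<delta>))"
  "lower_sharp R K (Suc 0) C A \<delta> X = (\<lambda>\<mu>. pure R K (pos_ext R K (Suc 0) A) X C (Ex \<delta>) (un_Ex \<mu>))"
  by (simp_all add: lower_sharp_def fun_eq_iff)

lemma lower_sharp_Suc_Suc:
  "lower_sharp R K (Suc (Suc n)) C A \<delta> =
     coend_map R K (pos_ext R K (Suc (Suc n)) A) (lower_sharp R K (Suc n) C A \<delta>)"
  by (auto simp: coend_map_def lower_sharp_def fun_eq_iff)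

lemma upper_sharp_simps:
  "upper_sharp R K 0 C A \<delta> Y = (\<lambda>\<mu>. Ex (push K C A Y (un_Mor \<mu>) \<delta>))"
  "upper_sharp R K (Suc n) C A \<delta> Y = (\<lambda>\<mu>. pure R K (pos_ext R K (Suc n) Y) C A \<mu> \<delta>)"
  by (simp_all add: upper_sharp_def fun_eq_iff)

declare pos_ext.simps [simp del] pos_push.simps(3) [simp del]
  pos_ext_0_sel [simp] pos_ext_1_sel [simp]

context linear_category
begin

lemma hom_fun_functor: "Mod_functor R K (hom_fun K Y)"
  by (auto simp: Mod_functor_def hom_module comp_assoc comp_linear_left comp_linear_right)

lemma hom_fun_morphism:
  "a \<in> mor K Y Y' \<Longrightarrow> Mod_morphism R K (hom_fun K Y) (hom_fun K Y') (\<lambda>X f. Comp K X Y Y' a f)"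
  by (auto simp: Mod_morphism_def comp_linear_right comp_assoc)

end

context bilinear_ext
begin

lemma ext_fun_functor: "Mod_functor R K (ext_fun K Y)"
  by (auto simp: Mod_functor_def ext_module pull_linear pull_linear_mor pull_comp)

lemma ext_fun_morphism:
  "a \<in> mor K Y Y' \<Longrightarrow> Mod_morphism R K (ext_fun K Y) (ext_fun K Y') (\<lambda>X. push K X Y Y' a)"
  by (auto simp: Mod_morphism_def push_linear push_pull)

lemma pull_morphism:
  "\<delta> \<in> carrier (EE K C A) \<Longrightarrow> Mod_morphism R K (hom_fun K C) (ext_fun K A) (\<lambda>X f. pull K X C A f \<delta>)"
  by (auto simp: Mod_morphism_def pull_linear_mor pull_comp)

end

context enough_projectives
begin

lemma coend_functorI: "Mod_functor R K P \<Longrightarrow> projective_coend_functor R K P"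
  by unfold_locales

lemma pos_ext_functor: "Mod_functor R K (pos_ext R K n Y)"
proof (induction n)
  case 0
  show ?case unfolding pos_ext_transport by (intro transport_functor hom_fun_functor) simp
next
  case (Suc n)
  show ?case
  proof (cases n)
    case 0
    show ?thesis unfolding 0 pos_ext_transport by (intro transport_functor ext_fun_functor) simp
  next
    case Suc
    then show ?thesis
      using Suc.IH unfolding pos_ext_Suc_Suc Suc
      by (intro projective_coend_functor.coend_fun_functor coend_functorI)
  qed
qed

lemmas pos_ext_module = Mod_functorD(1)[OF pos_ext_functor]

lemma pos_ext_coend_functor: "projective_coend_functor R K (pos_ext R K n Y)"
  by (intro coend_functorI pos_ext_functor)

lemma pos_push_morphism:
  assumes a: "a \<in> mor K Y Y'"
  shows "Mod_morphism R K (pos_ext R K n Y) (pos_ext R K n Y') (\<lambda>X. pos_push R K n X Y Y' a)"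
proof (induction n)
  case 0
  show ?case
    using transport_morphism[where g = Mor and h = un_Mor and g' = Mor and h' = un_Mor, OF _ _ hom_fun_morphism[OF a]]
    unfolding pos_ext_transport by (simp add: pos_push.simps(1)[abs_def])
next
  case (Suc n)
  show ?case
  proof (cases n)
    case 0
    then show ?thesis
      using transport_morphism[where g = Ex and h = un_Ex and g' = Ex and h' = un_Ex, OF _ _ ext_fun_morphism[OF a]]
      unfolding 0 pos_ext_transport by (simp add: pos_push.simps(2)[abs_def])
  next
    case (Suc k)
    then show ?thesis
      using projective_coend_functor.coend_map_morphism[OF pos_ext_coend_functor pos_ext_functor Suc.IH]
      unfolding pos_ext_Suc_Suc Suc pos_push_Suc_Suc by simp
  qed
qed

lemma lower_sharp_morphism:
  assumes \<delta>: "\<delta> \<in> carrier (EE K C A)"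
  shows "Mod_morphism R K (pos_ext R K n C) (pos_ext R K (Suc n) A) (lower_sharp R K n C A \<delta>)"
proof (induction n)
  case 0
  show ?case
    using transport_morphism[where g = Mor and h = un_Mor and g' = Ex and h' = un_Ex, OF _ _ pull_morphism[OF \<delta>]]
    unfolding pos_ext_transport lower_sharp_simps by simp
next
  case (Suc n)
  show ?case
  proof (cases n)
    case 0
    interpret P: projective_coend_functor R K "pos_ext R K (Suc 0) A" by (rule pos_ext_coend_functor)
    have in': "Ex \<delta> \<in> elts (pos_ext R K (Suc 0) A) C" using \<delta> unfolding pos_ext_1_sel by simp
    have "Mod_morphism R K (ext_fun K C) (coend_fun R K (pos_ext R K (Suc 0) A))
        (\<lambda>X. pure R K (pos_ext R K (Suc 0) A) X C (Ex \<delta>))"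
      using P.pure_linear_right[OF in'] P.Map_pure[OF _ in'] by (auto simp: Mod_morphism_def)
    then show ?thesis
      using Mod_morphism_from_transport[where g = Ex and h = un_Ex]
      unfolding 0 pos_ext_Suc_Suc pos_ext_transport(2)[of _ _ C] lower_sharp_simps by simp
  next
    case (Suc k)
    then show ?thesis
      using projective_coend_functor.coend_map_morphism[OF pos_ext_coend_functor pos_ext_functor Suc.IH]
      unfolding pos_ext_Suc_Suc Suc lower_sharp_Suc_Suc by simp
  qed
qed

lemmas pos_push_closed [simp, intro] = linear_map_closed[OF Mod_morphismD(1)[OF pos_push_morphism]]
lemmas lower_sharp_closed [simp, intro] = linear_map_closed[OF Mod_morphismD(1)[OF lower_sharp_morphism]]
lemmas pos_Map_closed [simp, intro] = linear_map_closed[OF Mod_functorD(2)[OF pos_ext_functor]]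


section \<open>Multiplication by an extension on the right\<close>

text \<open>
  \<open>upper_sharp R K n X M \<tau> Y \<rho>\<close> is \<open>\<rho> \<union> \<tau>\<close>. In degree one it is \<open>\<rho>\<^sub>*\<tau>\<close> and from degree two on it is a
  pure tensor of a coend; the rules below treat both at once.
\<close>

context
  fixes n :: nat
begin

lemma upper_sharp_linear:
  assumes \<tau>: "\<tau> \<in> carrier (EE K X M)"
  shows "linear_map R (Obj (pos_ext R K n Y) M) (Obj (pos_ext R K (Suc n) Y) X) (upper_sharp R K n X M \<tau> Y)"
proof (cases n)
  case 0
  then show ?thesis
    using linear_map_image_module[where g = Mor and h = un_Mor and g' = Ex and h' = un_Ex, OF _ _ push_linear_mor[OF \<tau>]]
    by (simp add: upper_sharp_simps pos_ext_transport transport_sel)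
next
  case (Suc k)
  then show ?thesis
    using projective_coend_functor.pure_linear_left[OF pos_ext_coend_functor \<tau>]
    unfolding Suc upper_sharp_simps pos_ext_Suc_Suc by simp
qed

lemmas upper_sharp_closed [simp, intro] = linear_map_closed[OF upper_sharp_linear]

lemma upper_sharp_push_ext:
  assumes "c \<in> mor K M N" "\<rho> \<in> elts (pos_ext R K n Y) N" "\<tau> \<in> carrier (EE K X M)"
  shows "upper_sharp R K n X N (push K X M N c \<tau>) Y \<rho> =
    upper_sharp R K n X M \<tau> Y (Map (pos_ext R K n Y) M N c \<rho>)"
proof (cases n)
  case 0
  then show ?thesis using assms unfolding 0 pos_ext_0_sel upper_sharp_simps by (auto simp: push_comp)
next
  case (Suc k)
  then show ?thesis
    using assms projective_coend_functor.axioms(1)[OF pos_ext_coend_functor[of n Y]]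
    unfolding Suc upper_sharp_simps by (intro coend_functor.pure_dinatural[symmetric])
qed

lemma Map_upper_sharp:
  assumes "f \<in> mor K X' X" "\<rho> \<in> elts (pos_ext R K n Y) M" "\<tau> \<in> carrier (EE K X M)"
  shows "Map (pos_ext R K (Suc n) Y) X' X f (upper_sharp R K n X M \<tau> Y \<rho>) =
    upper_sharp R K n X' M (pull K X' X M f \<tau>) Y \<rho>"
proof (cases n)
  case 0
  then show ?thesis using assms unfolding 0 pos_ext_0_sel upper_sharp_simps
    by (auto simp: push_pull pos_ext_1_sel)
next
  case (Suc k)
  then show ?thesis
    using assms projective_coend_functor.axioms(1)[OF pos_ext_coend_functor[of n Y]]
    unfolding Suc upper_sharp_simps pos_ext_Suc_Suc by (intro coend_functor.Map_pure)
qed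

lemma pos_push_upper_sharp:
  assumes "a \<in> mor K Y Y'" "\<rho> \<in> elts (pos_ext R K n Y) M" "\<tau> \<in> carrier (EE K X M)"
  shows "pos_push R K (Suc n) X Y Y' a (upper_sharp R K n X M \<tau> Y \<rho>) =
    upper_sharp R K n X M \<tau> Y' (pos_push R K n M Y Y' a \<rho>)"
proof (cases n)
  case 0
  then show ?thesis using assms unfolding 0 pos_ext_0_sel upper_sharp_simps
    by (auto simp: push_comp)
next
  case (Suc k)
  then show ?thesis
    using assms coend_functor.coend_map_pure[OF
        projective_coend_functor.axioms(1)[OF pos_ext_coend_functor] pos_ext_functor pos_push_morphism]
    unfolding Suc upper_sharp_simps fun_cong[OF pos_push_Suc_Suc] by blast
qed

lemma lower_sharp_upper_sharp:
  assumes "\<delta> \<in> carrier (EE K C A)" "\<rho> \<in> elts (pos_ext R K n C) M" "\<tau> \<in> carrier (EE K X M)"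
  shows "lower_sharp R K (Suc n) C A \<delta> X (upper_sharp R K n X M \<tau> C \<rho>) =
    upper_sharp R K (Suc n) X M \<tau> A (lower_sharp R K n C A \<delta> M \<rho>)"
proof (cases n)
  case 0
  then obtain f where f: "f \<in> mor K M C" "\<rho> = Mor f"
    using assms(2) unfolding 0 pos_ext_0_sel by blast
  interpret P: coend_functor R K "pos_ext R K (Suc 0) A"
    using projective_coend_functor.axioms(1)[OF pos_ext_coend_functor] .
  have "Ex \<delta> \<in> elts (pos_ext R K (Suc 0) A) C" using assms unfolding pos_ext_1_sel by simp
  from P.pure_dinatural[OF f(1) this assms(3)] show ?thesis
    unfolding 0 upper_sharp_simps lower_sharp_simps pos_ext_1_sel f by simp
next
  case (Suc k)
  then show ?thesis
    using assms coend_functor.coend_map_pure[OF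
        projective_coend_functor.axioms(1)[OF pos_ext_coend_functor] pos_ext_functor lower_sharp_morphism]
    unfolding Suc upper_sharp_simps lower_sharp_Suc_Suc by blast
qed

lemma upper_sharp_zero_ext:
  assumes "\<rho> \<in> elts (pos_ext R K n Y) M"
  shows "upper_sharp R K n X M \<zero>\<^bsub>EE K X M\<^esub> Y \<rho> = \<zero>\<^bsub>Obj (pos_ext R K (Suc n) Y) X\<^esub>"
proof (cases n)
  case 0
  then show ?thesis using assms unfolding 0 pos_ext_0_sel pos_ext_1_sel upper_sharp_simps by auto
next
  case (Suc k)
  then show ?thesis
    using assms projective_coend_functor.axioms(1)[OF pos_ext_coend_functor[of n Y]]
    unfolding Suc upper_sharp_simps pos_ext_Suc_Suc by (intro coend_functor.pure_zero_right)
qed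

lemma upper_sharp_onto:
  assumes t: "projective_triangle K \<Omega> G X j g \<omega>" and \<xi>: "\<xi> \<in> elts (pos_ext R K (Suc n) Y) X"
  obtains \<rho> where "\<rho> \<in> elts (pos_ext R K n Y) \<Omega>" "\<xi> = upper_sharp R K n X \<Omega> \<omega> Y \<rho>"
proof (cases n)
  case 0
  then obtain \<tau> where \<tau>: "\<tau> \<in> carrier (EE K X Y)" "\<xi> = Ex \<tau>" using \<xi> unfolding 0 pos_ext_1_sel by blast
  obtain a where "a \<in> mor K \<Omega> Y" "\<tau> = push K X \<Omega> Y a \<omega>" using projective_triangle_push[OF t \<tau>(1)] .
  then show thesis using \<tau> that[of "Mor a"] unfolding 0 pos_ext_0_sel upper_sharp_simps by simp
next
  case (Suc k)
  then show thesis
    using projective_coend_functor.coend_elements_pure[OF pos_ext_coend_functor t] \<xi> that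
    unfolding Suc upper_sharp_simps pos_ext_Suc_Suc by blast
qed

lemma upper_sharp_kernel:
  assumes t: "projective_triangle K \<Omega> G X j g \<omega>" and \<rho>: "\<rho> \<in> elts (pos_ext R K n Y) \<Omega>"
    and zero: "upper_sharp R K n X \<Omega> \<omega> Y \<rho> = \<zero>\<^bsub>Obj (pos_ext R K (Suc n) Y) X\<^esub>"
  obtains \<sigma> where "\<sigma> \<in> elts (pos_ext R K n Y) G" "\<rho> = Map (pos_ext R K n Y) \<Omega> G j \<sigma>"
proof (cases n)
  case 0
  then obtain f where f: "f \<in> mor K \<Omega> Y" "\<rho> = Mor f" using \<rho> unfolding 0 pos_ext_0_sel by blast
  then have "push K X \<Omega> Y f \<omega> = \<zero>\<^bsub>EE K X Y\<^esub>"
    using zero unfolding 0 upper_sharp_simps pos_ext_1_sel by simp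
  then obtain b where "b \<in> mor K G Y" "f = Comp K \<Omega> G Y b j"
    using extend_along_inflation[OF projective_triangleD(1)[OF t] f(1)] by blast
  then show thesis using f that[of "Mor b"] unfolding 0 pos_ext_0_sel by simp
next
  case (Suc k)
  then show thesis
    using projective_coend_functor.pure_eq_zero_imp[OF pos_ext_coend_functor t] \<rho> zero that
    unfolding Suc upper_sharp_simps pos_ext_Suc_Suc by blast
qed

end

lemma upper_sharp_zero:
  "\<tau> \<in> carrier (EE K X M) \<Longrightarrow>
   upper_sharp R K n X M \<tau> Y \<zero>\<^bsub>Obj (pos_ext R K n Y) M\<^esub> = \<zero>\<^bsub>Obj (pos_ext R K (Suc n) Y) X\<^esub>"
  using linear_map_zero[OF pos_ext_module pos_ext_module upper_sharp_linear] .

text \<open>Every positive extension of \<open>X\<close> is \<open>\<rho> \<union> \<tau>\<close> with \<open>\<tau> \<in> \<bbbE>(X, \<Omega>)\<close>, and \<open>g\<^sup>*\<tau> = 0\<close>.\<close>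

lemma projective_Map_zero:
  assumes g: "projective_morphism K G X g" and \<xi>: "\<xi> \<in> elts (pos_ext R K (Suc n) Y) X"
  shows "Map (pos_ext R K (Suc n) Y) G X g \<xi> = \<zero>\<^bsub>Obj (pos_ext R K (Suc n) Y) G\<^esub>"
proof -
  obtain \<Omega> G' j g' \<omega> where t: "projective_triangle K \<Omega> G' X j g' \<omega>" using ex_projective_triangle .
  obtain \<rho> where "\<rho> \<in> elts (pos_ext R K n Y) \<Omega>" "\<xi> = upper_sharp R K n X \<Omega> \<omega> Y \<rho>"
    using upper_sharp_onto[OF t \<xi>] .
  then show ?thesis
    using projective_triangleD[OF t] projective_morphismD[OF g]
    by (simp add: Map_upper_sharp upper_sharp_zero_ext)
qed

end


section \<open>Exactness in non-negative degrees\<close>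

context enough_projectives
begin

text \<open>
  The step of all three inductions on the degree. If \<open>\<Phi>'\<close> kills \<open>\<xi> = \<rho> \<union> \<omega>\<close>, then \<open>\<Phi> \<rho>\<close> need not vanish:
  it only comes from some \<open>\<sigma>\<close> on the middle term \<open>G\<close>. After refining the projective triangle this \<open>\<sigma>\<close>
  appears pulled back along the projective morphism \<open>p\<close>, which makes it zero in positive degrees.
\<close>

lemma lift_vanishing:
  assumes \<Phi>: "Mod_morphism R K (pos_ext R K n Y) (pos_ext R K m Y') \<Phi>"
    and \<Phi>': "\<And>M \<tau> \<rho>. \<tau> \<in> carrier (EE K X M) \<Longrightarrow> \<rho> \<in> elts (pos_ext R K n Y) M \<Longrightarrow>
      \<Phi>' (upper_sharp R K n X M \<tau> Y \<rho>) = upper_sharp R K m X M \<tau> Y' (\<Phi> M \<rho>)"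
    and \<xi>: "\<xi> \<in> elts (pos_ext R K (Suc n) Y) X"
    and zero: "\<Phi>' \<xi> = \<zero>\<^bsub>Obj (pos_ext R K (Suc m) Y') X\<^esub>"
  obtains \<Omega> G j g \<omega> \<rho> G' p \<sigma> where "projective_triangle K \<Omega> G X j g \<omega>"
    "\<rho> \<in> elts (pos_ext R K n Y) \<Omega>" "\<xi> = upper_sharp R K n X \<Omega> \<omega> Y \<rho>"
    "projective_morphism K G G' p" "\<sigma> \<in> elts (pos_ext R K m Y') G'"
    "\<Phi> \<Omega> \<rho> = Map (pos_ext R K m Y') \<Omega> G j (Map (pos_ext R K m Y') G G' p \<sigma>)"
proof -
  note F = Mod_functorD[OF pos_ext_functor]
  obtain \<Omega> G j g \<omega> where t: "projective_triangle K \<Omega> G X j g \<omega>" using ex_projective_triangle .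
  obtain \<rho> where \<rho>: "\<rho> \<in> elts (pos_ext R K n Y) \<Omega>" "\<xi> = upper_sharp R K n X \<Omega> \<omega> Y \<rho>"
    using upper_sharp_onto[OF t \<xi>] .
  note [simp] = projective_triangleD[OF t]
  have "upper_sharp R K m X \<Omega> \<omega> Y' (\<Phi> \<Omega> \<rho>) = \<zero>\<^bsub>Obj (pos_ext R K (Suc m) Y') X\<^esub>"
    using \<Phi>'[of \<omega> \<Omega> \<rho>] zero \<rho> by simp
  then obtain \<sigma> where \<sigma>: "\<sigma> \<in> elts (pos_ext R K m Y') G" "\<Phi> \<Omega> \<rho> = Map (pos_ext R K m Y') \<Omega> G j \<sigma>"
    using upper_sharp_kernel[OF t] linear_map_closed[OF Mod_morphismD(1)[OF \<Phi>] \<rho>(1)] by blast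
  obtain \<Omega>' G' j' g' \<omega>' k p where t': "projective_triangle K \<Omega>' G' X j' g' \<omega>'"
    and p: "projective_morphism K G' G p" and k: "k \<in> mor K \<Omega>' \<Omega>" "push K X \<Omega>' \<Omega> k \<omega>' = \<omega>"
      "Comp K \<Omega>' \<Omega> G j k = Comp K \<Omega>' G' G p j'"
    using refine_projective_triangle[OF t] .
  note [simp] = projective_triangleD[OF t'] projective_morphismD(1)[OF p]
  show thesis
  proof (rule that[OF t' _ _ p \<sigma>(1)])
    show "Map (pos_ext R K n Y) \<Omega>' \<Omega> k \<rho> \<in> elts (pos_ext R K n Y) \<Omega>'" using k \<rho> by simp
    show "\<xi> = upper_sharp R K n X \<Omega>' \<omega>' Y (Map (pos_ext R K n Y) \<Omega>' \<Omega> k \<rho>)"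
      using upper_sharp_push_ext[of k \<Omega>' \<Omega> \<rho> n Y \<omega>' X] k \<rho> by simp
    show "\<Phi> \<Omega>' (Map (pos_ext R K n Y) \<Omega>' \<Omega> k \<rho>) =
        Map (pos_ext R K m Y') \<Omega>' G' j' (Map (pos_ext R K m Y') G' G p \<sigma>)"
      using Mod_morphismD(2)[OF \<Phi> k(1) \<rho>(1)] \<sigma> F(4)[of k \<Omega>' \<Omega> j G \<sigma> m Y'] F(4)[of j' \<Omega>' G' p G \<sigma> m Y'] k
      by simp
  qed
qed

context
  fixes A B C x y \<delta>
  assumes tri: "s_triangle K A B C x y \<delta>"
begin

lemmas tri_mor [simp] = s_triangleD[OF tri]

lemma pos_push_push_zero:
  "\<alpha> \<in> elts (pos_ext R K n A) X \<Longrightarrow>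
   pos_push R K n X B C y (pos_push R K n X A B x \<alpha>) = \<zero>\<^bsub>Obj (pos_ext R K n C) X\<^esub>"
proof (induction n arbitrary: X \<alpha>)
  case 0
  then obtain f where "f \<in> mor K X A" "\<alpha> = Mor f" unfolding pos_ext_0_sel by blast
  then show ?case
    using comp_assoc[of f X A x B y C] triangle_comp_zero[OF tri] unfolding pos_ext_0_sel by simp
next
  case (Suc n)
  obtain \<Omega> G j g \<omega> where t: "projective_triangle K \<Omega> G X j g \<omega>" using ex_projective_triangle .
  obtain \<rho> where "\<rho> \<in> elts (pos_ext R K n A) \<Omega>" "\<alpha> = upper_sharp R K n X \<Omega> \<omega> A \<rho>"
    using upper_sharp_onto[OF t Suc.prems] .
  then show ?case
    using projective_triangleD[OF t] by (simp add: pos_push_upper_sharp Suc.IH upper_sharp_zero)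
qed

lemma lower_sharp_push_zero:
  "\<beta> \<in> elts (pos_ext R K n B) X \<Longrightarrow>
   lower_sharp R K n C A \<delta> X (pos_push R K n X B C y \<beta>) = \<zero>\<^bsub>Obj (pos_ext R K (Suc n) A) X\<^esub>"
proof (induction n arbitrary: X \<beta>)
  case 0
  then obtain f where "f \<in> mor K X B" "\<beta> = Mor f" unfolding pos_ext_0_sel by blast
  then show ?case
    using pull_comp[of y B C f X \<delta> A] triangle_pull_zero[OF tri]
    unfolding pos_ext_1_sel lower_sharp_simps by simp
next
  case (Suc n)
  obtain \<Omega> G j g \<omega> where t: "projective_triangle K \<Omega> G X j g \<omega>" using ex_projective_triangle .
  obtain \<rho> where "\<rho> \<in> elts (pos_ext R K n B) \<Omega>" "\<beta> = upper_sharp R K n X \<Omega> \<omega> B \<rho>"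
    using upper_sharp_onto[OF t Suc.prems] .
  then show ?case
    using projective_triangleD[OF t]
    by (simp add: pos_push_upper_sharp lower_sharp_upper_sharp Suc.IH upper_sharp_zero)
qed

lemma push_lower_sharp_zero:
  "\<gamma> \<in> elts (pos_ext R K n C) X \<Longrightarrow>
   pos_push R K (Suc n) X A B x (lower_sharp R K n C A \<delta> X \<gamma>) = \<zero>\<^bsub>Obj (pos_ext R K (Suc n) B) X\<^esub>"
proof (induction n arbitrary: X \<gamma>)
  case 0
  then obtain f where "f \<in> mor K X C" "\<gamma> = Mor f" unfolding pos_ext_0_sel by blast
  then show ?case
    using push_pull[of f X C x A B \<delta>] triangle_push_zero[OF tri]
    unfolding pos_ext_1_sel lower_sharp_simps by simp
next
  case (Suc n)
  obtain \<Omega> G j g \<omega> where t: "projective_triangle K \<Omega> G X j g \<omega>" using ex_projective_triangle .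
  obtain \<rho> where "\<rho> \<in> elts (pos_ext R K n C) \<Omega>" "\<gamma> = upper_sharp R K n X \<Omega> \<omega> C \<rho>"
    using upper_sharp_onto[OF t Suc.prems] .
  then show ?case
    using projective_triangleD[OF t]
    by (simp add: pos_push_upper_sharp lower_sharp_upper_sharp Suc.IH upper_sharp_zero)
qed

lemma pos_exact_third:
  "\<gamma> \<in> elts (pos_ext R K n C) X \<Longrightarrow>
   lower_sharp R K n C A \<delta> X \<gamma> = \<zero>\<^bsub>Obj (pos_ext R K (Suc n) A) X\<^esub> \<Longrightarrow>
   \<exists>\<beta>\<in>elts (pos_ext R K n B) X. \<gamma> = pos_push R K n X B C y \<beta>"
proof (induction n arbitrary: X \<gamma>)
  case 0
  then obtain f where f: "f \<in> mor K X C" "\<gamma> = Mor f" unfolding pos_ext_0_sel by blast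
  then have "pull K X C A f \<delta> = \<zero>\<^bsub>EE K X A\<^esub>"
    using 0 unfolding pos_ext_1_sel lower_sharp_simps by simp
  then show ?case using lift_along_deflation[OF tri f(1)] f(2) unfolding pos_ext_0_sel by auto
next
  case (Suc n)
  obtain \<Omega> G j g \<omega> \<rho> G' p \<sigma> where t: "projective_triangle K \<Omega> G X j g \<omega>"
    and \<rho>: "\<rho> \<in> elts (pos_ext R K n C) \<Omega>" "\<gamma> = upper_sharp R K n X \<Omega> \<omega> C \<rho>"
    and p: "projective_morphism K G G' p" and \<sigma>: "\<sigma> \<in> elts (pos_ext R K (Suc n) A) G'"
      "lower_sharp R K n C A \<delta> \<Omega> \<rho> =
        Map (pos_ext R K (Suc n) A) \<Omega> G j (Map (pos_ext R K (Suc n) A) G G' p \<sigma>)"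
    by (rule lift_vanishing[where \<Phi>' = "lower_sharp R K (Suc n) C A \<delta> X",
          OF lower_sharp_morphism[OF tri_mor(3)] _ Suc.prems])
      (simp_all add: lower_sharp_upper_sharp)
  note [simp] = projective_triangleD[OF t]
  have "lower_sharp R K n C A \<delta> \<Omega> \<rho> = \<zero>\<^bsub>Obj (pos_ext R K (Suc n) A) \<Omega>\<^esub>"
    using \<sigma> projective_Map_zero[OF p \<sigma>(1)] Mod_functor_closed(5)[OF pos_ext_functor, of j \<Omega> G "Suc n" A]
    by simp
  then obtain \<beta> where "\<beta> \<in> elts (pos_ext R K n B) \<Omega>" "\<rho> = pos_push R K n \<Omega> B C y \<beta>"
    using Suc.IH[OF \<rho>(1)] by blast
  then show ?case
    using \<rho>(2) by (intro bexI[of _ "upper_sharp R K n X \<Omega> \<omega> B \<beta>"])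
      (simp_all add: pos_push_upper_sharp)
qed

lemma pos_exact_first:
  "\<alpha> \<in> elts (pos_ext R K (Suc n) A) X \<Longrightarrow>
   pos_push R K (Suc n) X A B x \<alpha> = \<zero>\<^bsub>Obj (pos_ext R K (Suc n) B) X\<^esub> \<Longrightarrow>
   \<exists>\<gamma>\<in>elts (pos_ext R K n C) X. \<alpha> = lower_sharp R K n C A \<delta> X \<gamma>"
proof (induction n arbitrary: X \<alpha>)
  case 0
  then obtain \<theta> where \<theta>: "\<theta> \<in> carrier (EE K X A)" "\<alpha> = Ex \<theta>" unfolding pos_ext_1_sel by blast
  then have "push K X A B x \<theta> = \<zero>\<^bsub>EE K X B\<^esub>"
    using 0 unfolding pos_ext_1_sel by simp
  then show ?case
    using push_zero_imp_pull[OF tri \<theta>(1)] \<theta>(2) unfolding pos_ext_0_sel lower_sharp_simps by auto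
next
  case (Suc n)
  obtain \<Omega> G j g \<omega> \<rho> G' p \<sigma> where t: "projective_triangle K \<Omega> G X j g \<omega>"
    and \<rho>: "\<rho> \<in> elts (pos_ext R K (Suc n) A) \<Omega>" "\<alpha> = upper_sharp R K (Suc n) X \<Omega> \<omega> A \<rho>"
    and p: "projective_morphism K G G' p" and \<sigma>: "\<sigma> \<in> elts (pos_ext R K (Suc n) B) G'"
      "pos_push R K (Suc n) \<Omega> A B x \<rho> =
        Map (pos_ext R K (Suc n) B) \<Omega> G j (Map (pos_ext R K (Suc n) B) G G' p \<sigma>)"
    by (rule lift_vanishing[where \<Phi>' = "pos_push R K (Suc (Suc n)) X A B x",
          OF pos_push_morphism[OF tri_mor(1)] _ Suc.prems])
      (simp_all add: pos_push_upper_sharp)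
  note [simp] = projective_triangleD[OF t]
  have "pos_push R K (Suc n) \<Omega> A B x \<rho> = \<zero>\<^bsub>Obj (pos_ext R K (Suc n) B) \<Omega>\<^esub>"
    using \<sigma> projective_Map_zero[OF p \<sigma>(1)] Mod_functor_closed(5)[OF pos_ext_functor, of j \<Omega> G "Suc n" B]
    by simp
  then obtain \<gamma> where "\<gamma> \<in> elts (pos_ext R K n C) \<Omega>" "\<rho> = lower_sharp R K n C A \<delta> \<Omega> \<gamma>"
    using Suc.IH[OF \<rho>(1)] by blast
  then show ?case
    using \<rho>(2) by (intro bexI[of _ "upper_sharp R K n X \<Omega> \<omega> C \<gamma>"])
      (simp_all add: lower_sharp_upper_sharp)
qed

text \<open>
  Here the degree of \<open>\<sigma>\<close> may be zero, so \<open>p\<^sup>*\<sigma>\<close> need not vanish; but \<open>\<delta>\<^sub>\<sharp>(p\<^sup>*\<sigma>) = p\<^sup>*(\<delta>\<^sub>\<sharp>\<sigma>)\<close> does, so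
  \<open>p\<^sup>*\<sigma>\<close> lifts along \<open>y\<close> and can be subtracted.
\<close>

lemma pos_exact_middle:
  "\<beta> \<in> elts (pos_ext R K n B) X \<Longrightarrow>
   pos_push R K n X B C y \<beta> = \<zero>\<^bsub>Obj (pos_ext R K n C) X\<^esub> \<Longrightarrow>
   \<exists>\<alpha>\<in>elts (pos_ext R K n A) X. \<beta> = pos_push R K n X A B x \<alpha>"
proof (induction n arbitrary: X \<beta>)
  case 0
  then obtain f where f: "f \<in> mor K X B" "\<beta> = Mor f" unfolding pos_ext_0_sel by blast
  then have "Comp K X B C y f = \<zero>\<^bsub>Hom K X C\<^esub>" using 0 unfolding pos_ext_0_sel by simp
  then show ?case using factor_through_inflation[OF tri f(1)] f(2) unfolding pos_ext_0_sel by auto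
next
  case (Suc n)
  obtain \<Omega> G j g \<omega> \<rho> G' p \<sigma> where t: "projective_triangle K \<Omega> G X j g \<omega>"
    and \<rho>: "\<rho> \<in> elts (pos_ext R K n B) \<Omega>" "\<beta> = upper_sharp R K n X \<Omega> \<omega> B \<rho>"
    and p: "projective_morphism K G G' p" and \<sigma>: "\<sigma> \<in> elts (pos_ext R K n C) G'"
      "pos_push R K n \<Omega> B C y \<rho> = Map (pos_ext R K n C) \<Omega> G j (Map (pos_ext R K n C) G G' p \<sigma>)"
    by (rule lift_vanishing[where \<Phi>' = "pos_push R K (Suc n) X B C y",
          OF pos_push_morphism[OF tri_mor(2)] _ Suc.prems])
      (simp_all add: pos_push_upper_sharp)
  note [simp] = projective_triangleD[OF t] projective_morphismD(1)[OF p]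
  have "lower_sharp R K n C A \<delta> G (Map (pos_ext R K n C) G G' p \<sigma>) = \<zero>\<^bsub>Obj (pos_ext R K (Suc n) A) G\<^esub>"
    using Mod_morphismD(2)[OF lower_sharp_morphism, of \<delta> C A p G G' \<sigma> n] \<sigma>(1)
      projective_Map_zero[OF p lower_sharp_closed[of \<delta> C A \<sigma> n G']] by simp
  then obtain \<sigma>' where \<sigma>': "\<sigma>' \<in> elts (pos_ext R K n B) G"
    "Map (pos_ext R K n C) G G' p \<sigma> = pos_push R K n G B C y \<sigma>'"
    using pos_exact_third[of "Map (pos_ext R K n C) G G' p \<sigma>" n G] \<sigma>(1) by auto
  define \<sigma>'' where "\<sigma>'' = Map (pos_ext R K n B) \<Omega> G j \<sigma>'"
  have \<sigma>'': "\<sigma>'' \<in> elts (pos_ext R K n B) \<Omega>" using \<sigma>' by (simp add: \<sigma>''_def)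
  interpret M: module R "Obj (pos_ext R K n B) \<Omega>" by (rule pos_ext_module)
  have "pos_push R K n \<Omega> B C y \<rho> = pos_push R K n \<Omega> B C y \<sigma>''"
    using \<sigma>(2) \<sigma>' Mod_morphismD(2)[OF pos_push_morphism, of y B C j \<Omega> G \<sigma>' n] by (simp add: \<sigma>''_def)
  then have "pos_push R K n \<Omega> B C y (\<rho> \<ominus>\<^bsub>Obj (pos_ext R K n B) \<Omega>\<^esub> \<sigma>'') = \<zero>\<^bsub>Obj (pos_ext R K n C) \<Omega>\<^esub>"
    using linear_map_minus[OF pos_ext_module pos_ext_module Mod_morphismD(1)[OF pos_push_morphism], of y B C \<rho> n \<Omega> \<sigma>'']
      \<rho>(1) \<sigma>'' by (simp add: module_minus_eq_zero[OF pos_ext_module])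
  then obtain \<alpha> where \<alpha>: "\<alpha> \<in> elts (pos_ext R K n A) \<Omega>"
    "\<rho> \<ominus>\<^bsub>Obj (pos_ext R K n B) \<Omega>\<^esub> \<sigma>'' = pos_push R K n \<Omega> A B x \<alpha>"
    using Suc.IH[OF M.minus_closed[OF \<rho>(1) \<sigma>'']] by blast
  interpret N: module R "Obj (pos_ext R K (Suc n) B) X" by (rule pos_ext_module)
  have "upper_sharp R K n X \<Omega> \<omega> B \<sigma>'' = \<zero>\<^bsub>Obj (pos_ext R K (Suc n) B) X\<^esub>"
    using upper_sharp_push_ext[of j \<Omega> G \<sigma>' n B \<omega> X] \<sigma>'(1) triangle_push_zero[OF projective_triangleD(1)[OF t]]
    by (simp add: \<sigma>''_def upper_sharp_zero_ext)
  moreover have "\<rho> = pos_push R K n \<Omega> A B x \<alpha> \<oplus>\<^bsub>Obj (pos_ext R K n B) \<Omega>\<^esub> \<sigma>''"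
    using module_minus_add_cancel[OF pos_ext_module \<rho>(1) \<sigma>''] \<alpha>(2) by simp
  ultimately have "\<beta> = upper_sharp R K n X \<Omega> \<omega> B (pos_push R K n \<Omega> A B x \<alpha>)"
    using linear_map_add[OF upper_sharp_linear, of \<omega> X \<Omega> "pos_push R K n \<Omega> A B x \<alpha>" n B \<sigma>''] \<alpha>(1) \<sigma>'' \<rho>(2)
      upper_sharp_closed[of \<omega> X \<Omega> "pos_push R K n \<Omega> A B x \<alpha>" n B]
    by simp
  then show ?case
    using \<alpha>(1) by (intro bexI[of _ "upper_sharp R K n X \<Omega> \<omega> A \<alpha>"])
      (simp_all add: pos_push_upper_sharp)
qed

lemma pos_ext_exact:
  shows "Mod_exact R K (pos_ext R K n A) (\<lambda>X. pos_push R K n X A B x) (pos_ext R K n B)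
      (\<lambda>X. pos_push R K n X B C y) (pos_ext R K n C)"
    and "Mod_exact R K (pos_ext R K n B) (\<lambda>X. pos_push R K n X B C y) (pos_ext R K n C)
      (lower_sharp R K n C A \<delta>) (pos_ext R K (Suc n) A)"
    and "Mod_exact R K (pos_ext R K n C) (lower_sharp R K n C A \<delta>) (pos_ext R K (Suc n) A)
      (\<lambda>X. pos_push R K (Suc n) X A B x) (pos_ext R K (Suc n) B)"
  by (intro Mod_exactI pos_ext_functor pos_push_morphism lower_sharp_morphism tri_mor
      pos_push_push_zero lower_sharp_push_zero push_lower_sharp_zero
      pos_exact_middle pos_exact_third pos_exact_first; assumption)+

end

end


section \<open>Functors of natural transformations into hom functors\<close>

text \<open>The functor sending \<open>X\<close> to the transformations \<open>F \<rightarrow> C(X, -)\<close>.\<close>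

definition nat_fun ::
  "'r ring \<Rightarrow> ('r, 'o, 'm, 'e) ecat \<Rightarrow> ('r, 'o, 'm, 'p) mfun \<Rightarrow> ('r, 'o, 'm, 'o \<Rightarrow> 'p \<Rightarrow> 'm) mfun" where
  "nat_fun R K F = \<lparr> Obj = (\<lambda>X. nat_module R K F (hom_cov K X)),
     Map = (\<lambda>X' X c \<phi> Y. \<lambda>u\<in>elts F Y. Comp K X' X Y (\<phi> Y u) c) \<rparr>"

lemma nat_fun_sel [simp]:
  "elts (nat_fun R K F) X = nat_trans R K F (hom_cov K X)"
  "\<zero>\<^bsub>Obj (nat_fun R K F) X\<^esub> = (\<lambda>Y. \<lambda>u\<in>elts F Y. \<zero>\<^bsub>Hom K X Y\<^esub>)"
  "\<phi> \<oplus>\<^bsub>Obj (nat_fun R K F) X\<^esub> \<psi> = (\<lambda>Y. \<lambda>u\<in>elts F Y. \<phi> Y u \<oplus>\<^bsub>Hom K X Y\<^esub> \<psi> Y u)"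
  "r \<odot>\<^bsub>Obj (nat_fun R K F) X\<^esub> \<phi> = (\<lambda>Y. \<lambda>u\<in>elts F Y. r \<odot>\<^bsub>Hom K X Y\<^esub> \<phi> Y u)"
  "Map (nat_fun R K F) X' X c \<phi> = (\<lambda>Y. \<lambda>u\<in>elts F Y. Comp K X' X Y (\<phi> Y u) c)"
  by (simp_all add: nat_fun_def nat_module_def hom_cov_def)

lemma nat_transD:
  assumes "\<phi> \<in> nat_trans R K F (hom_cov K X)"
  shows "\<phi> Y \<in> extensional (elts F Y)"
    and "linear_map R (Obj F Y) (Hom K X Y) (\<phi> Y)"
    and "f \<in> mor K Y Z \<Longrightarrow> u \<in> elts F Y \<Longrightarrow> \<phi> Z (Map F Y Z f u) = Comp K X Y Z f (\<phi> Y u)"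
  using assms by (auto simp: nat_trans_def hom_cov_def)

lemma nat_transI:
  assumes "\<And>Y. \<phi> Y \<in> extensional (elts F Y)"
    and "\<And>Y. linear_map R (Obj F Y) (Hom K X Y) (\<phi> Y)"
    and "\<And>Y Z f u. f \<in> mor K Y Z \<Longrightarrow> u \<in> elts F Y \<Longrightarrow> \<phi> Z (Map F Y Z f u) = Comp K X Y Z f (\<phi> Y u)"
  shows "\<phi> \<in> nat_trans R K F (hom_cov K X)"
  using assms by (auto simp: nat_trans_def hom_cov_def)

lemma nat_trans_eqI:
  assumes "\<phi> \<in> nat_trans R K F (hom_cov K X)" "\<psi> \<in> nat_trans R K F (hom_cov K X)"
    and "\<And>Y u. u \<in> elts F Y \<Longrightarrow> \<phi> Y u = \<psi> Y u"
  shows "\<phi> = \<psi>"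
  using extensionalityI[OF nat_transD(1)[OF assms(1)] nat_transD(1)[OF assms(2)] assms(3)] by (rule ext)

locale covariant_modules = linear_category R K for R :: "'r ring" (structure)
    and K :: "('r, 'o, 'm, 'e) ecat" +
  fixes F :: "('r, 'o, 'm, 'p) mfun"
  assumes F_module: "module R (Obj F Y)"
    and F_Map_closed: "f \<in> mor K Y Z \<Longrightarrow> u \<in> elts F Y \<Longrightarrow> Map F Y Z f u \<in> elts F Z"
begin

lemma F_closed [simp, intro]:
  "\<zero>\<^bsub>Obj F Y\<^esub> \<in> elts F Y"
  "u \<in> elts F Y \<Longrightarrow> v \<in> elts F Y \<Longrightarrow> u \<oplus>\<^bsub>Obj F Y\<^esub> v \<in> elts F Y"
  "r \<in> carrier R \<Longrightarrow> u \<in> elts F Y \<Longrightarrow> r \<odot>\<^bsub>Obj F Y\<^esub> u \<in> elts F Y"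
proof -
  interpret M: module R "Obj F Y" by (rule F_module)
  show "\<zero>\<^bsub>Obj F Y\<^esub> \<in> elts F Y"
    "u \<in> elts F Y \<Longrightarrow> v \<in> elts F Y \<Longrightarrow> u \<oplus>\<^bsub>Obj F Y\<^esub> v \<in> elts F Y"
    "r \<in> carrier R \<Longrightarrow> u \<in> elts F Y \<Longrightarrow> r \<odot>\<^bsub>Obj F Y\<^esub> u \<in> elts F Y" by auto
qed

lemma nat_trans_closed:
  "\<phi> \<in> nat_trans R K F (hom_cov K X) \<Longrightarrow> u \<in> elts F Y \<Longrightarrow> \<phi> Y u \<in> mor K X Y"
  using linear_map_closed[OF nat_transD(2)] .

lemma nat_zero: "\<zero>\<^bsub>Obj (nat_fun R K F) X\<^esub> \<in> nat_trans R K F (hom_cov K X)"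
proof (rule nat_transI)
  fix Y
  interpret H: module R "Hom K X Y" by (rule hom_module)
  show "linear_map R (Obj F Y) (Hom K X Y) (\<zero>\<^bsub>Obj (nat_fun R K F) X\<^esub> Y)"
    by (intro linear_mapI) auto
qed (auto simp: F_Map_closed)

lemma nat_add:
  assumes "\<phi> \<in> nat_trans R K F (hom_cov K X)" "\<psi> \<in> nat_trans R K F (hom_cov K X)"
  shows "\<phi> \<oplus>\<^bsub>Obj (nat_fun R K F) X\<^esub> \<psi> \<in> nat_trans R K F (hom_cov K X)"
proof (rule nat_transI)
  note closed [simp] = nat_trans_closed[OF assms(1)] nat_trans_closed[OF assms(2)]
  fix Y
  interpret H: module R "Hom K X Y" by (rule hom_module)
  note add = linear_map_add[OF nat_transD(2)[OF assms(1)], of _ Y] linear_map_add[OF nat_transD(2)[OF assms(2)], of _ Y]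
  note smult = linear_map_smult[OF nat_transD(2)[OF assms(1)], of _ _ Y]
    linear_map_smult[OF nat_transD(2)[OF assms(2)], of _ _ Y]
  show "linear_map R (Obj F Y) (Hom K X Y) ((\<phi> \<oplus>\<^bsub>Obj (nat_fun R K F) X\<^esub> \<psi>) Y)"
    by (intro linear_mapI) (simp_all add: add smult H.a_ac H.smult_r_distr)
  show "(\<phi> \<oplus>\<^bsub>Obj (nat_fun R K F) X\<^esub> \<psi>) Z (Map F Y Z f u) =
      Comp K X Y Z f ((\<phi> \<oplus>\<^bsub>Obj (nat_fun R K F) X\<^esub> \<psi>) Y u)"
    if "f \<in> mor K Y Z" "u \<in> elts F Y" for Z f u
    using that F_Map_closed[OF that] nat_transD(3)[OF assms(1) that] nat_transD(3)[OF assms(2) that]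
      linear_map_add[OF comp_linear_right[OF that(1)], of "\<phi> Y u" X "\<psi> Y u"] by simp
qed auto

lemma nat_smult:
  assumes r: "r \<in> carrier R" and "\<phi> \<in> nat_trans R K F (hom_cov K X)"
  shows "r \<odot>\<^bsub>Obj (nat_fun R K F) X\<^esub> \<phi> \<in> nat_trans R K F (hom_cov K X)"
proof (rule nat_transI)
  note closed [simp] = nat_trans_closed[OF assms(2)]
  fix Y
  interpret H: module R "Hom K X Y" by (rule hom_module)
  note add = linear_map_add[OF nat_transD(2)[OF assms(2)], of _ Y]
  note smult = linear_map_smult[OF nat_transD(2)[OF assms(2)], of _ _ Y]
  show "linear_map R (Obj F Y) (Hom K X Y) ((r \<odot>\<^bsub>Obj (nat_fun R K F) X\<^esub> \<phi>) Y)"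
    using r by (intro linear_mapI) (simp_all add: add smult H.smult_r_distr H.smult_assoc1[symmetric] m_comm)
  show "(r \<odot>\<^bsub>Obj (nat_fun R K F) X\<^esub> \<phi>) Z (Map F Y Z f u) =
      Comp K X Y Z f ((r \<odot>\<^bsub>Obj (nat_fun R K F) X\<^esub> \<phi>) Y u)"
    if "f \<in> mor K Y Z" "u \<in> elts F Y" for Z f u
    using that F_Map_closed[OF that] nat_transD(3)[OF assms(2) that] r
      linear_map_smult[OF comp_linear_right[OF that(1)], of r "\<phi> Y u" X] by simp
qed auto

lemma nat_Map:
  assumes c: "c \<in> mor K X' X" and "\<phi> \<in> nat_trans R K F (hom_cov K X)"
  shows "Map (nat_fun R K F) X' X c \<phi> \<in> nat_trans R K F (hom_cov K X')"
proof (rule nat_transI)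
  note closed [simp] = nat_trans_closed[OF assms(2)]
  fix Y
  show "linear_map R (Obj F Y) (Hom K X' Y) (Map (nat_fun R K F) X' X c \<phi> Y)"
    using linear_map_compose[OF nat_transD(2)[OF assms(2), of Y] comp_linear_left[OF c]]
    by (auto simp: linear_map_def)
  show "(Map (nat_fun R K F) X' X c \<phi>) Z (Map F Y Z f u) =
      Comp K X' Y Z f ((Map (nat_fun R K F) X' X c \<phi>) Y u)"
    if "f \<in> mor K Y Z" "u \<in> elts F Y" for Z f u
    using that F_Map_closed[OF that] nat_transD(3)[OF assms(2) that] c
      comp_assoc[of c X' X "\<phi> Y u" Y f Z] by simp
qed auto

lemma nat_fun_module: "module R (Obj (nat_fun R K F) X)"
proof -
  note closed = nat_trans_closed
  show ?thesis
  proof (rule moduleI)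
    show "cring R" by (rule cring_axioms)
    show "abelian_group (Obj (nat_fun R K F) X)"
    proof (rule abelian_groupI, goal_cases)
      case (1 \<phi> \<psi>) then show ?case using nat_add by simp
    next
      case 2 show ?case using nat_zero by simp
    next
      case (3 \<phi> \<psi> \<chi>)
      then have in3: "\<phi> \<in> nat_trans R K F (hom_cov K X)" "\<psi> \<in> nat_trans R K F (hom_cov K X)"
        "\<chi> \<in> nat_trans R K F (hom_cov K X)" by simp_all
      show ?case
      proof (rule nat_trans_eqI[of _ R K F X])
        fix Y u assume u: "u \<in> elts F Y"
        interpret H: module R "Hom K X Y" by (rule hom_module)
        show "(\<phi> \<oplus>\<^bsub>Obj (nat_fun R K F) X\<^esub> \<psi> \<oplus>\<^bsub>Obj (nat_fun R K F) X\<^esub> \<chi>) Y u =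
          (\<phi> \<oplus>\<^bsub>Obj (nat_fun R K F) X\<^esub> (\<psi> \<oplus>\<^bsub>Obj (nat_fun R K F) X\<^esub> \<chi>)) Y u"
          using u in3 closed by (simp add: H.a_assoc)
      qed (intro nat_add in3)+
    next
      case (4 \<phi> \<psi>)
      then have in2: "\<phi> \<in> nat_trans R K F (hom_cov K X)" "\<psi> \<in> nat_trans R K F (hom_cov K X)" by simp_all
      show ?case
      proof (rule nat_trans_eqI[of _ R K F X])
        fix Y u assume u: "u \<in> elts F Y"
        interpret H: module R "Hom K X Y" by (rule hom_module)
        show "(\<phi> \<oplus>\<^bsub>Obj (nat_fun R K F) X\<^esub> \<psi>) Y u = (\<psi> \<oplus>\<^bsub>Obj (nat_fun R K F) X\<^esub> \<phi>) Y u"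
          using u in2 closed by (simp add: H.a_comm)
      qed (intro nat_add in2)+
    next
      case (5 \<phi>)
      then have in1: "\<phi> \<in> nat_trans R K F (hom_cov K X)" by simp
      show ?case
      proof (rule nat_trans_eqI[of _ R K F X])
        fix Y u assume u: "u \<in> elts F Y"
        interpret H: module R "Hom K X Y" by (rule hom_module)
        show "(\<zero>\<^bsub>Obj (nat_fun R K F) X\<^esub> \<oplus>\<^bsub>Obj (nat_fun R K F) X\<^esub> \<phi>) Y u = \<phi> Y u"
          using u in1 closed by simp
      qed (intro nat_add nat_zero in1)+
    next
      case (6 \<phi>)
      then have in1: "\<phi> \<in> nat_trans R K F (hom_cov K X)" by simp
      have neg: "(\<ominus> \<one>) \<odot>\<^bsub>Obj (nat_fun R K F) X\<^esub> \<phi> \<in> nat_trans R K F (hom_cov K X)"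
        by (intro nat_smult in1) simp
      have "(\<ominus> \<one>) \<odot>\<^bsub>Obj (nat_fun R K F) X\<^esub> \<phi> \<oplus>\<^bsub>Obj (nat_fun R K F) X\<^esub> \<phi> = \<zero>\<^bsub>Obj (nat_fun R K F) X\<^esub>"
      proof (rule nat_trans_eqI[of _ R K F X])
        fix Y u assume u: "u \<in> elts F Y"
        interpret H: module R "Hom K X Y" by (rule hom_module)
        show "((\<ominus> \<one>) \<odot>\<^bsub>Obj (nat_fun R K F) X\<^esub> \<phi> \<oplus>\<^bsub>Obj (nat_fun R K F) X\<^esub> \<phi>) Y u =
            \<zero>\<^bsub>Obj (nat_fun R K F) X\<^esub> Y u"
          using u in1 closed by (simp add: H.smult_l_minus H.l_neg)
      qed (intro nat_add nat_zero neg in1)+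
      then show ?case using neg by (intro bexI[of _ "(\<ominus> \<one>) \<odot>\<^bsub>Obj (nat_fun R K F) X\<^esub> \<phi>"]) simp_all
    qed
  next
    fix a \<phi> assume a: "a \<in> carrier R" and "\<phi> \<in> elts (nat_fun R K F) X"
    then have in1: "\<phi> \<in> nat_trans R K F (hom_cov K X)" by simp
    show "a \<odot>\<^bsub>Obj (nat_fun R K F) X\<^esub> \<phi> \<in> elts (nat_fun R K F) X" using nat_smult[OF a in1] by simp
    fix b assume b: "b \<in> carrier R"
    show "(a \<oplus> b) \<odot>\<^bsub>Obj (nat_fun R K F) X\<^esub> \<phi> =
      a \<odot>\<^bsub>Obj (nat_fun R K F) X\<^esub> \<phi> \<oplus>\<^bsub>Obj (nat_fun R K F) X\<^esub> b \<odot>\<^bsub>Obj (nat_fun R K F) X\<^esub> \<phi>"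
    proof (rule nat_trans_eqI[of _ R K F X])
      fix Y u assume u: "u \<in> elts F Y"
      interpret H: module R "Hom K X Y" by (rule hom_module)
      show "((a \<oplus> b) \<odot>\<^bsub>Obj (nat_fun R K F) X\<^esub> \<phi>) Y u =
        (a \<odot>\<^bsub>Obj (nat_fun R K F) X\<^esub> \<phi> \<oplus>\<^bsub>Obj (nat_fun R K F) X\<^esub> b \<odot>\<^bsub>Obj (nat_fun R K F) X\<^esub> \<phi>) Y u"
        using u in1 a b closed by (simp add: H.smult_l_distr)
    qed (intro nat_add nat_smult a b in1 a_closed)+
    show "(a \<otimes> b) \<odot>\<^bsub>Obj (nat_fun R K F) X\<^esub> \<phi> =
      a \<odot>\<^bsub>Obj (nat_fun R K F) X\<^esub> (b \<odot>\<^bsub>Obj (nat_fun R K F) X\<^esub> \<phi>)"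
    proof (rule nat_trans_eqI[of _ R K F X])
      fix Y u assume u: "u \<in> elts F Y"
      interpret H: module R "Hom K X Y" by (rule hom_module)
      show "((a \<otimes> b) \<odot>\<^bsub>Obj (nat_fun R K F) X\<^esub> \<phi>) Y u =
        (a \<odot>\<^bsub>Obj (nat_fun R K F) X\<^esub> (b \<odot>\<^bsub>Obj (nat_fun R K F) X\<^esub> \<phi>)) Y u"
        using u in1 a b closed by (simp add: H.smult_assoc1)
    qed (intro nat_smult a b in1 m_closed)+
  next
    fix a \<phi> \<psi> assume a: "a \<in> carrier R" and "\<phi> \<in> elts (nat_fun R K F) X" "\<psi> \<in> elts (nat_fun R K F) X"
    then have in2: "\<phi> \<in> nat_trans R K F (hom_cov K X)" "\<psi> \<in> nat_trans R K F (hom_cov K X)" by simp_all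
    show "a \<odot>\<^bsub>Obj (nat_fun R K F) X\<^esub> (\<phi> \<oplus>\<^bsub>Obj (nat_fun R K F) X\<^esub> \<psi>) =
      a \<odot>\<^bsub>Obj (nat_fun R K F) X\<^esub> \<phi> \<oplus>\<^bsub>Obj (nat_fun R K F) X\<^esub> a \<odot>\<^bsub>Obj (nat_fun R K F) X\<^esub> \<psi>"
    proof (rule nat_trans_eqI[of _ R K F X])
      fix Y u assume u: "u \<in> elts F Y"
      interpret H: module R "Hom K X Y" by (rule hom_module)
      show "(a \<odot>\<^bsub>Obj (nat_fun R K F) X\<^esub> (\<phi> \<oplus>\<^bsub>Obj (nat_fun R K F) X\<^esub> \<psi>)) Y u =
        (a \<odot>\<^bsub>Obj (nat_fun R K F) X\<^esub> \<phi> \<oplus>\<^bsub>Obj (nat_fun R K F) X\<^esub> a \<odot>\<^bsub>Obj (nat_fun R K F) X\<^esub> \<psi>) Y u"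
        using u in2 a closed by (simp add: H.smult_r_distr)
    qed (intro nat_smult nat_add a in2)+
  next
    fix \<phi> assume "\<phi> \<in> elts (nat_fun R K F) X"
    then have in1: "\<phi> \<in> nat_trans R K F (hom_cov K X)" by simp
    show "\<one> \<odot>\<^bsub>Obj (nat_fun R K F) X\<^esub> \<phi> = \<phi>"
    proof (rule nat_trans_eqI[of _ R K F X])
      fix Y u assume u: "u \<in> elts F Y"
      interpret H: module R "Hom K X Y" by (rule hom_module)
      show "(\<one> \<odot>\<^bsub>Obj (nat_fun R K F) X\<^esub> \<phi>) Y u = \<phi> Y u" using u in1 closed by simp
    qed (intro nat_smult in1 one_closed)+
  qed
qed

lemma nat_fun_functor: "Mod_functor R K (nat_fun R K F)"
  unfolding Mod_functor_def
proof (intro conjI allI ballI)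
  show "module R (Obj (nat_fun R K F) X)" for X by (rule nat_fun_module)
next
  fix X Y f assume f: "f \<in> mor K X Y"
  show "linear_map R (Obj (nat_fun R K F) Y) (Obj (nat_fun R K F) X) (Map (nat_fun R K F) X Y f)"
    using nat_Map[OF f] nat_trans_closed linear_map_add[OF comp_linear_left[OF f]]
      linear_map_smult[OF comp_linear_left[OF f]]
    by (intro linear_mapI) (auto intro!: ext restrict_ext)
next
  fix X u assume "u \<in> elts (nat_fun R K F) X"
  then have u: "u \<in> nat_trans R K F (hom_cov K X)" by simp
  show "Map (nat_fun R K F) X X (Ident K X) u = u"
    using nat_Map[OF ident_mor u] u nat_trans_closed[OF u] by (intro nat_trans_eqI[of _ R K F X]) auto
next
  fix X Y Z f g u assume f: "f \<in> mor K X Y" "g \<in> mor K Y Z" and "u \<in> elts (nat_fun R K F) Z"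
  then have u: "u \<in> nat_trans R K F (hom_cov K Z)" by simp
  show "Map (nat_fun R K F) X Z (Comp K X Y Z g f) u =
      Map (nat_fun R K F) X Y f (Map (nat_fun R K F) Y Z g u)"
    using f nat_trans_closed[OF u] comp_assoc by (auto intro!: ext restrict_ext)
next
  fix X Y u assume "u \<in> elts (nat_fun R K F) Y"
  then have u: "u \<in> nat_trans R K F (hom_cov K Y)" by simp
  show "linear_map R (Hom K X Y) (Obj (nat_fun R K F) X) (\<lambda>f. Map (nat_fun R K F) X Y f u)"
    using nat_Map[OF _ u] linear_map_add[OF comp_linear_right[OF nat_trans_closed[OF u]]]
      linear_map_smult[OF comp_linear_right[OF nat_trans_closed[OF u]]]
    by (intro linear_mapI) (auto intro!: ext restrict_ext)
qed

end

lemma precompose_apply [simp]: "u \<in> elts F Y \<Longrightarrow> precompose F \<theta> \<phi> Y u = \<phi> Y (\<theta> Y u)"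
  by (simp add: precompose_def)

context linear_category
begin

lemma precompose_nat_trans:
  assumes F: "covariant_modules R K F" and F': "covariant_modules R K F'"
    and \<theta>: "\<And>Y. linear_map R (Obj F' Y) (Obj F Y) (\<theta> Y)"
    and nat: "\<And>Y Z f u. f \<in> mor K Y Z \<Longrightarrow> u \<in> elts F' Y \<Longrightarrow> \<theta> Z (Map F' Y Z f u) = Map F Y Z f (\<theta> Y u)"
    and \<phi>: "\<phi> \<in> nat_trans R K F (hom_cov K X)"
  shows "precompose F' \<theta> \<phi> \<in> nat_trans R K F' (hom_cov K X)"
proof (rule nat_transI)
  interpret F: covariant_modules R K F by fact
  interpret F': covariant_modules R K F' by fact
  show "precompose F' \<theta> \<phi> Y \<in> extensional (elts F' Y)" for Y by (simp add: precompose_def)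
  show "linear_map R (Obj F' Y) (Hom K X Y) (precompose F' \<theta> \<phi> Y)" for Y
    using linear_map_compose[OF \<theta>[of Y] nat_transD(2)[OF \<phi>]]
    by (auto simp: linear_map_def)
  show "precompose F' \<theta> \<phi> Z (Map F' Y Z f u) = Comp K X Y Z f (precompose F' \<theta> \<phi> Y u)"
    if "f \<in> mor K Y Z" "u \<in> elts F' Y" for Y Z f u
    using that F'.F_Map_closed[OF that] nat nat_transD(3)[OF \<phi>] linear_map_closed[OF \<theta>] by simp
qed

lemma precompose_morphism:
  assumes F: "covariant_modules R K F" and F': "covariant_modules R K F'"
    and \<theta>: "\<And>Y. linear_map R (Obj F' Y) (Obj F Y) (\<theta> Y)"
    and nat: "\<And>Y Z f u. f \<in> mor K Y Z \<Longrightarrow> u \<in> elts F' Y \<Longrightarrow> \<theta> Z (Map F' Y Z f u) = Map F Y Z f (\<theta> Y u)"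
  shows "Mod_morphism R K (nat_fun R K F) (nat_fun R K F') (\<lambda>X. precompose F' \<theta>)"
  unfolding Mod_morphism_def
proof (intro conjI allI ballI)
  note closed = linear_map_closed[OF \<theta>]
  show "linear_map R (Obj (nat_fun R K F) X) (Obj (nat_fun R K F') X) (precompose F' \<theta>)" for X
    using precompose_nat_trans[OF F F' \<theta> nat]
    by (intro linear_mapI) (auto simp: precompose_def closed intro!: ext restrict_ext)
  show "precompose F' \<theta> (Map (nat_fun R K F) X Y f u) = Map (nat_fun R K F') X Y f (precompose F' \<theta> u)"
    if "f \<in> mor K X Y" "u \<in> elts (nat_fun R K F) Y" for X Y f u
    by (auto simp: precompose_def closed intro!: ext restrict_ext)
qed

end

section \<open>Negative extensions\<close>

text \<open>
  \<open>neg_ext R K n A\<close> is \<open>\<bbbE>\<^sub>I\<^sup>-\<^sup>n(-, A)\<close>, including degree zero, where it is only isomorphic to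
  \<open>C(-, A)\<close>.
\<close>

abbreviation neg_ext ::
  "'r ring \<Rightarrow> ('r, 'o, 'm, 'e) ecat \<Rightarrow> nat \<Rightarrow> 'o \<Rightarrow> ('r, 'o, 'm, 'o \<Rightarrow> ('o, 'm, 'e) pext \<Rightarrow> 'm) mfun" where
  "neg_ext R K n A \<equiv> nat_fun R K (pos_ext_cov R K n A)"

abbreviation neg_zero ::
  "'r ring \<Rightarrow> ('r, 'o, 'm, 'e) ecat \<Rightarrow> nat \<Rightarrow> 'o \<Rightarrow> 'o \<Rightarrow> 'o \<Rightarrow> ('o, 'm, 'e) pext \<Rightarrow> 'm" where
  "neg_zero R K n X A \<equiv> \<zero>\<^bsub>Obj (neg_ext R K n A) X\<^esub>"

definition neg_push ::
  "'r ring \<Rightarrow> ('r, 'o, 'm, 'e) ecat \<Rightarrow> nat \<Rightarrow> 'o \<Rightarrow> 'o \<Rightarrow> 'm \<Rightarrow>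
   ('o \<Rightarrow> ('o, 'm, 'e) pext \<Rightarrow> 'm) \<Rightarrow> 'o \<Rightarrow> ('o, 'm, 'e) pext \<Rightarrow> 'm" where
  "neg_push R K n A B x = precompose (pos_ext_cov R K n B) (\<lambda>Y. Map (pos_ext R K n Y) A B x)"

definition neg_conn ::
  "'r ring \<Rightarrow> ('r, 'o, 'm, 'e) ecat \<Rightarrow> nat \<Rightarrow> 'o \<Rightarrow> 'o \<Rightarrow> 'e \<Rightarrow>
   ('o \<Rightarrow> ('o, 'm, 'e) pext \<Rightarrow> 'm) \<Rightarrow> 'o \<Rightarrow> ('o, 'm, 'e) pext \<Rightarrow> 'm" where
  "neg_conn R K n C A \<delta> = precompose (pos_ext_cov R K n A) (upper_sharp R K n C A \<delta>)"

lemma pos_ext_cov_sel [simp]: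
  "Obj (pos_ext_cov R K n X) Y = Obj (pos_ext R K n Y) X"
  "Map (pos_ext_cov R K n X) Y Y' a = pos_push R K n X Y Y' a"
  by (simp_all add: pos_ext_cov_def)

lemma neg_push_apply [simp]:
  "u \<in> elts (pos_ext R K n Y) B \<Longrightarrow> neg_push R K n A B x \<phi> Y u = \<phi> Y (Map (pos_ext R K n Y) A B x u)"
  by (simp add: neg_push_def)

lemma neg_conn_apply [simp]:
  "u \<in> elts (pos_ext R K n Y) A \<Longrightarrow> neg_conn R K n C A \<delta> \<phi> Y u = \<phi> Y (upper_sharp R K n C A \<delta> Y u)"
  by (simp add: neg_conn_def)

lemma neg_zero_apply:
  "u \<in> elts (pos_ext R K n Y) A \<Longrightarrow> neg_zero R K n X A Y u = \<zero>\<^bsub>Hom K X Y\<^esub>"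
  by simp

context enough_projectives
begin

lemma covariant_pos_ext: "covariant_modules R K (pos_ext_cov R K n A)"
  by (intro covariant_modules.intro linear_category_axioms covariant_modules_axioms.intro)
    (simp_all add: pos_ext_module pos_push_closed del: pos_ext_0_sel)

lemma neg_functor: "Mod_functor R K (neg_ext R K n A)"
  using covariant_modules.nat_fun_functor[OF covariant_pos_ext] .

lemmas neg_module = Mod_functorD(1)[OF neg_functor]

lemma neg_push_morphism:
  assumes x: "x \<in> mor K A B"
  shows "Mod_morphism R K (neg_ext R K n A) (neg_ext R K n B) (\<lambda>X. neg_push R K n A B x)"
  unfolding neg_push_def
  using Mod_functorD(2)[OF pos_ext_functor x] Mod_morphismD(2)[OF pos_push_morphism x]
  by (intro precompose_morphism covariant_pos_ext) simp_all

lemma neg_conn_morphism: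
  assumes \<delta>: "\<delta> \<in> carrier (EE K C A)"
  shows "Mod_morphism R K (neg_ext R K (Suc n) C) (neg_ext R K n A) (\<lambda>X. neg_conn R K n C A \<delta>)"
  unfolding neg_conn_def
  using upper_sharp_linear[OF \<delta>] pos_push_upper_sharp[OF _ _ \<delta>]
  by (intro precompose_morphism covariant_pos_ext) simp_all

lemma neg_push_closed [simp, intro]:
  "x \<in> mor K A B \<Longrightarrow> \<phi> \<in> elts (neg_ext R K n A) X \<Longrightarrow> neg_push R K n A B x \<phi> \<in> elts (neg_ext R K n B) X"
  using linear_map_closed[OF Mod_morphismD(1)[OF neg_push_morphism]] .

lemma neg_conn_closed [simp, intro]:
  "\<delta> \<in> carrier (EE K C A) \<Longrightarrow> \<phi> \<in> elts (neg_ext R K (Suc n) C) X \<Longrightarrow>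
   neg_conn R K n C A \<delta> \<phi> \<in> elts (neg_ext R K n A) X"
  using linear_map_closed[OF Mod_morphismD(1)[OF neg_conn_morphism]] .

lemma neg_zero_closed [simp, intro]: "neg_zero R K n X A \<in> elts (neg_ext R K n A) X"
  using Mod_functor_closed(2)[OF neg_functor] .

lemma neg_eqI:
  assumes "\<phi> \<in> elts (neg_ext R K n A) X" "\<psi> \<in> elts (neg_ext R K n A) X"
    and "\<And>Y u. u \<in> elts (pos_ext R K n Y) A \<Longrightarrow> \<phi> Y u = \<psi> Y u"
  shows "\<phi> = \<psi>"
  using assms by (intro nat_trans_eqI[of \<phi> R K "pos_ext_cov R K n A" X]) simp_all

lemma neg_apply_linear:
  "\<phi> \<in> elts (neg_ext R K n A) X \<Longrightarrow> linear_map R (Obj (pos_ext R K n Y) A) (Hom K X Y) (\<phi> Y)"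
  using nat_transD(2)[of \<phi> R K "pos_ext_cov R K n A" X Y] by simp

lemma neg_apply_zero:
  "\<phi> \<in> elts (neg_ext R K n A) X \<Longrightarrow> \<phi> Y \<zero>\<^bsub>Obj (pos_ext R K n Y) A\<^esub> = \<zero>\<^bsub>Hom K X Y\<^esub>"
  using linear_map_zero[OF pos_ext_module hom_module neg_apply_linear] .

lemma neg_push_comp:
  assumes "x \<in> mor K A B" "y \<in> mor K B C" "\<phi> \<in> elts (neg_ext R K n A) X"
  shows "neg_push R K n A C (Comp K A B C y x) \<phi> = neg_push R K n B C y (neg_push R K n A B x \<phi>)"
  using assms Mod_functorD(4)[OF pos_ext_functor assms(1,2)]
  by (intro neg_eqI[of _ n C X] neg_push_closed comp_closed) (auto simp del: nat_fun_sel)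

lemma neg_push_zero_mor:
  assumes "\<phi> \<in> elts (neg_ext R K n A) X"
  shows "neg_push R K n A B \<zero>\<^bsub>Hom K A B\<^esub> \<phi> = neg_zero R K n X B"
  using assms linear_map_zero[OF hom_module pos_ext_module Mod_functorD(5)[OF pos_ext_functor]]
  by (intro neg_eqI[of _ n B X] neg_push_closed)
    (auto simp: neg_zero_apply neg_apply_zero simp del: nat_fun_sel)

lemma neg_conn_push_ext:
  assumes "a \<in> mor K A A'" "\<delta> \<in> carrier (EE K C A)" "\<phi> \<in> elts (neg_ext R K (Suc n) C) X"
  shows "neg_conn R K n C A' (push K C A A' a \<delta>) \<phi> = neg_push R K n A A' a (neg_conn R K n C A \<delta> \<phi>)"
  using assms
  by (intro neg_eqI[of _ n A' X] neg_push_closed neg_conn_closed push_closed)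
    (auto simp: upper_sharp_push_ext simp del: nat_fun_sel)

lemma neg_conn_pull_ext:
  assumes "c \<in> mor K C' C" "\<delta> \<in> carrier (EE K C A)" "\<phi> \<in> elts (neg_ext R K (Suc n) C') X"
  shows "neg_conn R K n C' A (pull K C' C A c \<delta>) \<phi> = neg_conn R K n C A \<delta> (neg_push R K (Suc n) C' C c \<phi>)"
  using assms
  by (intro neg_eqI[of _ n A X] neg_push_closed neg_conn_closed pull_closed)
    (auto simp: Map_upper_sharp simp del: nat_fun_sel)

lemma neg_conn_zero_ext:
  assumes "\<phi> \<in> elts (neg_ext R K (Suc n) C) X"
  shows "neg_conn R K n C A \<zero>\<^bsub>EE K C A\<^esub> \<phi> = neg_zero R K n X A"
  using assms
  by (intro neg_eqI[of _ n A X] neg_conn_closed)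
    (auto simp: upper_sharp_zero_ext neg_apply_zero neg_zero_apply simp del: nat_fun_sel)


subsection \<open>Dimension shift\<close>

text \<open>
  For a projective triangle \<open>\<Omega> \<rightarrow> G \<rightarrow> A\<close> the functor \<open>\<bbbE>\<^sup>n\<^sup>+\<^sup>1(A, -)\<close> is the cokernel of
  \<open>j\<^sup>* : \<bbbE>\<^sup>n(G, -) \<rightarrow> \<bbbE>\<^sup>n(\<Omega>, -)\<close>. Hence \<open>\<bbbE>\<^sub>I\<^sup>-\<^sup>(\<^sup>n\<^sup>+\<^sup>1\<^sup>)(X, A)\<close> is the kernel of
  \<open>j\<^sub>* : \<bbbE>\<^sub>I\<^sup>-\<^sup>n(X, \<Omega>) \<rightarrow> \<bbbE>\<^sub>I\<^sup>-\<^sup>n(X, G)\<close>.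
\<close>

lemma neg_conn_injective:
  assumes t: "projective_triangle K \<Omega> G A j g \<omega>"
    and in': "\<phi> \<in> elts (neg_ext R K (Suc n) A) X" "\<psi> \<in> elts (neg_ext R K (Suc n) A) X"
    and eq: "neg_conn R K n A \<Omega> \<omega> \<phi> = neg_conn R K n A \<Omega> \<omega> \<psi>"
  shows "\<phi> = \<psi>"
proof (rule neg_eqI[OF in'])
  fix Y u assume u: "u \<in> elts (pos_ext R K (Suc n) Y) A"
  obtain \<rho> where "\<rho> \<in> elts (pos_ext R K n Y) \<Omega>" "u = upper_sharp R K n A \<Omega> \<omega> Y \<rho>"
    using upper_sharp_onto[OF t u] .
  then show "\<phi> Y u = \<psi> Y u" using fun_cong[OF fun_cong[OF eq], of Y \<rho>] by simp
qed

lemma neg_conn_kernel: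
  assumes t: "projective_triangle K \<Omega> G A j g \<omega>" and \<psi>: "\<psi> \<in> elts (neg_ext R K n \<Omega>) X"
    and zero: "neg_push R K n \<Omega> G j \<psi> = neg_zero R K n X G"
  obtains \<phi> where "\<phi> \<in> elts (neg_ext R K (Suc n) A) X" "\<psi> = neg_conn R K n A \<Omega> \<omega> \<phi>"
proof -
  note [simp] = projective_triangleD[OF t]
  define lift where "lift Y u = (SOME \<rho>. \<rho> \<in> elts (pos_ext R K n Y) \<Omega> \<and> u = upper_sharp R K n A \<Omega> \<omega> Y \<rho>)" for Y u
  have lift: "lift Y u \<in> elts (pos_ext R K n Y) \<Omega> \<and> u = upper_sharp R K n A \<Omega> \<omega> Y (lift Y u)"
    if u: "u \<in> elts (pos_ext R K (Suc n) Y) A" for Y u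
  proof -
    obtain \<rho> where "\<rho> \<in> elts (pos_ext R K n Y) \<Omega> \<and> u = upper_sharp R K n A \<Omega> \<omega> Y \<rho>"
      using upper_sharp_onto[OF t u] by blast
    then show ?thesis unfolding lift_def by (rule someI)
  qed
  \<comment> \<open>\<open>\<psi>\<close> is constant on the fibres of \<open>\<rho> \<mapsto> \<rho> \<union> \<omega>\<close>, since it vanishes on \<open>j\<^sup>*\<bbbE>\<^sup>n(G, -)\<close>.\<close>
  have cong: "\<psi> Y \<rho> = \<psi> Y \<rho>'"
    if in2: "\<rho> \<in> elts (pos_ext R K n Y) \<Omega>" "\<rho>' \<in> elts (pos_ext R K n Y) \<Omega>"
      and eq: "upper_sharp R K n A \<Omega> \<omega> Y \<rho> = upper_sharp R K n A \<Omega> \<omega> Y \<rho>'" for Y \<rho> \<rho>'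
  proof -
    interpret M: module R "Obj (pos_ext R K n Y) \<Omega>" by (rule pos_ext_module)
    have "upper_sharp R K n A \<Omega> \<omega> Y (\<rho> \<ominus>\<^bsub>Obj (pos_ext R K n Y) \<Omega>\<^esub> \<rho>') = \<zero>\<^bsub>Obj (pos_ext R K (Suc n) Y) A\<^esub>"
      using linear_map_minus[OF pos_ext_module pos_ext_module upper_sharp_linear in2, of \<omega> A] eq in2
      by (simp add: module_minus_eq_zero[OF pos_ext_module])
    then obtain \<sigma> where \<sigma>: "\<sigma> \<in> elts (pos_ext R K n Y) G"
      "\<rho> \<ominus>\<^bsub>Obj (pos_ext R K n Y) \<Omega>\<^esub> \<rho>' = Map (pos_ext R K n Y) \<Omega> G j \<sigma>"
      using upper_sharp_kernel[OF t M.minus_closed[OF in2]] by blast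
    have "\<psi> Y (\<rho> \<ominus>\<^bsub>Obj (pos_ext R K n Y) \<Omega>\<^esub> \<rho>') = \<zero>\<^bsub>Hom K X Y\<^esub>"
      using fun_cong[OF fun_cong[OF zero], of Y \<sigma>] \<sigma> by simp
    then show ?thesis
      using linear_map_minus[OF pos_ext_module hom_module neg_apply_linear[OF \<psi>] in2]
        linear_map_closed[OF neg_apply_linear[OF \<psi>]] in2
      by (simp add: module_minus_eq_zero[OF hom_module])
  qed
  define \<phi> where "\<phi> Y = (\<lambda>u\<in>elts (pos_ext R K (Suc n) Y) A. \<psi> Y (lift Y u))" for Y
  have \<phi>: "\<phi> Y (upper_sharp R K n A \<Omega> \<omega> Y \<rho>) = \<psi> Y \<rho>" if "\<rho> \<in> elts (pos_ext R K n Y) \<Omega>" for Y \<rho>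
    using that lift[of "upper_sharp R K n A \<Omega> \<omega> Y \<rho>" Y] cong[of "lift Y (upper_sharp R K n A \<Omega> \<omega> Y \<rho>)" Y \<rho>]
    by (simp add: \<phi>_def)
  have "\<phi> \<in> nat_trans R K (pos_ext_cov R K (Suc n) A) (hom_cov K X)"
  proof (rule nat_transI)
    show "\<phi> Y \<in> extensional (elts (pos_ext_cov R K (Suc n) A) Y)" for Y by (simp add: \<phi>_def)
    show "linear_map R (Obj (pos_ext_cov R K (Suc n) A) Y) (Hom K X Y) (\<phi> Y)" for Y
    proof (rule linear_mapI)
      note up = upper_sharp_linear[OF projective_triangleD(5)[OF t], of n Y]
      interpret M: module R "Obj (pos_ext R K n Y) \<Omega>" by (rule pos_ext_module)
      fix u assume "u \<in> elts (pos_ext_cov R K (Suc n) A) Y"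
      then obtain \<rho> where u: "\<rho> \<in> elts (pos_ext R K n Y) \<Omega>" "u = upper_sharp R K n A \<Omega> \<omega> Y \<rho>"
        using upper_sharp_onto[OF t, of u n Y] by auto
      show "\<phi> Y u \<in> mor K X Y" using u \<phi> linear_map_closed[OF neg_apply_linear[OF \<psi>]] by simp
      show "\<phi> Y (r \<odot>\<^bsub>Obj (pos_ext_cov R K (Suc n) A) Y\<^esub> u) = r \<odot>\<^bsub>Hom K X Y\<^esub> \<phi> Y u" if "r \<in> carrier R" for r
        using linear_map_smult[OF up that u(1)] linear_map_smult[OF neg_apply_linear[OF \<psi>] that u(1)]
          \<phi>[OF u(1)] \<phi>[OF M.smult_closed[OF that u(1)]] u by simp
      fix v assume "v \<in> elts (pos_ext_cov R K (Suc n) A) Y"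
      then obtain \<rho>' where v: "\<rho>' \<in> elts (pos_ext R K n Y) \<Omega>" "v = upper_sharp R K n A \<Omega> \<omega> Y \<rho>'"
        using upper_sharp_onto[OF t, of v n Y] by auto
      show "\<phi> Y (u \<oplus>\<^bsub>Obj (pos_ext_cov R K (Suc n) A) Y\<^esub> v) = \<phi> Y u \<oplus>\<^bsub>Hom K X Y\<^esub> \<phi> Y v"
        using linear_map_add[OF up u(1) v(1)] linear_map_add[OF neg_apply_linear[OF \<psi>] u(1) v(1)]
          \<phi>[OF u(1)] \<phi>[OF v(1)] \<phi>[OF M.a_closed[OF u(1) v(1)]] u v by simp
    qed
    show "\<phi> Z (Map (pos_ext_cov R K (Suc n) A) Y Z f u) = Comp K X Y Z f (\<phi> Y u)"
      if f: "f \<in> mor K Y Z" and u': "u \<in> elts (pos_ext_cov R K (Suc n) A) Y" for Y Z f u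
    proof -
      obtain \<rho> where u: "\<rho> \<in> elts (pos_ext R K n Y) \<Omega>" "u = upper_sharp R K n A \<Omega> \<omega> Y \<rho>"
        using upper_sharp_onto[OF t, of u n Y] u' by auto
      then show ?thesis
        using f \<phi> nat_transD(3)[of \<psi> R K "pos_ext_cov R K n \<Omega>" X f Y Z \<rho>] \<psi>
        by (simp add: pos_push_upper_sharp)
    qed
  qed
  then have in1: "\<phi> \<in> elts (neg_ext R K (Suc n) A) X" by simp
  moreover have "\<psi> = neg_conn R K n A \<Omega> \<omega> \<phi>"
    using in1 \<phi> by (intro neg_eqI[OF \<psi>] neg_conn_closed) auto
  ultimately show thesis by (rule that)
qed


subsection \<open>Degree zero\<close>

definition yoneda :: "'b \<Rightarrow> 'b \<Rightarrow> 'c \<Rightarrow> 'b \<Rightarrow> ('b, 'c, 'd) pext \<Rightarrow> 'c" where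
  "yoneda X A f = (\<lambda>Y. \<lambda>u\<in>elts (pos_ext_cov R K 0 A) Y. Comp K X A Y (un_Mor u) f)"

lemma yoneda_in:
  assumes f: "f \<in> mor K X A"
  shows "yoneda X A f \<in> elts (neg_ext R K 0 A) X"
proof -
  have "yoneda X A f \<in> nat_trans R K (pos_ext_cov R K 0 A) (hom_cov K X)"
  proof (rule nat_transI)
    show "yoneda X A f Y \<in> extensional (elts (pos_ext_cov R K 0 A) Y)" for Y by (simp add: yoneda_def)
    show "linear_map R (Obj (pos_ext_cov R K 0 A) Y) (Hom K X Y) (yoneda X A f Y)" for Y
    proof -
      interpret H: module R "Hom K A Y" by (rule hom_module)
      show ?thesis using comp_linear_left[OF f, of Y]
        by (auto simp: linear_map_def yoneda_def)
    qed
    show "yoneda X A f Z (Map (pos_ext_cov R K 0 A) Y Z a u) = Comp K X Y Z a (yoneda X A f Y u)"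
      if "a \<in> mor K Y Z" "u \<in> elts (pos_ext_cov R K 0 A) Y" for Y Z a u
      using that f comp_assoc[of f X A _ Y a Z] by (auto simp: yoneda_def)
  qed
  then show ?thesis by simp
qed

lemma yoneda_ident [simp]: "f \<in> mor K X A \<Longrightarrow> yoneda X A f A (Mor (Ident K A)) = f"
  by (simp add: yoneda_def)

lemma neg_0_apply:
  assumes "\<phi> \<in> elts (neg_ext R K 0 A) X" "a \<in> mor K A Y"
  shows "\<phi> Y (Mor a) = Comp K X A Y a (\<phi> A (Mor (Ident K A)))"
  using nat_transD(3)[of \<phi> R K "pos_ext_cov R K 0 A" X a A Y "Mor (Ident K A)"] assms by simp

lemma neg_0_ident_closed [simp, intro]:
  "\<phi> \<in> elts (neg_ext R K 0 A) X \<Longrightarrow> \<phi> A (Mor (Ident K A)) \<in> mor K X A"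
  using linear_map_closed[OF neg_apply_linear[of \<phi> 0 A X A]] by simp

lemma neg_0_eqI:
  assumes "\<phi> \<in> elts (neg_ext R K 0 A) X" "\<psi> \<in> elts (neg_ext R K 0 A) X"
    and "\<phi> A (Mor (Ident K A)) = \<psi> A (Mor (Ident K A))"
  shows "\<phi> = \<psi>"
proof (rule neg_eqI[OF assms(1,2)])
  fix Y u assume "u \<in> elts (pos_ext R K 0 Y) A"
  then obtain a where a: "a \<in> mor K A Y" "u = Mor a" by auto
  show "\<phi> Y u = \<psi> Y u"
    unfolding a(2) neg_0_apply[OF assms(1) a(1)] neg_0_apply[OF assms(2) a(1)] assms(3) ..
qed

lemma neg_push_0_ident:
  assumes "\<phi> \<in> elts (neg_ext R K 0 A) X" "x \<in> mor K A B"
  shows "neg_push R K 0 A B x \<phi> B (Mor (Ident K B)) = Comp K X A B x (\<phi> A (Mor (Ident K A)))"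
  using assms by (simp add: neg_0_apply[OF assms, symmetric])

lemma yoneda_morphism:
  "Mod_morphism R K (neg_ext R K 0 A) (pos_ext R K 0 A) (\<lambda>X \<phi>. Mor (\<phi> A (Mor (Ident K A))))"
  unfolding Mod_morphism_def
proof (intro conjI allI ballI)
  show "linear_map R (Obj (neg_ext R K 0 A) X) (Obj (pos_ext R K 0 A) X) (\<lambda>\<phi>. Mor (\<phi> A (Mor (Ident K A))))" for X
    using neg_0_ident_closed[of _ A X] by (intro linear_mapI) auto
qed auto


subsection \<open>Exactness in negative degrees\<close>

text \<open>
  The induction on \<open>n\<close> carries exactness at the middle term together with the following form of
  exactness at the last term of an s-triangle with extension \<open>x\<^sup>*\<theta>\<close>: the hypothesis \<open>x\<^sub>*\<alpha> = 0\<close>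
  stands in for \<open>(x\<^sup>*\<theta>)\<^sub>\<sharp>\<alpha> = \<theta>\<^sub>\<sharp>(x\<^sub>*\<alpha>) = 0\<close>. It speaks only of \<open>\<bbbE>\<^sub>I\<^sup>-\<^sup>n\<close> and not of the
  connecting map out of it, so it covers degree zero, where that map leads to \<open>\<bbbE>\<close>.
\<close>

definition neg_middle :: "nat \<Rightarrow> bool" where
  "neg_middle n \<longleftrightarrow> (\<forall>A B C x y \<delta> X. \<forall>\<beta>\<in>elts (neg_ext R K n B) X. s_triangle K A B C x y \<delta> \<longrightarrow>
     neg_push R K n B C y \<beta> = neg_zero R K n X C \<longrightarrow>
     (\<exists>\<alpha>\<in>elts (neg_ext R K n A) X. \<beta> = neg_push R K n A B x \<alpha>))"

definition neg_lift :: "nat \<Rightarrow> bool" where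
  "neg_lift n \<longleftrightarrow> (\<forall>F E A B e d x \<theta> X. \<forall>\<alpha>\<in>elts (neg_ext R K n A) X.
     s_triangle K F E A e d (pull K A B F x \<theta>) \<longrightarrow> x \<in> mor K A B \<longrightarrow> \<theta> \<in> carrier (EE K B F) \<longrightarrow>
     neg_push R K n A B x \<alpha> = neg_zero R K n X B \<longrightarrow>
     (\<exists>\<beta>\<in>elts (neg_ext R K n E) X. \<alpha> = neg_push R K n E A d \<beta>))"

lemma neg_push_push_zero:
  assumes tri: "s_triangle K A B C x y \<delta>" and \<alpha>: "\<alpha> \<in> elts (neg_ext R K n A) X"
  shows "neg_push R K n B C y (neg_push R K n A B x \<alpha>) = neg_zero R K n X C"
  using neg_push_comp[OF s_triangleD(1,2)[OF tri] \<alpha>] triangle_comp_zero[OF tri] neg_push_zero_mor[OF \<alpha>]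
  by simp

lemma neg_conn_push_zero:
  assumes tri: "s_triangle K A B C x y \<delta>" and \<beta>: "\<beta> \<in> elts (neg_ext R K (Suc n) B) X"
  shows "neg_conn R K n C A \<delta> (neg_push R K (Suc n) B C y \<beta>) = neg_zero R K n X A"
  using neg_conn_pull_ext[OF s_triangleD(2,3)[OF tri] \<beta>] triangle_pull_zero[OF tri] neg_conn_zero_ext[OF \<beta>]
  by simp

lemma neg_push_conn_zero:
  assumes tri: "s_triangle K A B C x y \<delta>" and \<gamma>: "\<gamma> \<in> elts (neg_ext R K (Suc n) C) X"
  shows "neg_push R K n A B x (neg_conn R K n C A \<delta> \<gamma>) = neg_zero R K n X B"
  using neg_conn_push_ext[OF s_triangleD(1,3)[OF tri] \<gamma>] triangle_push_zero[OF tri] neg_conn_zero_ext[OF \<gamma>]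
  by simp

lemma neg_middle_0: "neg_middle 0"
  unfolding neg_middle_def
proof (intro allI ballI impI)
  fix A B C x y \<delta> X \<beta>
  assume \<beta>: "\<beta> \<in> elts (neg_ext R K 0 B) X" and tri: "s_triangle K A B C x y \<delta>"
    and zero: "neg_push R K 0 B C y \<beta> = neg_zero R K 0 X C"
  note [simp] = s_triangleD[OF tri]
  have "Comp K X B C y (\<beta> B (Mor (Ident K B))) = \<zero>\<^bsub>Hom K X C\<^esub>"
    using neg_push_0_ident[OF \<beta>, of y C] zero by simp
  then obtain a where a: "a \<in> mor K X A" "\<beta> B (Mor (Ident K B)) = Comp K X A B x a"
    using factor_through_inflation[OF tri neg_0_ident_closed[OF \<beta>]] by blast
  have "\<beta> = neg_push R K 0 A B x (yoneda X A a)"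
    using a neg_push_0_ident[OF yoneda_in[OF a(1)], of x B]
    by (intro neg_0_eqI[OF \<beta>] neg_push_closed yoneda_in) simp_all
  then show "\<exists>\<alpha>\<in>elts (neg_ext R K 0 A) X. \<beta> = neg_push R K 0 A B x \<alpha>" using yoneda_in[OF a(1)] by blast
qed

lemma neg_lift_0: "neg_lift 0"
  unfolding neg_lift_def
proof (intro allI ballI impI)
  fix F E A B e d x \<theta> X \<alpha>
  assume \<alpha>: "\<alpha> \<in> elts (neg_ext R K 0 A) X" and tri: "s_triangle K F E A e d (pull K A B F x \<theta>)"
    and x: "x \<in> mor K A B" and \<theta>: "\<theta> \<in> carrier (EE K B F)"
    and zero: "neg_push R K 0 A B x \<alpha> = neg_zero R K 0 X B"
  note [simp] = s_triangleD[OF tri]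
  let ?a = "\<alpha> A (Mor (Ident K A))"
  have "Comp K X A B x ?a = \<zero>\<^bsub>Hom K X B\<^esub>" using neg_push_0_ident[OF \<alpha> x] zero by simp
  then have "pull K X A F ?a (pull K A B F x \<theta>) = \<zero>\<^bsub>EE K X F\<^esub>"
    using pull_comp[OF x neg_0_ident_closed[OF \<alpha>] \<theta>] \<theta> by simp
  then obtain b where b: "b \<in> mor K X E" "?a = Comp K X E A d b"
    using lift_along_deflation[OF tri neg_0_ident_closed[OF \<alpha>]] by blast
  have "\<alpha> = neg_push R K 0 E A d (yoneda X E b)"
    using b neg_push_0_ident[OF yoneda_in[OF b(1)], of d A]
    by (intro neg_0_eqI[OF \<alpha>] neg_push_closed yoneda_in) simp_all
  then show "\<exists>\<beta>\<in>elts (neg_ext R K 0 E) X. \<alpha> = neg_push R K 0 E A d \<beta>" using yoneda_in[OF b(1)] by blast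
qed

text \<open>
  By the lifting hypothesis \<open>\<alpha> = d\<^sub>*\<beta>\<close> with \<open>\<beta>\<close> on the syzygy \<open>E\<close> of \<open>C\<close>. Now \<open>h\<^sub>*j\<^sub>*\<beta> = x\<^sub>*\<alpha> = 0\<close>, so
  \<open>j\<^sub>*\<beta>\<close> comes from some \<open>\<gamma>\<close> on \<open>F\<close>. Subtracting \<open>e\<^sub>*\<gamma>\<close> from \<open>\<beta>\<close> changes nothing on \<open>A\<close> and puts
  \<open>\<beta>\<close> into the kernel of \<open>j\<^sub>*\<close>, which is the image of the connecting map of \<open>\<epsilon>\<close>.
\<close>

lemma neg_exact_first_step:
  assumes mid: "neg_middle n" and lift: "neg_lift n" and tri: "s_triangle K A B C x y \<delta>"
    and \<alpha>: "\<alpha> \<in> elts (neg_ext R K n A) X" and zero: "neg_push R K n A B x \<alpha> = neg_zero R K n X B"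
  shows "\<exists>\<gamma>\<in>elts (neg_ext R K (Suc n) C) X. \<alpha> = neg_conn R K n C A \<delta> \<gamma>"
proof -
  obtain F H g h \<theta> where t: "projective_triangle K F H B g h \<theta>" using ex_projective_triangle .
  obtain E d e j \<epsilon> where d: "d \<in> mor K E A" and e: "e \<in> mor K F E"
    and t': "projective_triangle K E H C j (Comp K H B C y h) \<epsilon>"
    and hj: "Comp K E H B h j = Comp K E A B x d" and je: "Comp K F E H j e = g"
    and t'': "s_triangle K F E A e d (pull K A B F x \<theta>)" and d\<epsilon>: "push K C E A d \<epsilon> = \<delta>"
    by (rule syzygy_triangle[OF tri t])
  note [simp] = s_triangleD[OF tri] projective_triangleD[OF t] projective_triangleD[OF t'] d e
  obtain \<beta> where \<beta>: "\<beta> \<in> elts (neg_ext R K n E) X" "\<alpha> = neg_push R K n E A d \<beta>"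
    using lift \<alpha> t'' zero unfolding neg_lift_def by (meson s_triangleD(1)[OF tri] projective_triangleD(5)[OF t])
  have "neg_push R K n H B h (neg_push R K n E H j \<beta>) = neg_zero R K n X B"
    using neg_push_comp[of j E H h B \<beta> n X] neg_push_comp[of d E A x B \<beta> n X] \<beta> zero hj by simp
  then obtain \<gamma> where \<gamma>: "\<gamma> \<in> elts (neg_ext R K n F) X" "neg_push R K n E H j \<beta> = neg_push R K n F H g \<gamma>"
    using mid projective_triangleD(1)[OF t] neg_push_closed[OF projective_triangleD(3)[OF t'] \<beta>(1)]
    unfolding neg_middle_def by meson
  define \<gamma>' where "\<gamma>' = neg_push R K n F E e \<gamma>"
  have \<gamma>': "\<gamma>' \<in> elts (neg_ext R K n E) X" unfolding \<gamma>'_def using e \<gamma>(1) by (rule neg_push_closed)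
  interpret M: module R "Obj (neg_ext R K n E) X" by (rule neg_module)
  have \<beta>\<gamma>: "\<beta> \<ominus>\<^bsub>Obj (neg_ext R K n E) X\<^esub> \<gamma>' \<in> elts (neg_ext R K n E) X"
    using \<beta>(1) \<gamma>' by (rule M.minus_closed)
  have "neg_push R K n E H j \<beta> = neg_push R K n E H j \<gamma>'"
    using neg_push_comp[of e F E j H \<gamma> n X] \<gamma> je by (simp add: \<gamma>'_def)
  then have "neg_push R K n E H j (\<beta> \<ominus>\<^bsub>Obj (neg_ext R K n E) X\<^esub> \<gamma>') = neg_zero R K n X H"
    using linear_map_minus[OF neg_module neg_module Mod_morphismD(1)[OF neg_push_morphism] \<beta>(1) \<gamma>', of j H]
      module_minus_eq_zero[OF neg_module neg_push_closed[OF _ \<beta>(1)] neg_push_closed[OF _ \<gamma>'], of j H j]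
    by (simp del: nat_fun_sel)
  then obtain \<phi> where \<phi>: "\<phi> \<in> elts (neg_ext R K (Suc n) C) X"
    "\<beta> \<ominus>\<^bsub>Obj (neg_ext R K n E) X\<^esub> \<gamma>' = neg_conn R K n C E \<epsilon> \<phi>"
    using neg_conn_kernel[OF t' \<beta>\<gamma>] by blast
  interpret N: module R "Obj (neg_ext R K n A) X" by (rule neg_module)
  have "neg_push R K n E A d \<gamma>' = neg_zero R K n X A"
    unfolding \<gamma>'_def by (rule neg_push_push_zero[OF t'' \<gamma>(1)])
  then have "neg_push R K n E A d (\<beta> \<ominus>\<^bsub>Obj (neg_ext R K n E) X\<^esub> \<gamma>') = \<alpha>"
    using linear_map_minus[OF neg_module neg_module Mod_morphismD(1)[OF neg_push_morphism[OF d]] \<beta>(1) \<gamma>'] \<beta>(2) \<alpha>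
    by (simp add: N.minus_eq del: nat_fun_sel)
  then have "\<alpha> = neg_conn R K n C A \<delta> \<phi>"
    using neg_conn_push_ext[of d E A \<epsilon> C \<phi> n X] \<phi> d\<epsilon> by (simp del: nat_fun_sel)
  then show ?thesis using \<phi>(1) by blast
qed

text \<open>
  The shift of \<open>\<gamma>\<close> along \<open>\<epsilon>\<close> lies on \<open>E\<close> and dies on \<open>A\<close>, so it comes from some \<open>\<beta>\<close> on \<open>F\<close>. As it also
  dies on \<open>H\<close>, so does \<open>\<beta>\<close>, which is therefore the shift along \<open>\<theta>\<close> of an element over \<open>B\<close>.
\<close>

lemma neg_exact_third_step:
  assumes mid: "neg_middle n" and tri: "s_triangle K A B C x y \<delta>"
    and \<gamma>: "\<gamma> \<in> elts (neg_ext R K (Suc n) C) X" and zero: "neg_conn R K n C A \<delta> \<gamma> = neg_zero R K n X A"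
  shows "\<exists>\<beta>\<in>elts (neg_ext R K (Suc n) B) X. \<gamma> = neg_push R K (Suc n) B C y \<beta>"
proof -
  obtain F H g h \<theta> where t: "projective_triangle K F H B g h \<theta>" using ex_projective_triangle .
  obtain E d e j \<epsilon> where d: "d \<in> mor K E A" and e: "e \<in> mor K F E"
    and t': "projective_triangle K E H C j (Comp K H B C y h) \<epsilon>" and je: "Comp K F E H j e = g"
    and t'': "s_triangle K F E A e d (pull K A B F x \<theta>)" and d\<epsilon>: "push K C E A d \<epsilon> = \<delta>"
    and y\<epsilon>: "pull K B C E y \<epsilon> = push K B F E e \<theta>"
    by (rule syzygy_triangle[OF tri t])
  note [simp] = s_triangleD[OF tri] projective_triangleD[OF t] projective_triangleD[OF t'] d e
  define \<gamma>' where "\<gamma>' = neg_conn R K n C E \<epsilon> \<gamma>"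
  have \<gamma>': "\<gamma>' \<in> elts (neg_ext R K n E) X" unfolding \<gamma>'_def using \<gamma> by (intro neg_conn_closed) simp_all
  have "neg_push R K n E A d \<gamma>' = neg_zero R K n X A"
    using neg_conn_push_ext[of d E A \<epsilon> C \<gamma> n X] zero \<gamma> d\<epsilon> by (simp add: \<gamma>'_def del: nat_fun_sel)
  then obtain \<beta> where \<beta>: "\<beta> \<in> elts (neg_ext R K n F) X" "\<gamma>' = neg_push R K n F E e \<beta>"
    using mid t'' \<gamma>' unfolding neg_middle_def by meson
  have "neg_push R K n F H g \<beta> = neg_zero R K n X H"
    using neg_push_comp[of e F E j H \<beta> n X] \<beta> je neg_push_conn_zero[OF projective_triangleD(1)[OF t'] \<gamma>]
    by (simp add: \<gamma>'_def del: nat_fun_sel)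
  then obtain \<beta>' where \<beta>': "\<beta>' \<in> elts (neg_ext R K (Suc n) B) X" "\<beta> = neg_conn R K n B F \<theta> \<beta>'"
    using neg_conn_kernel[OF t \<beta>(1)] by blast
  have "neg_conn R K n C E \<epsilon> \<gamma> = neg_conn R K n C E \<epsilon> (neg_push R K (Suc n) B C y \<beta>')"
    using neg_conn_pull_ext[of y B C \<epsilon> E \<beta>' n X] neg_conn_push_ext[of e F E \<theta> B \<beta>' n X] \<beta>(2) \<beta>' y\<epsilon>
    by (simp add: \<gamma>'_def del: nat_fun_sel)
  then have "\<gamma> = neg_push R K (Suc n) B C y \<beta>'"
    using \<beta>'(1) by (intro neg_conn_injective[OF t' \<gamma>] neg_push_closed) simp_all
  then show ?thesis using \<beta>'(1) by blast
qed

text \<open>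
  Shifted along \<open>\<theta>\<close>, an element over \<open>B\<close> that dies over \<open>C\<close> becomes one over \<open>F\<close> that dies over \<open>E\<close>.
  Exactness at the first term of \<open>F \<rightarrow> E \<rightarrow> A\<close>, one degree higher, yields the preimage over \<open>A\<close>.
\<close>

lemma neg_middle_step:
  assumes mid: "neg_middle n" and lift: "neg_lift n"
  shows "neg_middle (Suc n)"
  unfolding neg_middle_def
proof (intro allI ballI impI)
  fix A B C x y \<delta> X \<beta>
  assume \<beta>: "\<beta> \<in> elts (neg_ext R K (Suc n) B) X" and tri: "s_triangle K A B C x y \<delta>"
    and zero: "neg_push R K (Suc n) B C y \<beta> = neg_zero R K (Suc n) X C"
  obtain F H g h \<theta> where t: "projective_triangle K F H B g h \<theta>" using ex_projective_triangle .
  obtain E d e j \<epsilon> where d: "d \<in> mor K E A" and e: "e \<in> mor K F E"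
    and t': "projective_triangle K E H C j (Comp K H B C y h) \<epsilon>"
    and t'': "s_triangle K F E A e d (pull K A B F x \<theta>)"
    and y\<epsilon>: "pull K B C E y \<epsilon> = push K B F E e \<theta>"
    by (rule syzygy_triangle[OF tri t])
  note [simp] = s_triangleD[OF tri] projective_triangleD[OF t] projective_triangleD[OF t'] d e
  have \<beta>': "neg_conn R K n B F \<theta> \<beta> \<in> elts (neg_ext R K n F) X" using \<beta> by (intro neg_conn_closed) simp_all
  have "neg_push R K n F E e (neg_conn R K n B F \<theta> \<beta>) = neg_conn R K n C E \<epsilon> (neg_push R K (Suc n) B C y \<beta>)"
    using neg_conn_pull_ext[of y B C \<epsilon> E \<beta> n X] neg_conn_push_ext[of e F E \<theta> B \<beta> n X] \<beta> y\<epsilon>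
    by (simp del: nat_fun_sel)
  also have "\<dots> = neg_zero R K n X E"
    using zero linear_map_zero[OF neg_module neg_module Mod_morphismD(1)[OF neg_conn_morphism[of \<epsilon> C E n]]]
    by (simp del: nat_fun_sel)
  finally obtain \<alpha> where \<alpha>: "\<alpha> \<in> elts (neg_ext R K (Suc n) A) X"
    "neg_conn R K n B F \<theta> \<beta> = neg_conn R K n A F (pull K A B F x \<theta>) \<alpha>"
    using neg_exact_first_step[OF mid lift t'' \<beta>'] by blast
  have "\<beta> = neg_push R K (Suc n) A B x \<alpha>"
    using \<alpha> neg_conn_pull_ext[of x A B \<theta> F \<alpha> n X]
    by (intro neg_conn_injective[OF t \<beta>] neg_push_closed) (simp_all del: nat_fun_sel)
  then show "\<exists>\<alpha>\<in>elts (neg_ext R K (Suc n) A) X. \<beta> = neg_push R K (Suc n) A B x \<alpha>" using \<alpha>(1) by blast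
qed

text \<open>This is exactness at the last term of \<open>F \<rightarrow> E \<rightarrow> A\<close>, because \<open>(x\<^sup>*\<theta>)\<^sub>\<sharp>\<alpha> = \<theta>\<^sub>\<sharp>(x\<^sub>*\<alpha>)\<close>.\<close>

lemma neg_lift_step:
  assumes mid: "neg_middle n"
  shows "neg_lift (Suc n)"
  unfolding neg_lift_def
proof (intro allI ballI impI)
  fix F E A B e d x \<theta> X \<alpha>
  assume \<alpha>: "\<alpha> \<in> elts (neg_ext R K (Suc n) A) X" and tri: "s_triangle K F E A e d (pull K A B F x \<theta>)"
    and x: "x \<in> mor K A B" and \<theta>: "\<theta> \<in> carrier (EE K B F)"
    and zero: "neg_push R K (Suc n) A B x \<alpha> = neg_zero R K (Suc n) X B"
  have "neg_conn R K n A F (pull K A B F x \<theta>) \<alpha> = neg_zero R K n X F"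
    using neg_conn_pull_ext[OF x \<theta> \<alpha>] zero
      linear_map_zero[OF neg_module neg_module Mod_morphismD(1)[OF neg_conn_morphism[OF \<theta>]]]
    by (simp del: nat_fun_sel)
  then show "\<exists>\<beta>\<in>elts (neg_ext R K (Suc n) E) X. \<alpha> = neg_push R K (Suc n) E A d \<beta>"
    using neg_exact_third_step[OF mid tri \<alpha>] by blast
qed

lemma neg_middle_lift: "neg_middle n \<and> neg_lift n"
  by (induction n) (auto simp: neg_middle_0 neg_lift_0 neg_middle_step neg_lift_step)

context
  fixes A B C x y \<delta>
  assumes tri: "s_triangle K A B C x y \<delta>"
begin

lemma neg_ext_exact:
  shows "Mod_exact R K (neg_ext R K n A) (\<lambda>X. neg_push R K n A B x) (neg_ext R K n B)
      (\<lambda>X. neg_push R K n B C y) (neg_ext R K n C)"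
    and "Mod_exact R K (neg_ext R K (Suc n) B) (\<lambda>X. neg_push R K (Suc n) B C y) (neg_ext R K (Suc n) C)
      (\<lambda>X. neg_conn R K n C A \<delta>) (neg_ext R K n A)"
    and "Mod_exact R K (neg_ext R K (Suc n) C) (\<lambda>X. neg_conn R K n C A \<delta>) (neg_ext R K n A)
      (\<lambda>X. neg_push R K n A B x) (neg_ext R K n B)"
proof -
  have mid: "\<exists>\<alpha>\<in>elts (neg_ext R K n A) X. \<beta> = neg_push R K n A B x \<alpha>"
    if "\<beta> \<in> elts (neg_ext R K n B) X" "neg_push R K n B C y \<beta> = neg_zero R K n X C" for X \<beta>
    using neg_middle_lift tri that unfolding neg_middle_def by meson
  note third = neg_exact_third_step[OF conjunct1[OF neg_middle_lift] tri]
  note first = neg_exact_first_step[OF conjunct1[OF neg_middle_lift] conjunct2[OF neg_middle_lift] tri]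
  note base = neg_functor neg_push_morphism neg_conn_morphism s_triangleD[OF tri]
  show "Mod_exact R K (neg_ext R K n A) (\<lambda>X. neg_push R K n A B x) (neg_ext R K n B)
      (\<lambda>X. neg_push R K n B C y) (neg_ext R K n C)"
    by (intro Mod_exactI base neg_push_push_zero[OF tri] mid; assumption)
  show "Mod_exact R K (neg_ext R K (Suc n) B) (\<lambda>X. neg_push R K (Suc n) B C y) (neg_ext R K (Suc n) C)
      (\<lambda>X. neg_conn R K n C A \<delta>) (neg_ext R K n A)"
    by (intro Mod_exactI base neg_conn_push_zero[OF tri] third; assumption)
  show "Mod_exact R K (neg_ext R K (Suc n) C) (\<lambda>X. neg_conn R K n C A \<delta>) (neg_ext R K n A)
      (\<lambda>X. neg_push R K n A B x) (neg_ext R K n B)"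
    by (intro Mod_exactI base neg_push_conn_zero[OF tri] first; assumption)
qed

text \<open>The two sequences are joined at \<open>\<bbbE>\<^sub>I\<^sup>0\<close> by the Yoneda isomorphism.\<close>

lemma neg_pos_exact:
  defines "\<kappa> \<equiv> \<lambda>\<phi>. Mor (neg_conn R K 0 C A \<delta> \<phi> A (Mor (Ident K A)))"
  shows "Mod_exact R K (neg_ext R K (Suc 0) B) (\<lambda>X. neg_push R K (Suc 0) B C y) (neg_ext R K (Suc 0) C)
      (\<lambda>X. \<kappa>) (pos_ext R K 0 A)"
    and "Mod_exact R K (neg_ext R K (Suc 0) C) (\<lambda>X. \<kappa>) (pos_ext R K 0 A)
      (\<lambda>X. pos_push R K 0 X A B x) (pos_ext R K 0 B)"
proof -
  note [simp] = s_triangleD[OF tri]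
  have \<kappa>: "Mod_morphism R K (neg_ext R K (Suc 0) C) (pos_ext R K 0 A) (\<lambda>X. \<kappa>)"
    unfolding \<kappa>_def
    using Mod_morphism_compose[OF neg_conn_morphism[OF s_triangleD(3)[OF tri]] yoneda_morphism] .
  have \<kappa>_zero: "\<kappa> \<phi> = \<zero>\<^bsub>Obj (pos_ext R K 0 A) X\<^esub> \<longleftrightarrow> neg_conn R K 0 C A \<delta> \<phi> = neg_zero R K 0 X A"
    if "\<phi> \<in> elts (neg_ext R K (Suc 0) C) X" for \<phi> X
  proof
    assume "\<kappa> \<phi> = \<zero>\<^bsub>Obj (pos_ext R K 0 A) X\<^esub>"
    then show "neg_conn R K 0 C A \<delta> \<phi> = neg_zero R K 0 X A"
      using that by (intro neg_0_eqI[of _ A X] neg_conn_closed neg_zero_closed) (simp_all add: \<kappa>_def)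
  next
    assume eq: "neg_conn R K 0 C A \<delta> \<phi> = neg_zero R K 0 X A"
    show "\<kappa> \<phi> = \<zero>\<^bsub>Obj (pos_ext R K 0 A) X\<^esub>" unfolding \<kappa>_def eq by simp
  qed
  show "Mod_exact R K (neg_ext R K (Suc 0) B) (\<lambda>X. neg_push R K (Suc 0) B C y) (neg_ext R K (Suc 0) C)
      (\<lambda>X. \<kappa>) (pos_ext R K 0 A)"
  proof (intro Mod_exactI neg_functor pos_ext_functor neg_push_morphism \<kappa> s_triangleD[OF tri])
    show "\<kappa> (neg_push R K (Suc 0) B C y \<beta>) = \<zero>\<^bsub>Obj (pos_ext R K 0 A) X\<^esub>"
      if "\<beta> \<in> elts (neg_ext R K (Suc 0) B) X" for X \<beta>
      using \<kappa>_zero[OF neg_push_closed[OF s_triangleD(2)[OF tri] that]] neg_conn_push_zero[OF tri that] by blast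
    show "\<exists>\<beta>\<in>elts (neg_ext R K (Suc 0) B) X. \<gamma> = neg_push R K (Suc 0) B C y \<beta>"
      if "\<gamma> \<in> elts (neg_ext R K (Suc 0) C) X" "\<kappa> \<gamma> = \<zero>\<^bsub>Obj (pos_ext R K 0 A) X\<^esub>" for X \<gamma>
      using neg_exact_third_step[OF conjunct1[OF neg_middle_lift] tri that(1)] \<kappa>_zero[OF that(1)] that(2) by blast
  qed
  show "Mod_exact R K (neg_ext R K (Suc 0) C) (\<lambda>X. \<kappa>) (pos_ext R K 0 A)
      (\<lambda>X. pos_push R K 0 X A B x) (pos_ext R K 0 B)"
  proof (intro Mod_exactI neg_functor pos_ext_functor pos_push_morphism \<kappa> s_triangleD[OF tri])
    show "pos_push R K 0 X A B x (\<kappa> \<phi>) = \<zero>\<^bsub>Obj (pos_ext R K 0 B) X\<^esub>"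
      if "\<phi> \<in> elts (neg_ext R K (Suc 0) C) X" for X \<phi>
      using neg_push_0_ident[OF neg_conn_closed[OF s_triangleD(3)[OF tri] that] s_triangleD(1)[OF tri]]
        neg_push_conn_zero[OF tri that] by (simp add: \<kappa>_def)
    fix X \<alpha> assume \<alpha>: "\<alpha> \<in> elts (pos_ext R K 0 A) X"
      and zero: "pos_push R K 0 X A B x \<alpha> = \<zero>\<^bsub>Obj (pos_ext R K 0 B) X\<^esub>"
    then obtain a where a: "a \<in> mor K X A" "\<alpha> = Mor a" by auto
    have "neg_push R K 0 A B x (yoneda X A a) = neg_zero R K 0 X B"
      using neg_push_0_ident[OF yoneda_in[OF a(1)], of x B] a zero
      by (intro neg_0_eqI[of _ B X] neg_push_closed yoneda_in neg_zero_closed) simp_all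
    then obtain \<phi> where \<phi>: "\<phi> \<in> elts (neg_ext R K (Suc 0) C) X" "yoneda X A a = neg_conn R K 0 C A \<delta> \<phi>"
      using neg_exact_first_step[OF conjunct1[OF neg_middle_lift] conjunct2[OF neg_middle_lift] tri yoneda_in[OF a(1)]]
      by blast
    have "\<alpha> = \<kappa> \<phi>" using a yoneda_ident[OF a(1)] unfolding \<kappa>_def \<phi>(2)[symmetric] by simp
    then show "\<exists>\<phi>\<in>elts (neg_ext R K (Suc 0) C) X. \<alpha> = \<kappa> \<phi>" using \<phi>(1) by blast
  qed
qed

end

end


section \<open>The long exact sequence in all degrees\<close>

lemma ext_I_nonneg:
  assumes "n \<ge> 0"
  shows "ext_I R K n A = transport Nonneg un_Nonneg (pos_ext R K (nat n) A)"
    and "ext_I_push R K n A B x = (\<lambda>X \<xi>. Nonneg (pos_push R K (nat n) X A B x (un_Nonneg \<xi>)))"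
    and "ext_I_conn R K n C A \<delta> = (\<lambda>X \<xi>. Nonneg (lower_sharp R K (nat n) C A \<delta> X (un_Nonneg \<xi>)))"
  using assms by (simp_all add: ext_I_def transport_def fun_eq_iff ext_I_push_def ext_I_conn_def)

lemma ext_I_neg:
  assumes "n < 0"
  shows "ext_I R K n A = transport Neg un_Neg (neg_ext R K (nat (- n)) A)"
    and "ext_I_push R K n A B x = (\<lambda>X \<xi>. Neg (neg_push R K (nat (- n)) A B x (un_Neg \<xi>)))"
    and "n \<noteq> -1 \<Longrightarrow>
      ext_I_conn R K n C A \<delta> = (\<lambda>X \<xi>. Neg (neg_conn R K (nat (- n - 1)) C A \<delta> (un_Neg \<xi>)))"
    and "n = -1 \<Longrightarrow> ext_I_conn R K n C A \<delta> =
      (\<lambda>X \<xi>. Nonneg (Mor (neg_conn R K 0 C A \<delta> (un_Neg \<xi>) A (Mor (Ident K A)))))"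
  using assms
  by (simp_all add: ext_I_def transport_def nat_fun_def fun_eq_iff ext_I_push_def neg_push_def
      ext_I_conn_def neg_conn_def Let_def)

theorem theorem5p8:
  fixes R :: "'r ring" and K :: "('r, 'o, 'm, 'e) ecat"
  assumes "extriangulated_category R K"
    and "enough_projective_morphisms K"
  shows "ext_I_delta_functor R K"
  unfolding ext_I_delta_functor_def
proof (intro allI impI)
  fix A B C x y \<delta> and n :: int
  assume tri: "s_triangle K A B C x y \<delta>"
  interpret enough_projectives R K
    using assms by (intro enough_projectives.intro enough_projectives_axioms.intro)
  let ?thesis = "Mod_exact R K (ext_I R K n A) (ext_I_push R K n A B x) (ext_I R K n B)
      (ext_I_push R K n B C y) (ext_I R K n C) \<and>
    Mod_exact R K (ext_I R K n B) (ext_I_push R K n B C y) (ext_I R K n C)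
      (ext_I_conn R K n C A \<delta>) (ext_I R K (n + 1) A) \<and>
    Mod_exact R K (ext_I R K n C) (ext_I_conn R K n C A \<delta>) (ext_I R K (n + 1) A)
      (ext_I_push R K (n + 1) A B x) (ext_I R K (n + 1) B)"
  consider "n \<ge> 0" | "n = -1" | "n < -1" by linarith
  then show ?thesis
  proof cases
    case 1
    then have n: "nat (n + 1) = Suc (nat n)" "n + 1 \<ge> 0" by auto
    show ?thesis
      unfolding ext_I_nonneg[OF 1] ext_I_nonneg[OF n(2)] n(1)
      by (intro conjI transport_exact pos_ext_exact[OF tri]) simp_all
  next
    case 2
    then have n: "n < 0" "n + 1 \<ge> 0" "nat (- n) = Suc 0" "nat (n + 1) = 0" by auto
    show ?thesis
      unfolding ext_I_neg(1,2)[OF n(1)] ext_I_neg(4)[OF n(1) 2] ext_I_nonneg[OF n(2)] n(3,4)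
      by (intro conjI transport_exact neg_ext_exact[OF tri] neg_pos_exact[OF tri]) simp_all
  next
    case 3
    then have n: "n < 0" "n + 1 < 0" "n \<noteq> -1" by auto
    have k: "nat (- n) = Suc (nat (- n - 1))" "nat (- (n + 1)) = nat (- n - 1)" using 3 by auto
    show ?thesis
      unfolding ext_I_neg(1,2)[OF n(1)] ext_I_neg(3)[OF n(1,3)] ext_I_neg(1,2)[OF n(2)] k
      by (intro conjI transport_exact neg_ext_exact[OF tri]) simp_all
  qed
qed

end
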